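(* Let $(X,\mathcal{F},\Lambda)$ and $(Y,\mathcal{G},\Delta)$ be measurable laminations with transverse invariant measures satisfying the standing assumptions of the context, and let $\Gamma$ be $\mathbb{R}$, $\mathbb{C}$ or a measurable subgroup of one of them. Let $f,g:(X,\mathcal{F},\Lambda)\to(Y,\mathcal{G},\Delta)$ be comparable countable-to-one MT-maps that are MT-homotopic in the following sense: there exists a countable-to-one MT-map $H:(X\times\mathbb{R},\mathcal{F}\times\mathbb{R},\Lambda)\to(Y,\mathcal{G},\Delta)$ with $H(x,0)=f(x)$ and $H(x,1)=g(x)$ for all $x\in X$, where $\mathcal{F}\times\mathbb{R}$ denotes the measurable lamination with leaves $L\times\mathbb{R}$, $L\in\mathcal{F}$ (such an $H$ is then also comparable). Then $f^*$ and $g^*$ induce the same homomorphism $L^2_\Delta H^n_{\mathrm{MT}}(\mathcal{G},\Gamma)\to L^2_\Lambda H^n_{\mathrm{MT}}(\mathcal{F},\Gamma)$ in singular $L^2$-cohomology, for all $n$.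
   Context: An MT-space is a set equipped with a $\sigma$-algebra and a topology (the $\sigma$-algebra need not be the Borel $\sigma$-algebra of the topology). Measure-theoretic terms refer to the $\sigma$-algebra, topological terms to the topology. An MT-map is a measurable continuous map; an MT-isomorphism is a measurable isomorphism that is also a homeomorphism. A standard Borel space is a measurable space isomorphic to a Borel subset of a Polish space. For a Polish space $P$ and a standard Borel space $T$, $P\times T$ is an MT-space with the $\sigma$-algebra generated by products of Borel sets and the product of the topology of $P$ with the discrete topology on $T$. A measurable chart on an MT-space $X$ is an MT-isomorphism $\varphi:U\to P\times T$, where $U\subset X$ is open and measurable, $T$ is a standard Borel space and $P$ is a locally compact, connected, locally path connected Polish space; its plaques are the sets $\varphi^{-1}(P\times\{t\})$ and its associated transversals the sets $\varphi^{-1}(\{x\}\times T)$. A measurable atlas is a countable family of measurable charts whose domains cover $X$. A measurable lamination is an MT-space admitting a measurable atlas; its leaves are its connected components. A measurable atlas is regular if for each of its charts $(U,\varphi)$ there is a measurable chart $(W,\psi)$ such that the closure of each plaque of $U$ is compact, $\overline U\subset W$, $\overline U$ is measurable and $\varphi=\psi|_U$, and if for every two charts of the atlas each plaque of the first meets at most one plaque of the second. A transversal is a measurable subset meeting each leaf in a countable set; it is complete if it meets every leaf. A measurable holonomy transformation is a measurable isomorphism between transversals mapping each point to a point of the same leaf. A transverse invariant measure $\Lambda$ is a $\sigma$-additive map from the family of transversals to $[0,\infty]$ invariant under measurable holonomy transformations. On $\mathcal{F}\times\mathbb{R}$, $\Lambda$ denotes the transverse invariant measure induced by $\Lambda$ (a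 transversal of $\mathcal{F}\times\mathbb{R}$ on which the projection to $X$ is injective has the $\Lambda$-measure of its projection). Standing assumptions on $(\mathcal{F},\Lambda)$ (and likewise on $(\mathcal{G},\Delta)$): there is a finite regular measurable atlas such that the transversal associated to each chart has finite measure, and there is a Riemannian metric on the leaves varying measurably on the ambient space. Fix a complete transversal $T$ of $\mathcal{F}$. An elementary measurable singular $n$-simplex relative to $T$ is an MT-map $\sigma:\Delta^n\times T_\sigma\to\mathcal{F}$ with $T_\sigma\subset T$ Borel and $\sigma(\Delta^n\times\{t\})\subset L_t$ (the leaf through $t$) for all $t\in T_\sigma$; here $\Delta^n$ is the canonical $n$-simplex. An elementary $n$-cochain is a map $\omega$ assigning to each elementary $n$-simplex $\sigma$ a measurable map $\omega(\sigma):T\to\Gamma$ supported in $T_\sigma$, such that $\omega(\sigma|_{\Delta^n\times S})=\omega(\sigma)\cdot\chi_S$ for every measurable $S\subset T_\sigma$, and $\omega(\sigma\circ(\mathrm{id}\times h))=\omega(\sigma)\circ h$ (on $A$, and $0$ off $A$) for every measurable holonomy transformation $h:A\to B$ between measurable subsets $A\subset T$, $B\subset T_\sigma$. The coboundary is the usual alternating sum of values on the $(n-1)$-dimensional faces of $\sigma$ (restricted to $\partial\Delta^n\times T_\sigma$). If $\Lambda(T)<\infty$, a singular $L^2$-cochain is the equivalence class of an elementary cochain $\omega$ with $\int_{T_\sigma}|\omega(\sigma)(t)|^2\,d\Lambda(t)<\infty$ for every elementary simplex $\sigma$ relative to $T$, two cochains being equivalent when their values agree $\Lambda$-almost everywhere.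 These form a cochain complex, whose cohomology is $L^2_\Lambda H^n_{\mathrm{MT}}(\mathcal{F},\Gamma)$; groups for different complete transversals of finite measure are identified through the maps induced by restricting cochains to elementary simplices relative to a smaller transversal. An MT-map $f:\mathcal{F}\to\mathcal{G}$ is countable-to-one if $f^{-1}(L)$ is a countable union of leaves of $\mathcal{F}$ for every leaf $L$ of $\mathcal{G}$. A countable-to-one MT-map $f:(\mathcal{F},\Lambda)\to(\mathcal{G},\Delta)$ is comparable if there are complete transversals $T$ of $\mathcal{F}$ and $T'$ of $\mathcal{G}$ with $\Lambda(T),\Delta(T')<\infty$, $f(T)\subset T'$ and $f:T\to T'$ injective. Comparable maps induce homomorphisms $f^*$ in singular $L^2$-cohomology by $(f^*\omega)(\sigma)(t)=\omega\big(f\circ\sigma\circ(\mathrm{id}\times (f|_{T_\sigma})^{-1})\big)(f(t))$ for $t\in T_\sigma$.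
   Formalization: The equality of f^* and g^* is stated for transversals on which their formulas map L²-cochains to L²-cochains and equivalent ones to equivalent ones; comparability alone does not ensure this (identity of S¹×[0,1], Λ Lebesgue, Δ=0). *)

theory Defs
  imports "HOL-Analysis.Analysis" "HOL-Algebra.Coset" "HOL-Homology.Simplices"
begin

section \<open>MT-spaces\<close>

text \<open>Only the \<sigma>-algebra of the first component is used; the measure it happens to carry
  is irrelevant.\<close>

record 'a mt_space =
  mt_meas :: "'a measure"
  mt_top :: "'a topology"

definition is_mt_space :: "'a mt_space \<Rightarrow> bool" where
  "is_mt_space F \<longleftrightarrow> space (mt_meas F) = topspace (mt_top F)"

definition mt_map :: "'a mt_space \<Rightarrow> 'b mt_space \<Rightarrow> ('a \<Rightarrow> 'b) \<Rightarrow> bool" where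
  "mt_map F G f \<longleftrightarrow> f \<in> measurable (mt_meas F) (mt_meas G) \<and> continuous_map (mt_top F) (mt_top G) f"

definition measurable_isomorphism :: "'a measure \<Rightarrow> 'b measure \<Rightarrow> ('a \<Rightarrow> 'b) \<Rightarrow> bool" where
  "measurable_isomorphism M N h \<longleftrightarrow>
     h \<in> measurable M N \<and> bij_betw h (space M) (space N) \<and>
     inv_into (space M) h \<in> measurable N M"

definition mt_isomorphism :: "'a mt_space \<Rightarrow> 'b mt_space \<Rightarrow> ('a \<Rightarrow> 'b) \<Rightarrow> bool" where
  "mt_isomorphism F G f \<longleftrightarrow>
     measurable_isomorphism (mt_meas F) (mt_meas G) f \<and> homeomorphic_map (mt_top F) (mt_top G) f"

definition mt_subspace :: "'a mt_space \<Rightarrow> 'a set \<Rightarrow> 'a mt_space" where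
  "mt_subspace F U = \<lparr>mt_meas = restrict_space (mt_meas F) U, mt_top = subtopology (mt_top F) U\<rparr>"

definition borel_of :: "'a topology \<Rightarrow> 'a measure" where
  "borel_of P = sigma (topspace P) {U. openin P U}"

definition polish_topology :: "'a topology \<Rightarrow> bool" where
  "polish_topology P \<longleftrightarrow> completely_metrizable_space P \<and> separable_space P"

text \<open>A Polish space has at most continuum many points, so up to homeomorphism it is given by an
  (arbitrary, not necessarily Euclidean) topology on some set of reals. This is why quantifying
  over topologies on the type \<^typ>\<open>real\<close> covers all Polish spaces, here and in the atlases below;
  the same applies to standard Borel spaces.\<close>

definition standard_borel_space :: "'a measure \<Rightarrow> bool" where
  "standard_borel_space M \<longleftrightarrow>
     (\<exists>(P :: real topology) B h. polish_topology P \<and> B \<in> sets (borel_of P) \<and>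
        measurable_isomorphism M (restrict_space (borel_of P) B) h)"

definition mt_product :: "'p topology \<Rightarrow> 't measure \<Rightarrow> ('p \<times> 't) mt_space" where
  "mt_product P T = \<lparr>mt_meas = borel_of P \<Otimes>\<^sub>M T,
                     mt_top = prod_topology P (discrete_topology (space T))\<rparr>"


section \<open>Measurable laminations\<close>

record ('a, 'p, 't) mt_chart =
  chart_dom :: "'a set"
  chart_map :: "'a \<Rightarrow> 'p \<times> 't"
  chart_plaque :: "'p topology"
  chart_trans :: "'t measure"

definition measurable_chart :: "'a mt_space \<Rightarrow> ('a, 'p, 't) mt_chart \<Rightarrow> bool" where
  "measurable_chart F c \<longleftrightarrow>
     openin (mt_top F) (chart_dom c) \<and> chart_dom c \<in> sets (mt_meas F) \<and>
     polish_topology (chart_plaque c) \<and> locally_compact_space (chart_plaque c) \<and>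
     connected_space (chart_plaque c) \<and> locally_path_connected_space (chart_plaque c) \<and>
     standard_borel_space (chart_trans c) \<and>
     mt_isomorphism (mt_subspace F (chart_dom c)) (mt_product (chart_plaque c) (chart_trans c))
       (chart_map c)"

definition plaques :: "('a, 'p, 't) mt_chart \<Rightarrow> 'a set set" where
  "plaques c = (\<lambda>t. {y \<in> chart_dom c. snd (chart_map c y) = t}) ` space (chart_trans c)"

definition chart_transversals :: "('a, 'p, 't) mt_chart \<Rightarrow> 'a set set" where
  "chart_transversals c =
     (\<lambda>x. {y \<in> chart_dom c. fst (chart_map c y) = x}) ` topspace (chart_plaque c)"

definition measurable_atlas :: "'a mt_space \<Rightarrow> ('a, 'p, 't) mt_chart set \<Rightarrow> bool" where
  "measurable_atlas F \<A> \<longleftrightarrow>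
     countable \<A> \<and> (\<forall>c\<in>\<A>. measurable_chart F c) \<and>
     (\<Union>c\<in>\<A>. chart_dom c) = topspace (mt_top F)"

definition measurable_lamination :: "'a mt_space \<Rightarrow> bool" where
  "measurable_lamination F \<longleftrightarrow>
     is_mt_space F \<and> (\<exists>\<A> :: ('a, real, real) mt_chart set. measurable_atlas F \<A>)"

definition leaf :: "'a mt_space \<Rightarrow> 'a \<Rightarrow> 'a set" where
  "leaf F x = connected_component_of_set (mt_top F) x"

definition leaves :: "'a mt_space \<Rightarrow> 'a set set" where
  "leaves F = connected_components_of (mt_top F)"

definition regular_atlas :: "'a mt_space \<Rightarrow> ('a, real, real) mt_chart set \<Rightarrow> bool" where
  "regular_atlas F \<A> \<longleftrightarrow>
     measurable_atlas F \<A> \<and>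
     (\<forall>c\<in>\<A>. \<exists>w :: ('a, real, real) mt_chart. measurable_chart F w \<and>
        (\<forall>p\<in>plaques c. compactin (mt_top F) (mt_top F closure_of p)) \<and>
        mt_top F closure_of chart_dom c \<subseteq> chart_dom w \<and>
        mt_top F closure_of chart_dom c \<in> sets (mt_meas F) \<and>
        (\<forall>y\<in>chart_dom c. chart_map c y = chart_map w y)) \<and>
     (\<forall>c\<in>\<A>. \<forall>c'\<in>\<A>. \<forall>p\<in>plaques c. \<forall>q\<in>plaques c'. \<forall>q'\<in>plaques c'.
        p \<inter> q \<noteq> {} \<longrightarrow> p \<inter> q' \<noteq> {} \<longrightarrow> q = q')"


section \<open>Transversals and transverse invariant measures\<close>

definition transversal :: "'a mt_space \<Rightarrow> 'a set \<Rightarrow> bool" where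
  "transversal F A \<longleftrightarrow> A \<in> sets (mt_meas F) \<and> (\<forall>L\<in>leaves F. countable (A \<inter> L))"

definition complete_transversal :: "'a mt_space \<Rightarrow> 'a set \<Rightarrow> bool" where
  "complete_transversal F A \<longleftrightarrow> transversal F A \<and> (\<forall>L\<in>leaves F. A \<inter> L \<noteq> {})"

definition holonomy_transformation ::
    "'a mt_space \<Rightarrow> 'a set \<Rightarrow> 'a set \<Rightarrow> ('a \<Rightarrow> 'a) \<Rightarrow> bool" where
  "holonomy_transformation F A B h \<longleftrightarrow>
     transversal F A \<and> transversal F B \<and>
     measurable_isomorphism (restrict_space (mt_meas F) A) (restrict_space (mt_meas F) B) h \<and>
     (\<forall>x\<in>A. h x \<in> leaf F x)"

definition transverse_invariant_measure :: "'a mt_space \<Rightarrow> ('a set \<Rightarrow> ennreal) \<Rightarrow> bool" where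
  "transverse_invariant_measure F \<Lambda> \<longleftrightarrow>
     positive (Collect (transversal F)) \<Lambda> \<and> countably_additive (Collect (transversal F)) \<Lambda> \<and>
     (\<forall>A B h. holonomy_transformation F A B h \<longrightarrow> \<Lambda> A = \<Lambda> B)"

text \<open>The measure that \<open>\<Lambda>\<close> induces on the measurable subsets of a transversal \<open>T\<close>.\<close>

definition transverse_measure :: "'a mt_space \<Rightarrow> ('a set \<Rightarrow> ennreal) \<Rightarrow> 'a set \<Rightarrow> 'a measure" where
  "transverse_measure F \<Lambda> T = measure_of T {A \<in> sets (mt_meas F). A \<subseteq> T} \<Lambda>"

text \<open>The lamination \<open>F \<times> \<real>\<close>: its connected components are the sets \<open>L \<times> \<real>\<close>.\<close>

definition times_line :: "'a mt_space \<Rightarrow> ('a \<times> real) mt_space" where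
  "times_line F = \<lparr>mt_meas = mt_meas F \<Otimes>\<^sub>M borel, mt_top = prod_topology (mt_top F) euclidean\<rparr>"

text \<open>\<open>\<Lambda>'\<close> is the transverse invariant measure on \<open>F \<times> \<real>\<close> induced by \<open>\<Lambda>\<close>. It is determined by its
  values on transversals with injective projection, since every transversal of \<open>F \<times> \<real>\<close> meets
  each \<open>{x} \<times> \<real>\<close> in a countable set and so is a countable disjoint union of such ones.\<close>

definition line_induced_measure ::
    "'a mt_space \<Rightarrow> ('a set \<Rightarrow> ennreal) \<Rightarrow> (('a \<times> real) set \<Rightarrow> ennreal) \<Rightarrow> bool" where
  "line_induced_measure F \<Lambda> \<Lambda>' \<longleftrightarrow>
     transverse_invariant_measure (times_line F) \<Lambda>' \<and>
     (\<forall>A. transversal (times_line F) A \<and> inj_on fst A \<longrightarrow> \<Lambda>' A = \<Lambda> (fst ` A))"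


section \<open>Measurable leafwise Riemannian metrics\<close>

text \<open>\<open>\<real>\<^sup>d\<close> is \<^term>\<open>Euclidean_space d\<close>, whose points are the \<^typ>\<open>nat \<Rightarrow> real\<close> vanishing from index
  \<open>d\<close> on. The following notions are meant for open subsets \<open>V\<close> of it.\<close>

definition partial_deriv :: "nat \<Rightarrow> ((nat \<Rightarrow> real) \<Rightarrow> real) \<Rightarrow> (nat \<Rightarrow> real) \<Rightarrow> real" where
  "partial_deriv i f p = deriv (\<lambda>s. f (p(i := s))) (p i)"

primrec C_k_on :: "nat \<Rightarrow> nat \<Rightarrow> (nat \<Rightarrow> real) set \<Rightarrow> ((nat \<Rightarrow> real) \<Rightarrow> real) \<Rightarrow> bool" where
  "C_k_on 0 d V f \<longleftrightarrow> continuous_map (subtopology (Euclidean_space d) V) euclideanreal f"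
| "C_k_on (Suc k) d V f \<longleftrightarrow>
     continuous_map (subtopology (Euclidean_space d) V) euclideanreal f \<and>
     (\<forall>i<d. (\<forall>p\<in>V. (\<lambda>s. f (p(i := s))) differentiable (at (p i))) \<and>
            C_k_on k d V (partial_deriv i f))"

definition smooth_on :: "nat \<Rightarrow> (nat \<Rightarrow> real) set \<Rightarrow> ((nat \<Rightarrow> real) \<Rightarrow> real) \<Rightarrow> bool" where
  "smooth_on d V f \<longleftrightarrow> (\<forall>k. C_k_on k d V f)"

definition chart_inv :: "('a, 'p, 't) mt_chart \<Rightarrow> 'p \<times> 't \<Rightarrow> 'a" where
  "chart_inv c = inv_into (chart_dom c) (chart_map c)"

text \<open>The \<open>k\<close>-th leafwise coordinate of the change of charts from \<open>c\<close> to \<open>c'\<close>, on the slice of \<open>c\<close>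
  over \<open>t\<close>, and the part of that slice where it is defined.\<close>

definition transition_coord ::
    "('a, 'p, 't) mt_chart \<Rightarrow> ('a, nat \<Rightarrow> real, 't) mt_chart \<Rightarrow> 't \<Rightarrow> nat \<Rightarrow> 'p \<Rightarrow> real" where
  "transition_coord c c' t k p = fst (chart_map c' (chart_inv c (p, t))) k"

definition transition_dom ::
    "('a, 'p, 't) mt_chart \<Rightarrow> ('a, 'q, 't) mt_chart \<Rightarrow> 't \<Rightarrow> 'p set" where
  "transition_dom c c' t = {p \<in> topspace (chart_plaque c). chart_inv c (p, t) \<in> chart_dom c'}"

text \<open>A leafwise smooth structure: a measurable atlas whose plaques are open sets of \<open>\<real>\<^sup>d\<close> (with \<open>d\<close>
  allowed to depend on the chart) and whose changes of charts are smooth along the plaques. Their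
  leafwise derivatives are automatically measurable on the ambient space.\<close>

definition leafwise_smooth_atlas ::
    "'a mt_space \<Rightarrow> ('a, nat \<Rightarrow> real, real) mt_chart set \<Rightarrow>
     (('a, nat \<Rightarrow> real, real) mt_chart \<Rightarrow> nat) \<Rightarrow> bool" where
  "leafwise_smooth_atlas F \<C> d \<longleftrightarrow>
     measurable_atlas F \<C> \<and>
     (\<forall>c\<in>\<C>. \<exists>V. openin (Euclidean_space (d c)) V \<and>
        chart_plaque c = subtopology (Euclidean_space (d c)) V) \<and>
     (\<forall>c\<in>\<C>. \<forall>c'\<in>\<C>. \<forall>t\<in>space (chart_trans c). \<forall>k<d c'.
        smooth_on (d c) (transition_dom c c' t) (transition_coord c c' t k))"

text \<open>\<open>g c y\<close> is the coefficient matrix, in the chart \<open>c\<close>, of the metric tensor at the point \<open>y\<close>.\<close>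

definition measurable_riemannian_metric ::
    "'a mt_space \<Rightarrow> ('a, nat \<Rightarrow> real, real) mt_chart set \<Rightarrow>
     (('a, nat \<Rightarrow> real, real) mt_chart \<Rightarrow> nat) \<Rightarrow>
     (('a, nat \<Rightarrow> real, real) mt_chart \<Rightarrow> 'a \<Rightarrow> nat \<Rightarrow> nat \<Rightarrow> real) \<Rightarrow> bool" where
  "measurable_riemannian_metric F \<C> d g \<longleftrightarrow>
     (\<forall>c\<in>\<C>. \<forall>i<d c. \<forall>j<d c.
        (\<lambda>y. g c y i j) \<in> borel_measurable (restrict_space (mt_meas F) (chart_dom c)) \<and>
        (\<forall>t\<in>space (chart_trans c).
           smooth_on (d c) (topspace (chart_plaque c)) (\<lambda>p. g c (chart_inv c (p, t)) i j))) \<and>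
     (\<forall>c\<in>\<C>. \<forall>y\<in>chart_dom c.
        (\<forall>i<d c. \<forall>j<d c. g c y i j = g c y j i) \<and>
        (\<forall>v :: nat \<Rightarrow> real. (\<exists>i<d c. v i \<noteq> 0) \<longrightarrow>
           (\<Sum>i<d c. \<Sum>j<d c. g c y i j * v i * v j) > 0)) \<and>
     (\<forall>c\<in>\<C>. \<forall>c'\<in>\<C>. \<forall>y\<in>chart_dom c \<inter> chart_dom c'. \<forall>i<d c. \<forall>j<d c.
        let p = fst (chart_map c y); t = snd (chart_map c y) in
        g c y i j = (\<Sum>k<d c'. \<Sum>l<d c'. partial_deriv i (transition_coord c c' t k) p *
                                        partial_deriv j (transition_coord c c' t l) p * g c' y k l))"

definition standing_assumptions :: "'a mt_space \<Rightarrow> ('a set \<Rightarrow> ennreal) \<Rightarrow> bool" where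
  "standing_assumptions F \<Lambda> \<longleftrightarrow>
     measurable_lamination F \<and> transverse_invariant_measure F \<Lambda> \<and>
     (\<exists>\<A>. finite \<A> \<and> regular_atlas F \<A> \<and> (\<forall>c\<in>\<A>. \<forall>A\<in>chart_transversals c. \<Lambda> A < \<infinity>)) \<and>
     (\<exists>\<C> d g. leafwise_smooth_atlas F \<C> d \<and> measurable_riemannian_metric F \<C> d g)"


section \<open>Elementary simplices and cochains\<close>

text \<open>The canonical simplex is \<^const>\<open>standard_simplex\<close>. An elementary simplex is a pair \<open>(S, \<sigma>)\<close>
  with \<open>S = T\<^sub>\<sigma>\<close>; \<open>\<sigma>\<close> is made \<^const>\<open>undefined\<close> outside \<open>\<Delta>\<^sup>n \<times> S\<close> so that equality of pairs is
  equality of simplices.\<close>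

type_synonym 'a elem_simplex = "'a set \<times> ((nat \<Rightarrow> real) \<times> 'a \<Rightarrow> 'a)"

definition simplex_topology :: "nat \<Rightarrow> (nat \<Rightarrow> real) topology" where
  "simplex_topology n = subtopology (powertop_real UNIV) (standard_simplex n)"

definition elementary_simplex :: "'a mt_space \<Rightarrow> 'a set \<Rightarrow> nat \<Rightarrow> 'a elem_simplex \<Rightarrow> bool" where
  "elementary_simplex F T n s \<longleftrightarrow> (case s of (S, \<sigma>) \<Rightarrow>
     S \<subseteq> T \<and> S \<in> sets (mt_meas F) \<and> \<sigma> \<in> extensional (standard_simplex n \<times> S) \<and>
     mt_map (mt_product (simplex_topology n) (restrict_space (mt_meas F) S)) F \<sigma> \<and>
     (\<forall>t\<in>S. \<sigma> ` (standard_simplex n \<times> {t}) \<subseteq> leaf F t))"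

definition simplex_restrict :: "nat \<Rightarrow> 'a set \<Rightarrow> 'a elem_simplex \<Rightarrow> 'a elem_simplex" where
  "simplex_restrict n S' s = (S', restrict (snd s) (standard_simplex n \<times> S'))"

text \<open>\<open>\<sigma> \<circ> (id \<times> h)\<close>, with \<open>h\<close> defined on \<open>A\<close>.\<close>

definition simplex_reparam ::
    "nat \<Rightarrow> 'a set \<Rightarrow> ('a \<Rightarrow> 'a) \<Rightarrow> 'a elem_simplex \<Rightarrow> 'a elem_simplex" where
  "simplex_reparam n A h s = (A, restrict (\<lambda>(x, t). snd s (x, h t)) (standard_simplex n \<times> A))"

text \<open>The \<open>i\<close>-th face, of dimension \<open>n\<close>, of an \<open>(n + 1)\<close>-simplex.\<close>

definition elem_face :: "nat \<Rightarrow> nat \<Rightarrow> 'a elem_simplex \<Rightarrow> 'a elem_simplex" where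
  "elem_face n i s =
     (fst s, restrict (\<lambda>(x, t). snd s (simplical_face i x, t)) (standard_simplex n \<times> fst s))"

text \<open>The coefficients \<open>\<Gamma>\<close> are a measurable subgroup of a type of class \<^class>\<open>real_normed_field\<close>;
  by the Gelfand--Mazur theorem the instances of this class are, up to isomorphism, exactly \<open>\<real>\<close> and
  \<open>\<complex>\<close>.\<close>

definition measurable_subgroup :: "'k::real_normed_field set \<Rightarrow> bool" where
  "measurable_subgroup \<Gamma> \<longleftrightarrow> \<Gamma> \<in> sets borel \<and> 0 \<in> \<Gamma> \<and> (\<forall>a\<in>\<Gamma>. \<forall>b\<in>\<Gamma>. a - b \<in> \<Gamma>)"

text \<open>A cochain is a function of all pairs \<open>(S, \<sigma>)\<close> and all points, but only its values on elementary
  simplices relative to \<open>T\<close> matter; those values are extended by \<open>0\<close> off \<open>T\<close>.\<close>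

type_synonym ('a, 'k) cochain = "'a elem_simplex \<Rightarrow> 'a \<Rightarrow> 'k"

definition elementary_cochain ::
    "'a mt_space \<Rightarrow> 'a set \<Rightarrow> 'k::real_normed_field set \<Rightarrow> nat \<Rightarrow> ('a, 'k) cochain \<Rightarrow> bool" where
  "elementary_cochain F T \<Gamma> n \<omega> \<longleftrightarrow>
     (\<forall>s. elementary_simplex F T n s \<longrightarrow>
        \<omega> s \<in> borel_measurable (restrict_space (mt_meas F) T) \<and>
        (\<forall>t. \<omega> s t \<in> \<Gamma>) \<and> (\<forall>t. t \<notin> fst s \<longrightarrow> \<omega> s t = 0) \<and>
        (\<forall>S'\<in>sets (mt_meas F). S' \<subseteq> fst s \<longrightarrow>
           \<omega> (simplex_restrict n S' s) = (\<lambda>t. \<omega> s t * indicator S' t)) \<and>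
        (\<forall>A B h. A \<subseteq> T \<and> B \<subseteq> fst s \<and> holonomy_transformation F A B h \<longrightarrow>
           \<omega> (simplex_reparam n A h s) = (\<lambda>t. if t \<in> A then \<omega> s (h t) else 0)))"

definition coboundary :: "nat \<Rightarrow> ('a, 'k::real_normed_field) cochain \<Rightarrow> ('a, 'k) cochain" where
  "coboundary n \<omega> s t = (\<Sum>i\<le>Suc n. (-1) ^ i * \<omega> (elem_face n i s) t)"


section \<open>Singular \<open>L\<^sup>2\<close>-cohomology\<close>

text \<open>Representatives of singular \<open>L\<^sup>2\<close>-cochains, and their equivalence.\<close>

definition l2_cochain ::
    "'a mt_space \<Rightarrow> ('a set \<Rightarrow> ennreal) \<Rightarrow> 'a set \<Rightarrow> 'k::real_normed_field set \<Rightarrow> nat \<Rightarrow>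
     ('a, 'k) cochain \<Rightarrow> bool" where
  "l2_cochain F \<Lambda> T \<Gamma> n \<omega> \<longleftrightarrow>
     elementary_cochain F T \<Gamma> n \<omega> \<and>
     (\<forall>s. elementary_simplex F T n s \<longrightarrow>
        (\<integral>\<^sup>+ t\<in>fst s. ennreal ((norm (\<omega> s t))\<^sup>2) \<partial>transverse_measure F \<Lambda> T) < \<infinity>)"

definition cochain_equiv ::
    "'a mt_space \<Rightarrow> ('a set \<Rightarrow> ennreal) \<Rightarrow> 'a set \<Rightarrow> nat \<Rightarrow>
     ('a, 'k::real_normed_field) cochain \<Rightarrow> ('a, 'k) cochain \<Rightarrow> bool" where
  "cochain_equiv F \<Lambda> T n \<omega> \<omega>' \<longleftrightarrow>
     (\<forall>s. elementary_simplex F T n s \<longrightarrow> (AE t in transverse_measure F \<Lambda> T. \<omega> s t = \<omega>' s t))"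

definition l2_cocycle_group ::
    "'a mt_space \<Rightarrow> ('a set \<Rightarrow> ennreal) \<Rightarrow> 'a set \<Rightarrow> 'k::real_normed_field set \<Rightarrow> nat \<Rightarrow>
     ('a, 'k) cochain monoid" where
  "l2_cocycle_group F \<Lambda> T \<Gamma> n =
     \<lparr>carrier = {\<omega>. l2_cochain F \<Lambda> T \<Gamma> n \<omega> \<and>
                    cochain_equiv F \<Lambda> T (Suc n) (coboundary n \<omega>) (\<lambda>s t. 0)},
      mult = (\<lambda>\<omega> \<omega>' s t. \<omega> s t + \<omega>' s t),
      one = (\<lambda>s t. 0)\<rparr>"

text \<open>The \<open>L\<^sup>2\<close>-cocycles representing a coboundary. Factoring them out of the cocycles identifies
  equivalent cochains and passes to cohomology in one step.\<close>

definition l2_coboundaries ::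
    "'a mt_space \<Rightarrow> ('a set \<Rightarrow> ennreal) \<Rightarrow> 'a set \<Rightarrow> 'k::real_normed_field set \<Rightarrow> nat \<Rightarrow>
     ('a, 'k) cochain set" where
  "l2_coboundaries F \<Lambda> T \<Gamma> n =
     {\<omega> \<in> carrier (l2_cocycle_group F \<Lambda> T \<Gamma> n).
        case n of
          0 \<Rightarrow> cochain_equiv F \<Lambda> T 0 \<omega> (\<lambda>s t. 0)
        | Suc m \<Rightarrow> \<exists>\<eta>. l2_cochain F \<Lambda> T \<Gamma> m \<eta> \<and> cochain_equiv F \<Lambda> T n \<omega> (coboundary m \<eta>)}"

definition l2_cohomology ::
    "'a mt_space \<Rightarrow> ('a set \<Rightarrow> ennreal) \<Rightarrow> 'a set \<Rightarrow> 'k::real_normed_field set \<Rightarrow> nat \<Rightarrow>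
     ('a, 'k) cochain set monoid" where
  "l2_cohomology F \<Lambda> T \<Gamma> n = l2_cocycle_group F \<Lambda> T \<Gamma> n Mod l2_coboundaries F \<Lambda> T \<Gamma> n"

text \<open>The map on cohomology induced by restricting cochains to the simplices relative to a smaller
  transversal \<open>T\<close>. A simplex relative to \<open>T\<close> is also one relative to the larger transversal, so on
  representatives the restriction is the identity.\<close>

definition l2_restrict ::
    "'a mt_space \<Rightarrow> ('a set \<Rightarrow> ennreal) \<Rightarrow> 'k::real_normed_field set \<Rightarrow> nat \<Rightarrow> 'a set \<Rightarrow>
     ('a, 'k) cochain set \<Rightarrow> ('a, 'k) cochain set" where
  "l2_restrict F \<Lambda> \<Gamma> n T c = l2_coboundaries F \<Lambda> T \<Gamma> n <#>\<^bsub>l2_cocycle_group F \<Lambda> T \<Gamma> n\<^esub> c"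

text \<open>The identification of the groups for two complete transversals: classes correspond when they
  are restrictions of one class relative to the union of the two. For \<open>T1 = T2\<close> this is equality.\<close>

definition l2_identified ::
    "'a mt_space \<Rightarrow> ('a set \<Rightarrow> ennreal) \<Rightarrow> 'k::real_normed_field set \<Rightarrow> nat \<Rightarrow> 'a set \<Rightarrow> 'a set \<Rightarrow>
     ('a, 'k) cochain set \<Rightarrow> ('a, 'k) cochain set \<Rightarrow> bool" where
  "l2_identified F \<Lambda> \<Gamma> n T1 T2 c1 c2 \<longleftrightarrow>
     (\<exists>e \<in> carrier (l2_cohomology F \<Lambda> (T1 \<union> T2) \<Gamma> n).
        l2_restrict F \<Lambda> \<Gamma> n T1 e = c1 \<and> l2_restrict F \<Lambda> \<Gamma> n T2 e = c2)"


section \<open>Comparable maps and homotopies\<close>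

definition countable_to_one :: "'a mt_space \<Rightarrow> 'b mt_space \<Rightarrow> ('a \<Rightarrow> 'b) \<Rightarrow> bool" where
  "countable_to_one F G f \<longleftrightarrow>
     mt_map F G f \<and>
     (\<forall>L\<in>leaves G. \<exists>K\<subseteq>leaves F. countable K \<and> f -` L \<inter> topspace (mt_top F) = \<Union>K)"

definition comparison_transversals ::
    "'a mt_space \<Rightarrow> ('a set \<Rightarrow> ennreal) \<Rightarrow> 'b mt_space \<Rightarrow> ('b set \<Rightarrow> ennreal) \<Rightarrow> ('a \<Rightarrow> 'b) \<Rightarrow>
     'a set \<Rightarrow> 'b set \<Rightarrow> bool" where
  "comparison_transversals F \<Lambda> G \<Delta> f T T' \<longleftrightarrow>
     complete_transversal F T \<and> complete_transversal G T' \<and> \<Lambda> T < \<infinity> \<and> \<Delta> T' < \<infinity> \<and>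
     f ` T \<subseteq> T' \<and> inj_on f T"

definition comparable ::
    "'a mt_space \<Rightarrow> ('a set \<Rightarrow> ennreal) \<Rightarrow> 'b mt_space \<Rightarrow> ('b set \<Rightarrow> ennreal) \<Rightarrow> ('a \<Rightarrow> 'b) \<Rightarrow> bool" where
  "comparable F \<Lambda> G \<Delta> f \<longleftrightarrow>
     countable_to_one F G f \<and> (\<exists>T T'. comparison_transversals F \<Lambda> G \<Delta> f T T')"

definition mt_homotopy ::
    "'a mt_space \<Rightarrow> 'b mt_space \<Rightarrow> ('a \<Rightarrow> 'b) \<Rightarrow> ('a \<Rightarrow> 'b) \<Rightarrow> ('a \<times> real \<Rightarrow> 'b) \<Rightarrow> bool" where
  "mt_homotopy F G f g H \<longleftrightarrow>
     countable_to_one (times_line F) G H \<and>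
     (\<forall>x\<in>topspace (mt_top F). H (x, 0) = f x \<and> H (x, 1) = g x)"

text \<open>\<open>f \<circ> \<sigma> \<circ> (id \<times> (f|S)\<inverse>)\<close>, for \<open>f\<close> injective on \<open>S = T\<^sub>\<sigma>\<close>.\<close>

definition simplex_push :: "nat \<Rightarrow> ('a \<Rightarrow> 'b) \<Rightarrow> 'a elem_simplex \<Rightarrow> 'b elem_simplex" where
  "simplex_push n f s =
     (f ` fst s, restrict (\<lambda>(x, u). f (snd s (x, inv_into (fst s) f u)))
                   (standard_simplex n \<times> f ` fst s))"

definition pullback :: "nat \<Rightarrow> ('a \<Rightarrow> 'b) \<Rightarrow> ('b, 'k::real_normed_field) cochain \<Rightarrow> ('a, 'k) cochain" where
  "pullback n f \<omega> s t = (if t \<in> fst s then \<omega> (simplex_push n f s) (f t) else 0)"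

text \<open>The formula for \<open>f\<^sup>*\<close> defines a map of \<open>L\<^sup>2\<close>-cochain complexes: it takes \<open>L\<^sup>2\<close>-cochains to
  \<open>L\<^sup>2\<close>-cochains and equivalent ones to equivalent ones. Injectivity of \<open>f\<close> between the transversals
  does not relate \<open>\<Lambda>\<close> to \<open>\<Delta>\<close> and so does not by itself give this: for the identity map of a compact
  product \<open>S\<^sup>1 \<times> [0,1]\<close> it fails if \<open>\<Delta> = 0\<close> and \<open>\<Lambda>\<close> is Lebesgue measure.\<close>

definition l2_pullback_defined ::
    "'a mt_space \<Rightarrow> ('a set \<Rightarrow> ennreal) \<Rightarrow> 'b mt_space \<Rightarrow> ('b set \<Rightarrow> ennreal) \<Rightarrow>
     'k::real_normed_field set \<Rightarrow> ('a \<Rightarrow> 'b) \<Rightarrow> 'a set \<Rightarrow> 'b set \<Rightarrow> bool" where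
  "l2_pullback_defined F \<Lambda> G \<Delta> \<Gamma> f T T' \<longleftrightarrow>
     (\<forall>m \<omega>. l2_cochain G \<Delta> T' \<Gamma> m \<omega> \<longrightarrow> l2_cochain F \<Lambda> T \<Gamma> m (pullback m f \<omega>)) \<and>
     (\<forall>m \<omega> \<omega>'. l2_cochain G \<Delta> T' \<Gamma> m \<omega> \<and> l2_cochain G \<Delta> T' \<Gamma> m \<omega>' \<and>
        cochain_equiv G \<Delta> T' m \<omega> \<omega>' \<longrightarrow>
        cochain_equiv F \<Lambda> T m (pullback m f \<omega>) (pullback m f \<omega>'))"

text \<open>\<open>f\<^sup>*\<close> on cohomology, relative to the transversal \<open>T\<close> of the source: the coset of the
  coboundaries containing the pullbacks of the representatives of \<open>c\<close>.\<close>

definition l2_induced ::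
    "'a mt_space \<Rightarrow> ('a set \<Rightarrow> ennreal) \<Rightarrow> 'a set \<Rightarrow> 'k::real_normed_field set \<Rightarrow> nat \<Rightarrow>
     ('a \<Rightarrow> 'b) \<Rightarrow> ('b, 'k) cochain set \<Rightarrow> ('a, 'k) cochain set" where
  "l2_induced F \<Lambda> T \<Gamma> n f c =
     l2_coboundaries F \<Lambda> T \<Gamma> n <#>\<^bsub>l2_cocycle_group F \<Lambda> T \<Gamma> n\<^esub> (pullback n f ` c)"

end

theory Submission
  imports Defs
begin

text \<open>For a simplex \<open>\<sigma>\<close> over \<open>S\<close> and a leafwise injection \<open>\<theta>\<close> of \<open>S\<close> into a transversal of \<open>G\<close>, the prism
  \<open>H \<circ> (\<sigma> \<times> id)\<close> reparametrised by \<open>\<theta>\<^sup>-\<^sup>1\<close> decomposes into elementary simplices of \<open>G\<close>, and the usual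
  alternating sum is a cochain homotopy. As the transversals for \<open>f\<close> and \<open>g\<close> differ, \<open>\<theta>\<close> is taken on their
  union \<open>T\<close> to be \<open>f\<close> on the transversal of \<open>f\<close> and \<open>g\<close> on the rest. It is not injective on \<open>T\<close>, but the
  two parts are treated separately and match by holonomy invariance. The class of the cocycle obtained
  from \<open>H(\<cdot>, 0)\<close> on \<open>T\<close> restricts to \<open>f\<^sup>*\<close> and, by the homotopy, to \<open>g\<^sup>*\<close>.

  The prism pieces are not pushforwards of simplices by \<open>f\<close> or \<open>g\<close>, so square-integrability of their values
  is not immediate. It follows by applying \<open>f\<^sup>*\<close> to a \<open>0\<close>-cochain that, on the constant simplex, takes the
  values of the given cochain on an arbitrary simplex.\<close>

section \<open>MT-spaces, leaves and holonomy\<close>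

text \<open>Nothing is known about how \<open>\<Lambda>\<close> compares with
  \<open>\<Delta>\<close> beyond \<open>l2_pullback_defined\<close> for \<open>f\<close> and for
  \<open>g\<close>; the homotopy \<open>H\<close> brings no such bound. So a simplex pushed through
  \<open>H\<close> has to be parametrised by values of \<open>f\<close> on \<open>Tf\<close> or of
  \<open>g\<close> on \<open>Tg\<close>, never by values of \<open>H\<close> at another time. This
  is possible because a parametrising point only has to lie on the right leaf:
  \<open>{t} \<times> \<real>\<close> is connected, so \<open>H (t, 0)\<close> and
  \<open>g t = H (t, 1)\<close> are on one leaf of \<open>G\<close>, and even the slice of
  \<open>H\<close> at time 0 can be parametrised by \<open>g t\<close>. This matters on
  \<open>Tg - Tf\<close>, where \<open>f\<close> may fail to be injective. The union of the
  transversals is forced by \<open>l2_identified\<close>, which asks for one class on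
  \<open>Tf \<union> Tg\<close> restricting to both images.\<close>

lemma mt_space_eq: "is_mt_space F \<Longrightarrow> space (mt_meas F) = topspace (mt_top F)"
  by (simp add: is_mt_space_def)

lemma measurable_isomorphismI:
  assumes "h \<in> measurable M N" and "k \<in> measurable N M"
    and "\<And>x. x \<in> space M \<Longrightarrow> k (h x) = x" and "\<And>y. y \<in> space N \<Longrightarrow> h (k y) = y"
  shows "measurable_isomorphism M N h"
proof -
  have bij: "bij_betw h (space M) (space N)"
    by (rule bij_betw_byWitness[where f' = k])
      (use assms in \<open>auto dest: measurable_space\<close>)
  have "inv_into (space M) h y = k y" if "y \<in> space N" for y
    using that assms bij by (metis bij_betw_def inv_into_f_eq measurable_space)
  then have "inv_into (space M) h \<in> measurable N M"
    using assms(2) by (subst measurable_cong[where g = k]) auto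
  then show ?thesis
    using bij assms(1) by (simp add: measurable_isomorphism_def)
qed

lemma measurable_isomorphism_compose:
  assumes "measurable_isomorphism M N h" and "measurable_isomorphism N K k"
  shows "measurable_isomorphism M K (\<lambda>x. k (h x))"
proof (rule measurable_isomorphismI[where k = "\<lambda>y. inv_into (space M) h (inv_into (space N) k y)"])
  show "(\<lambda>x. k (h x)) \<in> measurable M K"
    by (rule measurable_compose[where N = N]) (use assms in \<open>auto simp: measurable_isomorphism_def\<close>)
  show "(\<lambda>y. inv_into (space M) h (inv_into (space N) k y)) \<in> measurable K M"
    by (rule measurable_compose[where N = N]) (use assms in \<open>auto simp: measurable_isomorphism_def\<close>)
  fix x assume x: "x \<in> space M"
  then show "inv_into (space M) h (inv_into (space N) k (k (h x))) = x"
    using assms unfolding measurable_isomorphism_def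
    by (metis bij_betw_apply bij_betw_inv_into_left)
next
  fix y assume x: "y \<in> space K"
  then show "k (h (inv_into (space M) h (inv_into (space N) k y))) = y"
    using assms unfolding measurable_isomorphism_def
    by (metis bij_betw_apply bij_betw_inv_into bij_betw_inv_into_right)
qed

lemma measurable_isomorphism_inv:
  assumes "measurable_isomorphism M N h"
  shows "measurable_isomorphism N M (inv_into (space M) h)"
  by (rule measurable_isomorphismI[where k = h])
    (use assms in \<open>auto simp: measurable_isomorphism_def bij_betw_inv_into_left bij_betw_inv_into_right\<close>)

text \<open>The image of \<open>E\<close> is its preimage under the inverse map, which is measurable
  by the definition of an isomorphism.\<close>

lemma measurable_isomorphism_restrict:
  assumes iso: "measurable_isomorphism (restrict_space M A) (restrict_space N B) h"
    and A: "A \<in> sets M" and B: "B \<in> sets N" and E: "E \<in> sets M" "E \<subseteq> A"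
  shows "h ` E \<in> sets N"
    and "measurable_isomorphism (restrict_space M E) (restrict_space N (h ` E)) h"
proof -
  have sp: "space (restrict_space M A) = A" "space (restrict_space N B) = B"
    using A B by (auto simp: space_restrict_space dest: sets.sets_into_space)
  have h: "h \<in> measurable (restrict_space M A) (restrict_space N B)" "bij_betw h A B"
    and k: "inv_into A h \<in> measurable (restrict_space N B) (restrict_space M A)"
    using iso sp by (auto simp: measurable_isomorphism_def)
  have eq: "h ` E = inv_into A h -` E \<inter> B"
  proof (intro equalityI subsetI)
    fix y assume "y \<in> h ` E"
    then obtain x where x: "x \<in> E" "y = h x" by blast
    then have "inv_into A h y = x" "y \<in> B"
      using h(2) E(2) by (auto simp: bij_betw_inv_into_left bij_betw_apply)
    with x show "y \<in> inv_into A h -` E \<inter> B" by simp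
  next
    fix y assume "y \<in> inv_into A h -` E \<inter> B"
    then have "h (inv_into A h y) = y" "inv_into A h y \<in> E"
      using h(2) by (auto simp: bij_betw_inv_into_right)
    then show "y \<in> h ` E" by (metis imageI)
  qed
  have "E \<in> sets (restrict_space M A)"
    using E A by (auto simp: sets_restrict_space_iff dest: sets.sets_into_space)
  from measurable_sets[OF k this] have "h ` E \<in> sets (restrict_space N B)"
    by (simp add: eq sp)
  then show hE: "h ` E \<in> sets N"
    using B by (auto simp: sets_restrict_space_iff dest: sets.sets_into_space)
  have hEB: "h ` E \<subseteq> B" using eq by auto
  have M: "h \<in> measurable (restrict_space M E) (restrict_space N (h ` E))"
  proof (rule measurable_restrict_space2)
    show "h \<in> space (restrict_space M E) \<rightarrow> h ` E" by (auto simp: space_restrict_space)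
    have "h \<in> measurable (restrict_space M A) N"
      using h(1) B by (metis measurable_restrict_space2_iff)
    from measurable_restrict_mono[OF this E(2)] show "h \<in> measurable (restrict_space M E) N" .
  qed
  have N: "inv_into A h \<in> measurable (restrict_space N (h ` E)) (restrict_space M E)"
  proof (rule measurable_restrict_space2)
    show "inv_into A h \<in> space (restrict_space N (h ` E)) \<rightarrow> E" using eq by (auto simp: space_restrict_space)
    have "inv_into A h \<in> measurable (restrict_space N B) M"
      using k A by (metis measurable_restrict_space2_iff)
    from measurable_restrict_mono[OF this hEB]
    show "inv_into A h \<in> measurable (restrict_space N (h ` E)) M" .
  qed
  show "measurable_isomorphism (restrict_space M E) (restrict_space N (h ` E)) h"
    by (rule measurable_isomorphismI[OF M N])
      (use h(2) E hEB in \<open>auto simp: space_restrict_space bij_betw_inv_into_left bij_betw_inv_into_right subsetD\<close>)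
qed

lemma measurable_isomorphism_id: "measurable_isomorphism M M (\<lambda>x. x)"
  by (rule measurable_isomorphismI[where k = "\<lambda>x. x"]) auto

lemma leaf_sym: "y \<in> leaf F x \<Longrightarrow> x \<in> leaf F y"
  by (simp add: leaf_def connected_component_of_sym)

lemma leaf_trans: "y \<in> leaf F x \<Longrightarrow> z \<in> leaf F y \<Longrightarrow> z \<in> leaf F x"
  unfolding leaf_def by (metis connected_component_of_trans mem_Collect_eq)

lemma leaf_refl: "x \<in> topspace (mt_top F) \<Longrightarrow> x \<in> leaf F x"
  by (simp add: leaf_def connected_component_of_refl)

lemma leaf_in_topspace: "y \<in> leaf F x \<Longrightarrow> y \<in> topspace (mt_top F)"
  unfolding leaf_def using connected_component_of_subset_topspace by fastforce

lemma leaf_image: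
  assumes "continuous_map (mt_top F) (mt_top G) h" and "y \<in> leaf F x"
  shows "h y \<in> leaf G (h x)"
proof -
  obtain C where C: "connectedin (mt_top F) C" "x \<in> C" "y \<in> C"
    using assms(2) by (auto simp: leaf_def connected_component_of_def)
  have "connectedin (mt_top G) (h ` C)"
    using connectedin_continuous_map_image[OF assms(1) C(1)] .
  then show ?thesis using C by (auto simp: leaf_def connected_component_of_def)
qed

text \<open>Components of a product are products of components, and the line is connected. Hence all
  times of a homotopy over one point stay on one leaf of the target.\<close>

lemma leaf_times_line: "leaf (times_line F) (x, s) = leaf F x \<times> UNIV"
proof -
  have "connected_component_of_set euclideanreal s = UNIV"
    using connected_component_of_maximal[of euclideanreal UNIV s] by (metis UNIV_I connected_UNIV connectedin_iff_connected subset_UNIV subset_antisym)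
  then show ?thesis
    by (simp add: leaf_def times_line_def connected_component_of_pair)
qed

lemma transversal_subset:
  assumes "transversal F T" and "A \<in> sets (mt_meas F)" and "A \<subseteq> T"
  shows "transversal F A"
  using assms unfolding transversal_def by (meson Int_mono countable_subset order_refl)

lemma transversal_Un:
  assumes "transversal F A" and "transversal F B"
  shows "transversal F (A \<union> B)"
  using assms unfolding transversal_def by (auto simp: Int_Un_distrib2)

text \<open>Allows a holonomy transformation to be cut down to the points where both ends lie in
  prescribed measurable sets.\<close>

lemma holonomy_restrict:
  assumes h: "holonomy_transformation F A B h" and E: "E \<in> sets (mt_meas F)" "E \<subseteq> A"
  shows "holonomy_transformation F E (h ` E) h" and "h ` E \<in> sets (mt_meas F)"
proof -
  have A: "A \<in> sets (mt_meas F)" and B: "B \<in> sets (mt_meas F)"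
    and iso: "measurable_isomorphism (restrict_space (mt_meas F) A) (restrict_space (mt_meas F) B) h"
    using h by (auto simp: holonomy_transformation_def transversal_def)
  note R = measurable_isomorphism_restrict[OF iso A B E]
  then show "h ` E \<in> sets (mt_meas F)" by simp
  have "space (restrict_space (mt_meas F) A) = A" "space (restrict_space (mt_meas F) B) = B"
    using A B by (auto simp: space_restrict_space dest: sets.sets_into_space)
  then have "bij_betw h A B"
    using iso by (simp add: measurable_isomorphism_def)
  then have "h ` E \<subseteq> B" using E by (auto simp: bij_betw_def)
  then show "holonomy_transformation F E (h ` E) h"
    using h R E by (auto simp: holonomy_transformation_def intro: transversal_subset)
qed

section \<open>Borel sets of a topology and measurability of points\<close>

lemma space_borel_of [simp]: "space (borel_of P) = topspace P"
  by (auto simp: borel_of_def openin_subset space_measure_of_conv)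

lemma sets_borel_of: "sets (borel_of P) = sigma_sets (topspace P) {U. openin P U}"
  unfolding borel_of_def by (rule sets_measure_of) (auto dest: openin_subset)

lemma sets_borel_of_closed:
  assumes "closedin P C" shows "C \<in> sets (borel_of P)"
proof -
  have "topspace P - C \<in> sets (borel_of P)"
    using assms by (auto simp: sets_borel_of closedin_def intro!: sigma_sets.Basic)
  from sets.compl_sets[OF this] show ?thesis
    using assms by (simp add: closedin_def double_diff)
qed

lemma measurable_borel_of:
  assumes "continuous_map P Q h" shows "h \<in> measurable (borel_of P) (borel_of Q)"
  unfolding borel_of_def[of Q]
proof (rule measurable_measure_of)
  show "{U. openin Q U} \<subseteq> Pow (topspace Q)" by (auto dest: openin_subset)
  show "h \<in> space (borel_of P) \<rightarrow> topspace Q"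
    using assms by (auto simp: continuous_map_def)
  fix U assume "U \<in> {U. openin Q U}"
  then have "openin P {x \<in> topspace P. h x \<in> U}"
    using assms by (auto simp: continuous_map_def)
  moreover have "{x \<in> topspace P. h x \<in> U} = h -` U \<inter> space (borel_of P)" by auto
  ultimately show "h -` U \<inter> space (borel_of P) \<in> sets (borel_of P)"
    by (auto simp: sets_borel_of intro: sigma_sets.Basic)
qed

lemma measurable_borel_of_euclidean:
  assumes "continuous_map P euclidean h" shows "h \<in> borel_measurable (borel_of P)"
proof -
  have "borel = borel_of (euclidean :: 'b topology)"
    by (simp add: borel_def borel_of_def)
  then show ?thesis using measurable_borel_of[OF assms] by simp
qed

text \<open>Points must be measurable so that a simplex can be restricted to a single parameter. In
  a chart the point is a product of two points: one is closed in a Polish space, the other is the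
  preimage of a point under an injection into a Polish space.\<close>

lemma measurable_lamination_singleton:
  assumes "measurable_lamination F" and "y \<in> topspace (mt_top F)"
  shows "{y} \<in> sets (mt_meas F)"
proof -
  obtain \<A> :: "('a, real, real) mt_chart set" where "measurable_atlas F \<A>"
    using assms by (auto simp: measurable_lamination_def)
  then have "y \<in> (\<Union>c\<in>\<A>. chart_dom c)" and "\<forall>c\<in>\<A>. measurable_chart F c"
    using assms(2) by (simp_all add: measurable_atlas_def)
  then obtain c :: "('a, real, real) mt_chart" where c: "measurable_chart F c" "y \<in> chart_dom c"
    by auto
  define U where "U = chart_dom c"
  define P where "P = chart_plaque c"
  define T where "T = chart_trans c"
  define \<phi> where "\<phi> = chart_map c"
  have U: "U \<in> sets (mt_meas F)" "y \<in> U" and P: "polish_topology P" and T: "standard_borel_space T"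
    and \<phi>: "measurable_isomorphism (restrict_space (mt_meas F) U) (borel_of P \<Otimes>\<^sub>M T) \<phi>"
    using c by (auto simp: measurable_chart_def U_def P_def T_def \<phi>_def mt_isomorphism_def mt_subspace_def mt_product_def)
  have single: "{p} \<in> sets (borel_of Q)" if "polish_topology Q" "p \<in> topspace Q" for Q :: "real topology" and p
  proof -
    have "closedin Q {p}"
      using that unfolding polish_topology_def
      by (metis closedin_t1_singleton completely_metrizable_imp_metrizable_space metrizable_imp_t1_space)
    then show ?thesis by (rule sets_borel_of_closed)
  qed
  have spU: "space (restrict_space (mt_meas F) U) = U"
    using U by (auto simp: space_restrict_space dest: sets.sets_into_space)
  have m: "\<phi> \<in> measurable (restrict_space (mt_meas F) U) (borel_of P \<Otimes>\<^sub>M T)" and inj: "inj_on \<phi> U"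
    using \<phi> spU by (auto simp: measurable_isomorphism_def bij_betw_def)
  have "\<phi> y \<in> space (borel_of P \<Otimes>\<^sub>M T)"
    using m U spU by (auto dest: measurable_space)
  then obtain p t where pt: "\<phi> y = (p, t)" "p \<in> topspace P" "t \<in> space T"
    by (auto simp: space_pair_measure)
  have "{t} \<in> sets T"
  proof -
    obtain Q :: "real topology" and B h where Q: "polish_topology Q" "B \<in> sets (borel_of Q)"
      and h: "measurable_isomorphism T (restrict_space (borel_of Q) B) h"
      using T by (auto simp: standard_borel_space_def)
    have hm: "h \<in> measurable T (restrict_space (borel_of Q) B)" and hi: "inj_on h (space T)"
      using h by (auto simp: measurable_isomorphism_def bij_betw_def)
    have ht: "h t \<in> B" "h t \<in> topspace Q"
      using measurable_space[OF hm pt(3)] by (auto simp: space_restrict_space)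
    have "{h t} \<in> sets (restrict_space (borel_of Q) B)"
      unfolding sets_restrict_space
      by (rule image_eqI[OF _ single[OF Q(1) ht(2)]]) (use ht in auto)
    from measurable_sets[OF hm this] have "h -` {h t} \<inter> space T \<in> sets T" .
    moreover have "h -` {h t} \<inter> space T = {t}"
      using inj_on_eq_iff[OF hi _ pt(3)] pt(3) by blast
    ultimately show ?thesis by simp
  qed
  then have "{p} \<times> {t} \<in> sets (borel_of P \<Otimes>\<^sub>M T)"
    using single[OF P pt(2)] by (rule pair_measureI[rotated])
  from measurable_sets[OF m this] have "\<phi> -` ({p} \<times> {t}) \<inter> U \<in> sets (restrict_space (mt_meas F) U)"
    by (simp add: spU)
  moreover have "\<phi> -` ({p} \<times> {t}) \<inter> U = {y}"
    using inj_on_eq_iff[OF inj _ U(2)] pt(1) U(2) by auto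
  ultimately have "{y} \<in> sets (restrict_space (mt_meas F) U)" by simp
  then show ?thesis using U(1) by (subst (asm) sets_restrict_space_iff) auto
qed

section \<open>Transformations of elementary simplices\<close>

lemma topspace_simplex_topology [simp]: "topspace (simplex_topology n) = standard_simplex n"
  by (simp add: simplex_topology_def)

lemma elementary_simplex_iff:
  "elementary_simplex F T n s \<longleftrightarrow>
     fst s \<subseteq> T \<and> fst s \<in> sets (mt_meas F) \<and> snd s \<in> extensional (standard_simplex n \<times> fst s) \<and>
     snd s \<in> measurable (borel_of (simplex_topology n) \<Otimes>\<^sub>M restrict_space (mt_meas F) (fst s)) (mt_meas F) \<and>
     continuous_map (prod_topology (simplex_topology n) (discrete_topology (fst s))) (mt_top F) (snd s) \<and>
     (\<forall>t\<in>fst s. \<forall>x\<in>standard_simplex n. snd s (x, t) \<in> leaf F t)"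
proof -
  have "space (restrict_space (mt_meas F) (fst s)) = fst s" if "fst s \<in> sets (mt_meas F)"
    using that by (auto simp: space_restrict_space dest: sets.sets_into_space)
  then show ?thesis
    by (cases s) (auto simp: elementary_simplex_def mt_map_def mt_product_def image_subset_iff)
qed

lemma elementary_simplexD:
  assumes "elementary_simplex F T n s"
  shows "fst s \<subseteq> T" and "fst s \<in> sets (mt_meas F)"
    and "\<And>x t. x \<in> standard_simplex n \<Longrightarrow> t \<in> fst s \<Longrightarrow> snd s (x, t) \<in> leaf F t"
  using assms by (auto simp: elementary_simplex_iff)

lemma elementary_simplex_mono:
  "elementary_simplex F T n s \<Longrightarrow> fst s \<subseteq> T' \<Longrightarrow> elementary_simplex F T' n s"
  by (auto simp: elementary_simplex_iff)

text \<open>One construction for the faces, restrictions and reparametrisations of a simplex (with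
  \<open>H = fst\<close>), for its pushforwards, and for the pieces of its prism over a homotopy \<open>H\<close>.\<close>

definition simplex_transform ::
    "nat \<Rightarrow> ('a \<times> real \<Rightarrow> 'b) \<Rightarrow> ((nat \<Rightarrow> real) \<Rightarrow> nat \<Rightarrow> real) \<Rightarrow> ((nat \<Rightarrow> real) \<Rightarrow> real) \<Rightarrow>
     'b set \<Rightarrow> ('b \<Rightarrow> 'a) \<Rightarrow> 'a elem_simplex \<Rightarrow> 'b elem_simplex" where
  "simplex_transform m H a b R k s =
     (R, restrict (\<lambda>(x, u). H (snd s (a x, k u), b x)) (standard_simplex m \<times> R))"

lemma fst_simplex_transform [simp]: "fst (simplex_transform m H a b R k s) = R"
  by (simp add: simplex_transform_def)

lemma snd_simplex_transform:
  "x \<in> standard_simplex m \<Longrightarrow> u \<in> R \<Longrightarrow>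
     snd (simplex_transform m H a b R k s) (x, u) = H (snd s (a x, k u), b x)"
  by (simp add: simplex_transform_def)

lemma simplex_transform_cong:
  assumes "R = R'"
    and "\<And>x u. x \<in> standard_simplex m \<Longrightarrow> u \<in> R' \<Longrightarrow>
           H (snd s (a x, k u), b x) = H' (snd s' (a' x, k' u), b' x)"
  shows "simplex_transform m H a b R k s = simplex_transform m H' a' b' R' k' s'"
  using assms by (auto simp: simplex_transform_def intro!: restrict_ext)

text \<open>The new simplex is the composite of \<open>H\<close> with
  \<open>\<sigma> \<circ> (a \<times> k)\<close> paired with \<open>b\<close>. The parameter sets
  are discrete, so \<open>k\<close> is automatically continuous. The leaf condition ranges over the
  whole leaf of \<open>k u\<close> because the simplex over \<open>k u\<close> may take any value
  there.\<close>

lemma elementary_simplex_transform: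
  assumes s: "elementary_simplex F T n s" and H: "mt_map (times_line F) G H"
    and a: "continuous_map (simplex_topology m) (simplex_topology n) a"
    and b: "continuous_map (simplex_topology m) euclideanreal b"
    and R: "R \<in> sets (mt_meas G)" "R \<subseteq> T'"
    and k: "k \<in> measurable (restrict_space (mt_meas G) R) (restrict_space (mt_meas F) (fst s))"
    and leaf: "\<And>u y r. u \<in> R \<Longrightarrow> y \<in> leaf F (k u) \<Longrightarrow> H (y, r) \<in> leaf G u"
  shows "elementary_simplex G T' m (simplex_transform m H a b R k s)"
proof -
  have S: "fst s \<in> sets (mt_meas F)" using s by (simp add: elementary_simplex_iff)
  have spR: "space (restrict_space (mt_meas G) R) = R"
    using R by (auto simp: space_restrict_space dest: sets.sets_into_space)
  have spS: "space (restrict_space (mt_meas F) (fst s)) = fst s"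
    using S by (auto simp: space_restrict_space dest: sets.sets_into_space)
  let ?\<tau> = "\<lambda>p. H (snd s (a (fst p), k (snd p)), b (fst p))"
  have kR: "k u \<in> fst s" if "u \<in> R" for u
    using measurable_space[OF k] that spR spS by auto
  have aD: "a x \<in> standard_simplex n" if "x \<in> standard_simplex m" for x
    using a that by (auto simp: continuous_map_def)
  have sm: "snd s \<in> measurable (borel_of (simplex_topology n) \<Otimes>\<^sub>M restrict_space (mt_meas F) (fst s)) (mt_meas F)"
    using s by (simp add: elementary_simplex_iff)
  have am: "a \<in> measurable (borel_of (simplex_topology m)) (borel_of (simplex_topology n))"
    by (rule measurable_borel_of[OF a])
  have bm: "b \<in> borel_measurable (borel_of (simplex_topology m))"
    by (rule measurable_borel_of_euclidean[OF b])
  let ?D = "borel_of (simplex_topology m) \<Otimes>\<^sub>M restrict_space (mt_meas G) R"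
  have 1: "(\<lambda>p. (a (fst p), k (snd p))) \<in> measurable ?D
      (borel_of (simplex_topology n) \<Otimes>\<^sub>M restrict_space (mt_meas F) (fst s))"
    by (intro measurable_Pair measurable_compose[OF measurable_fst am] measurable_compose[OF measurable_snd k])
  have 2: "(\<lambda>p. (snd s (a (fst p), k (snd p)), b (fst p))) \<in> measurable ?D (mt_meas F \<Otimes>\<^sub>M borel)"
    by (intro measurable_Pair measurable_compose[OF 1 sm] measurable_compose[OF measurable_fst bm])
  have "H \<in> measurable (mt_meas F \<Otimes>\<^sub>M borel) (mt_meas G)"
    using H by (simp add: mt_map_def times_line_def)
  then have 3: "?\<tau> \<in> measurable ?D (mt_meas G)"
    by (rule measurable_compose[OF 2])
  have spD: "space ?D = standard_simplex m \<times> R"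
    by (simp add: space_pair_measure spR)
  have meas: "snd (simplex_transform m H a b R k s) \<in> measurable ?D (mt_meas G)"
    by (subst measurable_cong[where g = ?\<tau>])
      (use 3 in \<open>auto simp: spD simplex_transform_def\<close>)
  let ?X = "prod_topology (simplex_topology m) (discrete_topology R)"
  have cf: "continuous_map ?X (simplex_topology m) fst"
    by (rule continuous_map_fst)
  have ck: "continuous_map ?X (discrete_topology (fst s)) (\<lambda>p. k (snd p))"
    by (rule continuous_map_compose[OF continuous_map_snd, unfolded o_def])
      (auto simp: kR continuous_map_def)
  have c1: "continuous_map ?X (prod_topology (simplex_topology n) (discrete_topology (fst s)))
      (\<lambda>p. (a (fst p), k (snd p)))"
    by (intro continuous_map_paired[THEN iffD2] conjI ck continuous_map_compose[OF cf a, unfolded o_def])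
  have sc: "continuous_map (prod_topology (simplex_topology n) (discrete_topology (fst s))) (mt_top F) (snd s)"
    using s by (simp add: elementary_simplex_iff)
  have c2: "continuous_map ?X (prod_topology (mt_top F) euclideanreal)
      (\<lambda>p. (snd s (a (fst p), k (snd p)), b (fst p)))"
    by (intro continuous_map_paired[THEN iffD2] conjI continuous_map_compose[OF cf b, unfolded o_def]
        continuous_map_compose[OF c1 sc, unfolded o_def])
  have "continuous_map (prod_topology (mt_top F) euclideanreal) (mt_top G) H"
    using H by (simp add: mt_map_def times_line_def)
  from continuous_map_compose[OF c2 this] have 4: "continuous_map ?X (mt_top G) ?\<tau>"
    by (simp add: o_def)
  have cont: "continuous_map ?X (mt_top G) (snd (simplex_transform m H a b R k s))"
    by (rule continuous_map_eq[OF 4]) (auto simp: simplex_transform_def)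
  have "snd (simplex_transform m H a b R k s) (x, u) \<in> leaf G u"
    if "x \<in> standard_simplex m" "u \<in> R" for x u
    using that leaf elementary_simplexD(3)[OF s aD kR] by (simp add: snd_simplex_transform)
  then show ?thesis
    using R meas cont by (auto simp: elementary_simplex_iff simplex_transform_def)
qed

lemma mt_map_fst: "mt_map (times_line F) F fst"
  by (auto simp: mt_map_def times_line_def continuous_map_fst)

lemma simplex_restrict_eq:
  "S \<subseteq> fst s \<Longrightarrow> simplex_restrict n S s = simplex_transform n fst (\<lambda>x. x) (\<lambda>_. 0) S (\<lambda>t. t) s"
  by (auto simp: simplex_restrict_def simplex_transform_def intro!: restrict_ext)

lemma simplex_reparam_eq:
  "simplex_reparam n A h s = simplex_transform n fst (\<lambda>x. x) (\<lambda>_. 0) A h s"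
  by (simp add: simplex_reparam_def simplex_transform_def)

lemma elem_face_eq:
  "elem_face n i s = simplex_transform n fst (simplical_face i) (\<lambda>_. 0) (fst s) (\<lambda>t. t) s"
  by (simp add: elem_face_def simplex_transform_def)

lemma simplex_push_eq:
  "simplex_push n f s =
     simplex_transform n (\<lambda>p. f (fst p)) (\<lambda>x. x) (\<lambda>_. 0) (f ` fst s) (inv_into (fst s) f) s"
  by (simp add: simplex_push_def simplex_transform_def)

lemma fst_simplex_restrict [simp]: "fst (simplex_restrict n S s) = S"
  by (simp add: simplex_restrict_def)

lemma fst_simplex_reparam [simp]: "fst (simplex_reparam n A h s) = A"
  by (simp add: simplex_reparam_def)

lemma fst_elem_face [simp]: "fst (elem_face n i s) = fst s"
  by (simp add: elem_face_def)

lemma fst_simplex_push [simp]: "fst (simplex_push n f s) = f ` fst s"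
  by (simp add: simplex_push_def)

lemma measurable_id_restrict:
  "S \<subseteq> S' \<Longrightarrow> (\<lambda>t. t) \<in> measurable (restrict_space M S) (restrict_space M S')"
  by (rule measurable_restrict_space2) (auto simp: space_restrict_space intro: measurable_restrict_space1)

lemma continuous_simplical_face:
  assumes "i \<le> Suc n"
  shows "continuous_map (simplex_topology n) (simplex_topology (Suc n)) (simplical_face i)"
proof -
  have "simplical_face i \<in> standard_simplex n \<rightarrow> standard_simplex (Suc n)"
    using assms simplical_face_in_standard_simplex[of "Suc n" i] by auto
  then show ?thesis
    unfolding simplex_topology_def
    by (auto simp: continuous_map_in_subtopology continuous_map_componentwise simplical_face_def
        intro!: continuous_map_from_subtopology continuous_map_product_projection)
qed

lemma elementary_simplex_face:
  assumes s: "elementary_simplex F T (Suc n) s" and i: "i \<le> Suc n"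
  shows "elementary_simplex F T n (elem_face n i s)"
  unfolding elem_face_eq
  by (rule elementary_simplex_transform[OF s mt_map_fst continuous_simplical_face[OF i]])
    (use elementary_simplexD[OF s] in \<open>auto intro: measurable_id_restrict\<close>)

lemma elementary_simplex_restrict:
  assumes s: "elementary_simplex F T n s" and S: "S \<in> sets (mt_meas F)" "S \<subseteq> fst s"
  shows "elementary_simplex F T n (simplex_restrict n S s)"
  unfolding simplex_restrict_eq[OF S(2)]
  by (rule elementary_simplex_transform[OF s mt_map_fst])
    (use elementary_simplexD[OF s] S in \<open>auto intro: measurable_id_restrict\<close>)

lemma holonomy_transformation_measurable:
  assumes "holonomy_transformation F A B h" and "B \<subseteq> S"
  shows "h \<in> measurable (restrict_space (mt_meas F) A) (restrict_space (mt_meas F) S)"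
proof -
  have "h \<in> measurable (restrict_space (mt_meas F) A) (restrict_space (mt_meas F) B)"
    using assms by (auto simp: holonomy_transformation_def measurable_isomorphism_def)
  then show ?thesis
    using assms(2) by (auto simp: measurable_restrict_space2_iff)
qed

lemma elementary_simplex_reparam:
  assumes s: "elementary_simplex F T n s" and h: "holonomy_transformation F A B h"
    and AB: "A \<subseteq> T" "B \<subseteq> fst s"
  shows "elementary_simplex F T n (simplex_reparam n A h s)"
  unfolding simplex_reparam_eq
proof (rule elementary_simplex_transform[OF s mt_map_fst])
  show "A \<in> sets (mt_meas F)" using h by (simp add: holonomy_transformation_def transversal_def)
  show "h \<in> measurable (restrict_space (mt_meas F) A) (restrict_space (mt_meas F) (fst s))"
    by (rule holonomy_transformation_measurable[OF h AB(2)])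
  show "fst (y, r) \<in> leaf F u" if "u \<in> A" "y \<in> leaf F (h u)" for u y r
    using that h by (auto simp: holonomy_transformation_def intro: leaf_trans)
qed (use AB in auto)

lemma elementary_cochainD:
  assumes "elementary_cochain F T \<Gamma> n \<omega>" and "elementary_simplex F T n s"
  shows "\<omega> s \<in> borel_measurable (restrict_space (mt_meas F) T)"
    and "\<omega> s t \<in> \<Gamma>" and "t \<notin> fst s \<Longrightarrow> \<omega> s t = 0"
    and "S \<in> sets (mt_meas F) \<Longrightarrow> S \<subseteq> fst s \<Longrightarrow> \<omega> (simplex_restrict n S s) = (\<lambda>t. \<omega> s t * indicator S t)"
    and "A \<subseteq> T \<Longrightarrow> B \<subseteq> fst s \<Longrightarrow> holonomy_transformation F A B h \<Longrightarrow>
           \<omega> (simplex_reparam n A h s) = (\<lambda>t. if t \<in> A then \<omega> s (h t) else 0)"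
  using assms unfolding elementary_cochain_def by blast+

text \<open>Both invariance axioms at once: \<open>r'\<close> restricted to \<open>A\<close> is \<open>r\<close> reparametrised by \<open>h\<close>.\<close>

lemma cochain_value_local:
  assumes \<omega>: "elementary_cochain F T \<Gamma> n \<omega>"
    and r: "elementary_simplex F T n r" and r': "elementary_simplex F T n r'"
    and h: "holonomy_transformation F A B h" and A: "A \<subseteq> fst r'" and B: "B \<subseteq> fst r"
    and eq: "\<And>x u. x \<in> standard_simplex n \<Longrightarrow> u \<in> A \<Longrightarrow> snd r' (x, u) = snd r (x, h u)"
    and u: "u \<in> A"
  shows "\<omega> r' u = \<omega> r (h u)"
proof -
  have "A \<in> sets (mt_meas F)" using h by (simp add: holonomy_transformation_def transversal_def)
  then have "\<omega> (simplex_restrict n A r') u = \<omega> r' u"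
    using u A by (simp add: elementary_cochainD(4)[OF \<omega> r'])
  moreover have "simplex_restrict n A r' = simplex_reparam n A h r"
    by (auto simp: simplex_restrict_def simplex_reparam_def eq intro!: restrict_ext)
  moreover have "\<omega> (simplex_reparam n A h r) u = \<omega> r (h u)"
    using u A B h elementary_simplexD(1)[OF r'] by (subst elementary_cochainD(5)[OF \<omega> r]) auto
  ultimately show ?thesis by simp
qed

lemma simplex_restrict_transform:
  "simplex_restrict m S (simplex_transform m H a b R k s) = simplex_transform m H a b S k s" if "S \<subseteq> R"
  using that by (auto simp: simplex_restrict_def simplex_transform_def simp: restrict_def intro!: ext)

lemma elem_face_transform:
  assumes "i \<le> Suc m"
  shows "elem_face m i (simplex_transform (Suc m) H a b R k s) =
     simplex_transform m H (\<lambda>x. a (simplical_face i x)) (\<lambda>x. b (simplical_face i x)) R k s"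
  using assms simplical_face_in_standard_simplex[of "Suc m" i]
  by (auto simp: elem_face_def simplex_transform_def simp: restrict_def intro!: ext)

lemma transform_elem_face:
  assumes "\<And>u. u \<in> R \<Longrightarrow> k u \<in> fst s" and "\<And>x. x \<in> standard_simplex m \<Longrightarrow> a x \<in> standard_simplex n"
  shows "simplex_transform m H a b R k (elem_face n i s) =
     simplex_transform m H (\<lambda>x. simplical_face i (a x)) b R k s"
  using assms by (auto simp: elem_face_def simplex_transform_def simp: restrict_def intro!: ext)

section \<open>Square-integrable cochains and cohomology\<close>

text \<open>Second countability of the coefficient field gives Borel measurability of sums and
  differences. Asking for a transversal keeps every measurable subset of \<open>T\<close> an
  instance.\<close>

locale l2_complex =
  fixes F :: "'a mt_space" and \<Lambda> :: "'a set \<Rightarrow> ennreal" and T :: "'a set"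
    and \<Gamma> :: "'k::{real_normed_field, second_countable_topology} set"
  assumes mt: "is_mt_space F" and tim: "transverse_invariant_measure F \<Lambda>"
    and T: "transversal F T" and \<Gamma>: "measurable_subgroup \<Gamma>"
begin

lemma T_sets: "T \<in> sets (mt_meas F)"
  using T by (simp add: transversal_def)

lemma T_topspace: "t \<in> T \<Longrightarrow> t \<in> topspace (mt_top F)"
  using sets.sets_into_space[OF T_sets] mt by (auto simp: is_mt_space_def)

lemma l2_complex_subset: "D \<in> sets (mt_meas F) \<Longrightarrow> D \<subseteq> T \<Longrightarrow> l2_complex F \<Lambda> D \<Gamma>"
  using transversal_subset[OF T] mt tim \<Gamma> by (simp add: l2_complex_def)

lemma zero_in: "0 \<in> \<Gamma>"
  and diff_in: "a \<in> \<Gamma> \<Longrightarrow> b \<in> \<Gamma> \<Longrightarrow> a - b \<in> \<Gamma>"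
  using \<Gamma> by (auto simp: measurable_subgroup_def)

abbreviation "\<mu> \<equiv> transverse_measure F \<Lambda> T"

lemma space_transverse_measure: "space \<mu> = T"
  by (auto simp: transverse_measure_def intro!: space_measure_of)

lemma sets_restrict_T: "sets (restrict_space (mt_meas F) T) = {A \<in> sets (mt_meas F). A \<subseteq> T}"
  using T_sets by (auto simp: sets_restrict_space_iff)

lemma space_restrict_T: "space (restrict_space (mt_meas F) T) = T"
  using sets.sets_into_space[OF T_sets] by (auto simp: space_restrict_space)

lemma sets_transverse_measure: "sets \<mu> = {A \<in> sets (mt_meas F). A \<subseteq> T}"
proof -
  have "sets \<mu> = sigma_sets T {A \<in> sets (mt_meas F). A \<subseteq> T}"
    unfolding transverse_measure_def by (rule sets_measure_of) auto
  also have "\<dots> = {A \<in> sets (mt_meas F). A \<subseteq> T}"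
    using sets.sigma_sets_eq[of "restrict_space (mt_meas F) T"]
    by (simp add: sets_restrict_T space_restrict_T)
  finally show ?thesis .
qed

lemma measurable_transverse_measure:
  "h \<in> measurable (restrict_space (mt_meas F) T) N \<Longrightarrow> h \<in> measurable \<mu> N"
  using measurable_cong_sets[of \<mu> "restrict_space (mt_meas F) T" N N]
  by (simp add: sets_restrict_T sets_transverse_measure)

text \<open>\<open>measure_of\<close> has the prescribed values only if these form a measure on the
  generated \<sigma>-algebra. All sets in it are transversals, so the axioms of a transverse
  invariant measure supply this.\<close>

lemma emeasure_transverse_measure:
  assumes "A \<in> sets (mt_meas F)" and "A \<subseteq> T"
  shows "emeasure \<mu> A = \<Lambda> A"
proof (rule emeasure_measure_of[OF transverse_measure_def])
  have sub: "sets \<mu> \<subseteq> Collect (transversal F)"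
    using transversal_subset[OF T] by (auto simp: sets_transverse_measure)
  show "positive (sets \<mu>) \<Lambda>"
    using tim by (simp add: transverse_invariant_measure_def positive_def)
  show "countably_additive (sets \<mu>) \<Lambda>"
    using tim sub unfolding transverse_invariant_measure_def countably_additive_def
    by (meson subset_trans subsetD)
qed (use assms in \<open>auto simp: sets_transverse_measure\<close>)

lemma transverse_measure_restrict:
  assumes D: "D \<in> sets (mt_meas F)" "D \<subseteq> T"
  shows "transverse_measure F \<Lambda> D = restrict_space \<mu> D"
proof (rule measure_eqI)
  interpret D: l2_complex F \<Lambda> D \<Gamma> by (rule l2_complex_subset[OF D])
  have DT: "D \<in> sets \<mu>" using D by (simp add: sets_transverse_measure)
  then show "sets (transverse_measure F \<Lambda> D) = sets (restrict_space \<mu> D)"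
    using D by (auto simp: sets_restrict_space_iff D.sets_transverse_measure sets_transverse_measure)
  fix A assume "A \<in> sets (transverse_measure F \<Lambda> D)"
  then have A: "A \<in> sets (mt_meas F)" "A \<subseteq> D"
    by (auto simp: D.sets_transverse_measure)
  have "emeasure (restrict_space \<mu> D) A = emeasure \<mu> A"
    using DT A by (auto intro: emeasure_restrict_space)
  then show "emeasure (transverse_measure F \<Lambda> D) A = emeasure (restrict_space \<mu> D) A"
    using A D by (simp add: D.emeasure_transverse_measure emeasure_transverse_measure)
qed

lemma AE_subset:
  assumes "D \<in> sets (mt_meas F)" and "D \<subseteq> T"
  shows "(AE t in transverse_measure F \<Lambda> D. P t) \<longleftrightarrow> (AE t in \<mu>. t \<in> D \<longrightarrow> P t)"
  unfolding transverse_measure_restrict[OF assms]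
  using assms by (subst AE_restrict_space_iff) (auto simp: sets_transverse_measure space_transverse_measure Int_absorb2)

lemma nn_integral_subset:
  assumes "D \<in> sets (mt_meas F)" and "D \<subseteq> T" and "S \<subseteq> D"
  shows "(\<integral>\<^sup>+t\<in>S. h t \<partial>transverse_measure F \<Lambda> D) = (\<integral>\<^sup>+t\<in>S. h t \<partial>\<mu>)"
proof -
  have "(\<integral>\<^sup>+t\<in>S. h t \<partial>transverse_measure F \<Lambda> D) = (\<integral>\<^sup>+t. h t * indicator S t * indicator D t \<partial>\<mu>)"
    unfolding transverse_measure_restrict[OF assms(1,2)]
    using assms(1,2) by (subst nn_integral_restrict_space)
      (auto simp: sets_transverse_measure space_transverse_measure Int_absorb2)
  also have "\<dots> = (\<integral>\<^sup>+t\<in>S. h t \<partial>\<mu>)"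
    using assms(3) by (intro nn_integral_cong) (auto split: split_indicator)
  finally show ?thesis .
qed

lemma elementary_simplex_space:
  assumes "elementary_simplex F T n s" shows "fst s \<in> sets \<mu>"
  using elementary_simplexD[OF assms] by (simp add: sets_transverse_measure)

lemma reparam_in:
  assumes "holonomy_transformation F A B h" and "B \<subseteq> S" and "t \<in> A" 
  shows "h t \<in> S"
proof -
  have "A \<in> sets (mt_meas F)" using assms by (simp add: holonomy_transformation_def transversal_def)
  then have "space (restrict_space (mt_meas F) A) = A"
    by (auto simp: space_restrict_space dest: sets.sets_into_space)
  then show ?thesis
    using measurable_space[OF holonomy_transformation_measurable[OF assms(1,2)], of t] assms(3)
    by (auto simp: space_restrict_space)
qed

text \<open>Restrictions and reparametrisations of elementary simplices are again elementary, so the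
  axioms never look at other pairs. Values there can be chosen freely, which
  \<open>elementary_simplex_push\<close> exploits.\<close>

lemma l2_cochain_cong:
  assumes "l2_cochain F \<Lambda> T \<Gamma> n \<omega>" and eq: "\<And>s. elementary_simplex F T n s \<Longrightarrow> \<omega>' s = \<omega> s"
  shows "l2_cochain F \<Lambda> T \<Gamma> n \<omega>'"
  using assms(1) unfolding l2_cochain_def elementary_cochain_def
  by (auto simp: eq elementary_simplex_restrict elementary_simplex_reparam)

lemma l2_cochain_zero: "l2_cochain F \<Lambda> T \<Gamma> n (\<lambda>s t. 0)"
  using zero_in by (auto simp: l2_cochain_def elementary_cochain_def fun_eq_iff)

lemma l2_cochain_measurable:
  assumes "l2_cochain F \<Lambda> T \<Gamma> n \<omega>" and "elementary_simplex F T n s"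
  shows "\<omega> s \<in> borel_measurable \<mu>"
  using assms by (auto simp: l2_cochain_def intro: measurable_transverse_measure elementary_cochainD)

lemma l2_cochain_elementary: "l2_cochain F \<Lambda> T \<Gamma> n \<omega> \<Longrightarrow> elementary_cochain F T \<Gamma> n \<omega>"
  by (simp add: l2_cochain_def)

lemma l2_cochain_finite:
  assumes "l2_cochain F \<Lambda> T \<Gamma> n \<omega>" and "elementary_simplex F T n s"
  shows "(\<integral>\<^sup>+t\<in>fst s. ennreal ((norm (\<omega> s t))\<^sup>2) \<partial>\<mu>) < \<infinity>"
  using assms unfolding l2_cochain_def by blast

text \<open>\<open>measurable_subgroup\<close> is stated through differences, so this is the basic
  closure property; negatives, sums and alternating sums follow from it.\<close>

lemma l2_cochain_diff:
  assumes 1: "l2_cochain F \<Lambda> T \<Gamma> n \<omega>" and 2: "l2_cochain F \<Lambda> T \<Gamma> n \<omega>'"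
  shows "l2_cochain F \<Lambda> T \<Gamma> n (\<lambda>s t. \<omega> s t - \<omega>' s t)"
  unfolding l2_cochain_def
proof (intro conjI allI impI)
  note e = elementary_cochainD[OF l2_cochain_elementary[OF 1]] elementary_cochainD[OF l2_cochain_elementary[OF 2]]
  show "elementary_cochain F T \<Gamma> n (\<lambda>s t. \<omega> s t - \<omega>' s t)"
    unfolding elementary_cochain_def
  proof (intro allI impI conjI ballI)
    fix s assume s: "elementary_simplex F T n s"
    show "(\<lambda>t. \<omega> s t - \<omega>' s t) \<in> borel_measurable (restrict_space (mt_meas F) T)"
      using e[OF s] by simp
    show "\<omega> s t - \<omega>' s t \<in> \<Gamma>" for t
      using e[OF s] by (simp add: diff_in)
    show "\<omega> s t - \<omega>' s t = 0" if "t \<notin> fst s" for t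
      using e(3)[OF s that] e(8)[OF s that] by simp
    show "(\<lambda>t. \<omega> (simplex_restrict n S s) t - \<omega>' (simplex_restrict n S s) t) =
        (\<lambda>t. (\<omega> s t - \<omega>' s t) * indicator S t)" if "S \<in> sets (mt_meas F)" "S \<subseteq> fst s" for S
      using e(4)[OF s that] e(9)[OF s that] by (simp add: algebra_simps)
    show "(\<lambda>t. \<omega> (simplex_reparam n A h s) t - \<omega>' (simplex_reparam n A h s) t) =
        (\<lambda>t. if t \<in> A then \<omega> s (h t) - \<omega>' s (h t) else 0)"
      if "A \<subseteq> T \<and> B \<subseteq> fst s \<and> holonomy_transformation F A B h" for A B h
      using e(5)[OF s, of A B h] e(10)[OF s, of A B h] that by (auto simp: fun_eq_iff)
  qed
  fix s assume s: "elementary_simplex F T n s"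
  have [measurable]: "\<omega> s \<in> borel_measurable \<mu>" "\<omega>' s \<in> borel_measurable \<mu>" "fst s \<in> sets \<mu>"
    using 1 2 s elementary_simplex_space by (auto intro: l2_cochain_measurable)
  have "(norm (a - b))\<^sup>2 \<le> 2 * (norm a)\<^sup>2 + 2 * (norm b)\<^sup>2" for a b :: 'k
  proof -
    have "(norm (a - b))\<^sup>2 \<le> (norm a + norm b)\<^sup>2"
      by (intro power_mono norm_triangle_ineq4) auto
    also have "\<dots> \<le> 2 * (norm a)\<^sup>2 + 2 * (norm b)\<^sup>2"
      using zero_le_power2[of "norm a - norm b"] by (simp add: power2_eq_square algebra_simps)
    finally show ?thesis .
  qed
  then have "ennreal ((norm (a - b))\<^sup>2) \<le> 2 * ennreal ((norm a)\<^sup>2) + 2 * ennreal ((norm b)\<^sup>2)" for a b :: 'k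
    by (auto simp: ennreal_plus[symmetric] ennreal_mult'[symmetric] simp del: ennreal_plus
        simp flip: ennreal_numeral intro!: ennreal_leI)
  then have "(\<integral>\<^sup>+t\<in>fst s. ennreal ((norm (\<omega> s t - \<omega>' s t))\<^sup>2) \<partial>\<mu>)
      \<le> (\<integral>\<^sup>+t. 2 * (ennreal ((norm (\<omega> s t))\<^sup>2) * indicator (fst s) t) + 
              2 * (ennreal ((norm (\<omega>' s t))\<^sup>2) * indicator (fst s) t) \<partial>\<mu>)"
    by (intro nn_integral_mono) (auto split: split_indicator)
  also have "\<dots> = 2 * (\<integral>\<^sup>+t\<in>fst s. ennreal ((norm (\<omega> s t))\<^sup>2) \<partial>\<mu>)
      + 2 * (\<integral>\<^sup>+t\<in>fst s. ennreal ((norm (\<omega>' s t))\<^sup>2) \<partial>\<mu>)"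
    by (subst nn_integral_add) (auto simp: nn_integral_cmult)
  also have "\<dots> < \<infinity>"
    using l2_cochain_finite[OF 1 s] l2_cochain_finite[OF 2 s] by (simp add: ennreal_mult_less_top)
  finally show "(\<integral>\<^sup>+t\<in>fst s. ennreal ((norm (\<omega> s t - \<omega>' s t))\<^sup>2) \<partial>\<mu>) < \<infinity>" .
qed

lemma l2_cochain_minus:
  "l2_cochain F \<Lambda> T \<Gamma> n \<omega> \<Longrightarrow> l2_cochain F \<Lambda> T \<Gamma> n (\<lambda>s t. - \<omega> s t)"
  using l2_cochain_diff[OF l2_cochain_zero] by simp

lemma l2_cochain_add:
  "l2_cochain F \<Lambda> T \<Gamma> n \<omega> \<Longrightarrow> l2_cochain F \<Lambda> T \<Gamma> n \<omega>' \<Longrightarrow>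
     l2_cochain F \<Lambda> T \<Gamma> n (\<lambda>s t. \<omega> s t + \<omega>' s t)"
  using l2_cochain_diff[OF _ l2_cochain_minus, of n \<omega> \<omega>'] by simp

text \<open>\<open>\<Gamma>\<close> is only a group, so general coefficients are excluded; the signs
  are harmless because each term is a cochain or its negative.\<close>

lemma l2_cochain_alternating_sum:
  assumes "finite I" and "\<And>i. i \<in> I \<Longrightarrow> l2_cochain F \<Lambda> T \<Gamma> n (\<omega> i)"
  shows "l2_cochain F \<Lambda> T \<Gamma> n (\<lambda>s t. \<Sum>i\<in>I. (-1) ^ i * \<omega> i s t)"
  using assms
proof (induction I rule: finite_induct)
  case empty
  then show ?case by (simp add: l2_cochain_zero)
next
  case (insert i I)
  then have i: "l2_cochain F \<Lambda> T \<Gamma> n (\<omega> i)" by simp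
  have "l2_cochain F \<Lambda> T \<Gamma> n (\<lambda>s t. (-1) ^ i * \<omega> i s t)"
    using i l2_cochain_minus[OF i] by (cases "even i") simp_all
  then show ?case using insert by (auto intro: l2_cochain_add)
qed

lemma l2_cochain_mono:
  assumes "l2_cochain F \<Lambda> T \<Gamma> n \<omega>" and D: "D \<in> sets (mt_meas F)" "D \<subseteq> T"
  shows "l2_cochain F \<Lambda> D \<Gamma> n \<omega>"
  unfolding l2_cochain_def
proof (intro conjI allI impI)
  have el: "elementary_simplex F T n s" if "elementary_simplex F D n s" for s
    using elementary_simplex_mono[OF that] elementary_simplexD[OF that] D by auto
  note e = elementary_cochainD[OF l2_cochain_elementary[OF assms(1)]]
  show "elementary_cochain F D \<Gamma> n \<omega>"
    unfolding elementary_cochain_def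
  proof (intro allI impI conjI ballI)
    fix s assume s: "elementary_simplex F D n s"
    show "\<omega> s \<in> borel_measurable (restrict_space (mt_meas F) D)"
      using measurable_restrict_mono[OF e(1)[OF el[OF s]]] D e(1)[OF el[OF s]]
      by (metis measurable_compose measurable_id_restrict)
  qed (use e el D in auto)
  fix s assume s: "elementary_simplex F D n s"
  then show "(\<integral>\<^sup>+t\<in>fst s. ennreal ((norm (\<omega> s t))\<^sup>2) \<partial>transverse_measure F \<Lambda> D) < \<infinity>"
    using l2_cochain_finite[OF assms(1) el[OF s]] nn_integral_subset[OF D elementary_simplexD(1)[OF s]]
    by simp
qed

lemma elem_face_restrict:
  assumes "S \<subseteq> fst s" and "i \<le> Suc n"
  shows "elem_face n i (simplex_restrict (Suc n) S s) = simplex_restrict n S (elem_face n i s)"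
  using assms simplical_face_in_standard_simplex[of "Suc n" i]
  by (auto simp: elem_face_def simplex_restrict_def restrict_def intro!: ext)

lemma elem_face_reparam:
  assumes "\<And>t. t \<in> A \<Longrightarrow> h t \<in> fst s" and "i \<le> Suc n"
  shows "elem_face n i (simplex_reparam (Suc n) A h s) = simplex_reparam n A h (elem_face n i s)"
  using assms simplical_face_in_standard_simplex[of "Suc n" i]
  by (auto simp: elem_face_def simplex_reparam_def restrict_def intro!: ext)

text \<open>Faces commute with restriction and reparametrisation, so each face by itself turns an
  \<open>n\<close>-cochain into an \<open>(n + 1)\<close>-cochain. The coboundary is then an
  instance of \<open>l2_cochain_alternating_sum\<close>.\<close>

lemma l2_cochain_face:
  assumes \<omega>: "l2_cochain F \<Lambda> T \<Gamma> n \<omega>" and i: "i \<le> Suc n"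
  shows "l2_cochain F \<Lambda> T \<Gamma> (Suc n) (\<lambda>s. \<omega> (elem_face n i s))"
  unfolding l2_cochain_def
proof (intro conjI allI impI)
  note e = elementary_cochainD[OF l2_cochain_elementary[OF \<omega>] elementary_simplex_face[OF _ i]]
  show "elementary_cochain F T \<Gamma> (Suc n) (\<lambda>s. \<omega> (elem_face n i s))"
    unfolding elementary_cochain_def
  proof (intro allI impI conjI ballI)
    fix s assume s: "elementary_simplex F T (Suc n) s"
    show "\<omega> (elem_face n i (simplex_reparam (Suc n) A h s)) =
      (\<lambda>t. if t \<in> A then \<omega> (elem_face n i s) (h t) else 0)"
      if "A \<subseteq> T \<and> B \<subseteq> fst s \<and> holonomy_transformation F A B h" for A B h
      using e(5)[OF s, of A B h] that reparam_in[of A B h "fst s"]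
      by (subst elem_face_reparam) (auto simp: i)
  qed (use e i in \<open>auto simp: elem_face_restrict\<close>)
  fix s assume "elementary_simplex F T (Suc n) s"
  from elementary_simplex_face[OF this i]
  show "(\<integral>\<^sup>+t\<in>fst s. ennreal ((norm (\<omega> (elem_face n i s) t))\<^sup>2) \<partial>\<mu>) < \<infinity>"
    using l2_cochain_finite[OF \<omega>, of "elem_face n i s"] by simp
qed

lemma l2_cochain_coboundary:
  assumes "l2_cochain F \<Lambda> T \<Gamma> n \<omega>"
  shows "l2_cochain F \<Lambda> T \<Gamma> (Suc n) (coboundary n \<omega>)"
proof -
  have "coboundary n \<omega> = (\<lambda>s t. \<Sum>i\<in>{..Suc n}. (-1) ^ i * \<omega> (elem_face n i s) t)"
    by (simp add: coboundary_def fun_eq_iff)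
  then show ?thesis
    using l2_cochain_alternating_sum[of "{..Suc n}" "Suc n" "\<lambda>i s. \<omega> (elem_face n i s)"]
      l2_cochain_face[OF assms] by simp
qed

abbreviation "equ \<equiv> cochain_equiv F \<Lambda> T"

lemma cochain_equivD:
  "equ n \<omega> \<omega>' \<Longrightarrow> elementary_simplex F T n s \<Longrightarrow> AE t in \<mu>. \<omega> s t = \<omega>' s t"
  unfolding cochain_equiv_def by blast

lemma cochain_equivI:
  "(\<And>s. elementary_simplex F T n s \<Longrightarrow> AE t in \<mu>. \<omega> s t = \<omega>' s t) \<Longrightarrow> equ n \<omega> \<omega>'"
  unfolding cochain_equiv_def by blast

lemma cochain_equiv_eqI: "(\<And>s t. elementary_simplex F T n s \<Longrightarrow> t \<in> T \<Longrightarrow> \<omega> s t = \<omega>' s t) \<Longrightarrow> equ n \<omega> \<omega>'"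
  by (rule cochain_equivI, rule AE_I2) (simp add: space_transverse_measure)

lemma cochain_equiv_trans:
  assumes "equ n \<omega> \<omega>'" and "equ n \<omega>' \<omega>''" shows "equ n \<omega> \<omega>''"
proof (rule cochain_equivI)
  fix s assume "elementary_simplex F T n s"
  from cochain_equivD[OF assms(1) this] cochain_equivD[OF assms(2) this]
  show "AE t in \<mu>. \<omega> s t = \<omega>'' s t" by eventually_elim simp
qed

lemma cochain_equiv_diff:
  assumes "equ n \<omega> \<omega>'" and "equ n \<eta> \<eta>'"
  shows "equ n (\<lambda>s t. \<omega> s t - \<eta> s t) (\<lambda>s t. \<omega>' s t - \<eta>' s t)"
proof (rule cochain_equivI)
  fix s assume "elementary_simplex F T n s"
  from cochain_equivD[OF assms(1) this] cochain_equivD[OF assms(2) this]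
  show "AE t in \<mu>. \<omega> s t - \<eta> s t = \<omega>' s t - \<eta>' s t" by eventually_elim simp
qed

lemma cochain_equiv_minus:
  "equ n \<omega> \<omega>' \<Longrightarrow> equ n (\<lambda>s t. - \<omega> s t) (\<lambda>s t. - \<omega>' s t)"
  using cochain_equiv_diff[of n "\<lambda>s t. 0" "\<lambda>s t. 0" \<omega> \<omega>'] cochain_equiv_eqI[of n "\<lambda>s t. 0" "\<lambda>s t. 0"] by simp

lemma cochain_equiv_add:
  assumes "equ n \<omega> \<omega>'" and "equ n \<eta> \<eta>'"
  shows "equ n (\<lambda>s t. \<omega> s t + \<eta> s t) (\<lambda>s t. \<omega>' s t + \<eta>' s t)"
  using cochain_equiv_diff[OF assms(1) cochain_equiv_minus[OF assms(2)]] by simp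

lemma cochain_equiv_alternating_sum:
  assumes "finite I" and "\<And>i. i \<in> I \<Longrightarrow> equ n (\<omega> i) (\<omega>' i)"
  shows "equ n (\<lambda>s t. \<Sum>i\<in>I. (-1) ^ i * \<omega> i s t) (\<lambda>s t. \<Sum>i\<in>I. (-1) ^ i * \<omega>' i s t)"
  unfolding cochain_equiv_def
proof (intro allI impI)
  fix s assume s: "elementary_simplex F T n s"
  have "AE t in \<mu>. \<forall>i\<in>I. \<omega> i s t = \<omega>' i s t"
  proof (rule AE_finite_allI[OF assms(1)])
    fix i assume "i \<in> I"
    from cochain_equivD[OF assms(2)[OF this] s] show "AE t in \<mu>. \<omega> i s t = \<omega>' i s t" .
  qed
  then show "AE t in \<mu>. (\<Sum>i\<in>I. (-1) ^ i * \<omega> i s t) = (\<Sum>i\<in>I. (-1) ^ i * \<omega>' i s t)"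
    by eventually_elim (auto intro: sum.cong)
qed

lemma cochain_equiv_mono:
  assumes "equ n \<omega> \<omega>'" and D: "D \<in> sets (mt_meas F)" "D \<subseteq> T"
  shows "cochain_equiv F \<Lambda> D n \<omega> \<omega>'"
  unfolding cochain_equiv_def AE_subset[OF D]
proof (intro allI impI)
  fix s assume s: "elementary_simplex F D n s"
  have "elementary_simplex F T n s"
    using elementary_simplexD(1)[OF s] D(2) by (intro elementary_simplex_mono[OF s]) simp
  from cochain_equivD[OF assms(1) this] show "AE t in \<mu>. t \<in> D \<longrightarrow> \<omega> s t = \<omega>' s t"
    by eventually_elim simp
qed

end

text \<open>\<open>l2_restrict\<close> and \<open>l2_induced\<close> multiply the coboundaries with
  a set that may fill only part of a coset; a nonempty part is enough to recover the whole
  coset.\<close>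

lemma (in comm_group) set_mult_in_coset:
  assumes "subgroup B G" and "x \<in> carrier G" and "X \<subseteq> B #> x" and "X \<noteq> {}"
  shows "B <#> X = B #> x"
proof -
  have "B #> y = B #> x" if "y \<in> X" for y
    using repr_independence[OF _ assms(2,1)] assms(3) that by auto
  moreover have "B <#> X = (\<Union>y\<in>X. B #> y)"
    by (auto simp: set_mult_def r_coset_def)
  ultimately show ?thesis using assms(4) by auto
qed

lemma coboundary_diff:
  "coboundary n (\<lambda>s t. \<omega> s t - \<omega>' s t) = (\<lambda>s t. coboundary n \<omega> s t - coboundary n \<omega>' s t)"
  by (simp add: coboundary_def sum_subtractf right_diff_distrib fun_eq_iff)

lemma coboundary_zero [simp]: "coboundary n (\<lambda>s t. 0) = (\<lambda>s t. 0)"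
  by (simp add: coboundary_def fun_eq_iff)

lemma mult_l2_cocycle_group [simp]:
  "\<omega> \<otimes>\<^bsub>l2_cocycle_group F \<Lambda> T \<Gamma> n\<^esub> \<omega>' = (\<lambda>s t. \<omega> s t + \<omega>' s t)"
  by (simp add: l2_cocycle_group_def)

lemma one_l2_cocycle_group [simp]: "\<one>\<^bsub>l2_cocycle_group F \<Lambda> T \<Gamma> n\<^esub> = (\<lambda>s t. 0)"
  by (simp add: l2_cocycle_group_def)

section \<open>The group of cocycles, its quotient, and restriction to smaller transversals\<close>

context l2_complex
begin

abbreviation "cocycles \<equiv> l2_cocycle_group F \<Lambda> T \<Gamma>"
abbreviation "coboundaries \<equiv> l2_coboundaries F \<Lambda> T \<Gamma>"

lemma cocycle_iff:
  "\<omega> \<in> carrier (cocycles n) \<longleftrightarrow>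
     l2_cochain F \<Lambda> T \<Gamma> n \<omega> \<and> equ (Suc n) (coboundary n \<omega>) (\<lambda>s t. 0)"
  by (simp add: l2_cocycle_group_def)

lemma cochain_equiv_refl: "equ n \<omega> \<omega>"
  by (rule cochain_equiv_eqI) simp

lemma cocycle_diff:
  assumes "\<omega> \<in> carrier (cocycles n)" and "\<omega>' \<in> carrier (cocycles n)"
  shows "(\<lambda>s t. \<omega> s t - \<omega>' s t) \<in> carrier (cocycles n)"
  using assms cochain_equiv_diff[of "Suc n" "coboundary n \<omega>" "\<lambda>s t. 0" "coboundary n \<omega>'" "\<lambda>s t. 0"]
  by (simp add: cocycle_iff l2_cochain_diff coboundary_diff)

lemma cocycle_zero: "(\<lambda>s t. 0) \<in> carrier (cocycles n)"
  by (simp add: cocycle_iff l2_cochain_zero cochain_equiv_refl)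

lemma cocycle_minus: "\<omega> \<in> carrier (cocycles n) \<Longrightarrow> (\<lambda>s t. - \<omega> s t) \<in> carrier (cocycles n)"
  using cocycle_diff[OF cocycle_zero] by simp

lemma cocycle_add:
  "\<omega> \<in> carrier (cocycles n) \<Longrightarrow> \<omega>' \<in> carrier (cocycles n) \<Longrightarrow>
     (\<lambda>s t. \<omega> s t + \<omega>' s t) \<in> carrier (cocycles n)"
  using cocycle_diff[OF _ cocycle_minus, of \<omega> n \<omega>'] by simp

lemma comm_group_cocycles: "comm_group (cocycles n)"
proof (rule comm_groupI)
  show "\<exists>\<omega>'\<in>carrier (cocycles n). \<omega>' \<otimes>\<^bsub>cocycles n\<^esub> \<omega> = \<one>\<^bsub>cocycles n\<^esub>"
    if "\<omega> \<in> carrier (cocycles n)" for \<omega>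
    using cocycle_minus[OF that] by (intro bexI[of _ "\<lambda>s t. - \<omega> s t"]) simp_all
qed (simp_all add: cocycle_add cocycle_zero algebra_simps)

lemma inv_cocycles:
  assumes "\<omega> \<in> carrier (cocycles n)"
  shows "inv\<^bsub>cocycles n\<^esub> \<omega> = (\<lambda>s t. - \<omega> s t)"
proof -
  interpret comm_group "cocycles n" by (rule comm_group_cocycles)
  show ?thesis
    using inv_equality[of "\<lambda>s t. - \<omega> s t" \<omega>] assms cocycle_minus[OF assms] by simp
qed

text \<open>The condition in \<open>l2_coboundaries\<close> apart from being a cocycle. There are no
  cochains of degree -1, so in degree 0 only null cochains qualify.\<close>

definition exact :: "nat \<Rightarrow> ('a, 'k) cochain \<Rightarrow> bool" where
  "exact n \<omega> \<longleftrightarrow> (case n of 0 \<Rightarrow> equ 0 \<omega> (\<lambda>s t. 0)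
     | Suc m \<Rightarrow> \<exists>\<eta>. l2_cochain F \<Lambda> T \<Gamma> m \<eta> \<and> equ n \<omega> (coboundary m \<eta>))"

lemma coboundaries_iff: "\<omega> \<in> coboundaries n \<longleftrightarrow> \<omega> \<in> carrier (cocycles n) \<and> exact n \<omega>"
  by (simp add: l2_coboundaries_def exact_def)

lemma exact_if_equiv_zero: "equ n \<omega> (\<lambda>s t. 0) \<Longrightarrow> exact n \<omega>"
  by (cases n) (auto simp: exact_def intro!: exI[of _ "\<lambda>s t. 0"] l2_cochain_zero)

lemma exact_diff:
  assumes "exact n \<omega>" and "exact n \<omega>'"
  shows "exact n (\<lambda>s t. \<omega> s t - \<omega>' s t)"
proof (cases n)
  case 0
  then show ?thesis
    using assms cochain_equiv_diff[of 0 \<omega> "\<lambda>s t. 0" \<omega>' "\<lambda>s t. 0"] by (simp add: exact_def)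
next
  case (Suc m)
  then obtain \<eta> \<eta>' where "l2_cochain F \<Lambda> T \<Gamma> m \<eta>" "equ n \<omega> (coboundary m \<eta>)"
    "l2_cochain F \<Lambda> T \<Gamma> m \<eta>'" "equ n \<omega>' (coboundary m \<eta>')"
    using assms by (auto simp: exact_def)
  then have "l2_cochain F \<Lambda> T \<Gamma> m (\<lambda>s t. \<eta> s t - \<eta>' s t)"
    "equ n (\<lambda>s t. \<omega> s t - \<omega>' s t) (coboundary m (\<lambda>s t. \<eta> s t - \<eta>' s t))"
    by (simp_all add: l2_cochain_diff coboundary_diff cochain_equiv_diff)
  then show ?thesis using Suc by (auto simp: exact_def)
qed

lemma subgroup_coboundaries: "subgroup (coboundaries n) (cocycles n)"
proof -
  have z: "(\<lambda>s t. 0) \<in> coboundaries n"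
    by (simp add: coboundaries_iff cocycle_zero exact_if_equiv_zero cochain_equiv_refl)
  have d: "(\<lambda>s t. \<omega> s t - \<omega>' s t) \<in> coboundaries n" if "\<omega> \<in> coboundaries n" "\<omega>' \<in> coboundaries n" for \<omega> \<omega>'
    using that by (simp add: coboundaries_iff cocycle_diff exact_diff)
  have m: "(\<lambda>s t. - \<omega> s t) \<in> coboundaries n" if "\<omega> \<in> coboundaries n" for \<omega>
    using d[OF z that] by simp
  show ?thesis
  proof
    show "\<omega> \<otimes>\<^bsub>cocycles n\<^esub> \<omega>' \<in> coboundaries n" if "\<omega> \<in> coboundaries n" "\<omega>' \<in> coboundaries n" for \<omega> \<omega>'
      using d[OF that(1) m[OF that(2)]] by simp
    show "inv\<^bsub>cocycles n\<^esub> \<omega> \<in> coboundaries n" if "\<omega> \<in> coboundaries n" for \<omega>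
      using m[OF that] that by (simp add: inv_cocycles coboundaries_iff)
  qed (use z in \<open>auto simp: coboundaries_iff\<close>)
qed

abbreviation cohomology_class :: "nat \<Rightarrow> ('a, 'k) cochain \<Rightarrow> ('a, 'k) cochain set" where
  "cohomology_class n \<omega> \<equiv> coboundaries n #>\<^bsub>cocycles n\<^esub> \<omega>"

lemma carrier_l2_cohomology:
  "carrier (l2_cohomology F \<Lambda> T \<Gamma> n) = cohomology_class n ` carrier (cocycles n)"
  by (auto simp: l2_cohomology_def FactGroup_def RCOSETS_def)

lemma mult_cohomology_class:
  assumes "\<omega> \<in> carrier (cocycles n)" and "\<omega>' \<in> carrier (cocycles n)"
  shows "cohomology_class n \<omega> \<otimes>\<^bsub>l2_cohomology F \<Lambda> T \<Gamma> n\<^esub> cohomology_class n \<omega>' =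
    cohomology_class n (\<lambda>s t. \<omega> s t + \<omega>' s t)"
proof -
  interpret comm_group "cocycles n" by (rule comm_group_cocycles)
  interpret normal "coboundaries n" "cocycles n"
    by (rule subgroup_imp_normal[OF subgroup_coboundaries])
  show ?thesis using rcos_sum[OF assms] by (simp add: l2_cohomology_def FactGroup_def)
qed

lemma cohomology_class_eqI:
  assumes "\<omega> \<in> carrier (cocycles n)" and "\<omega>' \<in> carrier (cocycles n)"
    and "exact n (\<lambda>s t. \<omega> s t - \<omega>' s t)"
  shows "cohomology_class n \<omega> = cohomology_class n \<omega>'"
proof -
  interpret comm_group "cocycles n" by (rule comm_group_cocycles)
  have "(\<lambda>s t. \<omega> s t - \<omega>' s t) \<in> coboundaries n"
    using assms by (simp add: coboundaries_iff cocycle_diff)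
  then have "\<omega> \<in> cohomology_class n \<omega>'"
    unfolding r_coset_def by (auto intro!: bexI[of _ "\<lambda>s t. \<omega> s t - \<omega>' s t"])
  then show ?thesis
    using repr_independence[OF _ assms(2) subgroup_coboundaries] by simp
qed

lemma mem_cohomology_class: "\<omega> \<in> carrier (cocycles n) \<Longrightarrow> \<omega> \<in> cohomology_class n \<omega>"
  using comm_group_cocycles subgroup_coboundaries
  by (meson comm_group_def group.rcos_self)

lemma set_mult_coboundaries:
  assumes "\<omega> \<in> carrier (cocycles n)" and "X \<subseteq> cohomology_class n \<omega>" and "X \<noteq> {}"
  shows "coboundaries n <#>\<^bsub>cocycles n\<^esub> X = cohomology_class n \<omega>"
  using comm_group.set_mult_in_coset[OF comm_group_cocycles subgroup_coboundaries assms] .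

text \<open>Every simplex relative to \<open>D\<close> is one relative to \<open>T\<close>, so the
  conditions relative to \<open>D\<close> follow from those relative to \<open>T\<close>:
  restriction to a smaller transversal is an inclusion of sets of representatives.\<close>

lemma cocycles_subset:
  assumes D: "D \<in> sets (mt_meas F)" "D \<subseteq> T"
  shows "carrier (cocycles n) \<subseteq> carrier (l2_cocycle_group F \<Lambda> D \<Gamma> n)"
proof -
  interpret D: l2_complex F \<Lambda> D \<Gamma> by (rule l2_complex_subset[OF D])
  show ?thesis
    using l2_cochain_mono[OF _ D] cochain_equiv_mono[OF _ D] by (auto simp: cocycle_iff D.cocycle_iff)
qed

lemma coboundaries_subset:
  assumes D: "D \<in> sets (mt_meas F)" "D \<subseteq> T"
  shows "coboundaries n \<subseteq> l2_coboundaries F \<Lambda> D \<Gamma> n"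
proof -
  interpret D: l2_complex F \<Lambda> D \<Gamma> by (rule l2_complex_subset[OF D])
  have "D.exact n \<omega>" if ex: "exact n \<omega>" for \<omega>
  proof (cases n)
    case 0
    then show ?thesis using ex cochain_equiv_mono[OF _ D] by (simp add: exact_def D.exact_def)
  next
    case (Suc m)
    then obtain \<eta> where "l2_cochain F \<Lambda> T \<Gamma> m \<eta>" "equ n \<omega> (coboundary m \<eta>)"
      using ex by (auto simp: exact_def)
    from l2_cochain_mono[OF this(1) D] cochain_equiv_mono[OF this(2) D] show ?thesis
      using Suc by (auto simp: D.exact_def)
  qed
  then show ?thesis
    using subsetD[OF cocycles_subset[OF D]] by (auto simp: coboundaries_iff D.coboundaries_iff)
qed

text \<open>The class relative to \<open>T\<close> sits inside the class of \<open>\<omega>\<close>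
  relative to \<open>D\<close>, and \<open>set_mult_coboundaries\<close> enlarges it to the
  latter.\<close>

lemma l2_restrict_cohomology_class:
  assumes D: "D \<in> sets (mt_meas F)" "D \<subseteq> T" and \<omega>: "\<omega> \<in> carrier (cocycles n)"
  shows "l2_restrict F \<Lambda> \<Gamma> n D (cohomology_class n \<omega>) =
    l2_coboundaries F \<Lambda> D \<Gamma> n #>\<^bsub>l2_cocycle_group F \<Lambda> D \<Gamma> n\<^esub> \<omega>"
proof -
  interpret D: l2_complex F \<Lambda> D \<Gamma> by (rule l2_complex_subset[OF D])
  have "cohomology_class n \<omega> \<subseteq> D.cohomology_class n \<omega>"
    using coboundaries_subset[OF D] by (auto simp: r_coset_def)
  then show ?thesis
    unfolding l2_restrict_def using mem_cohomology_class[OF \<omega>] cocycles_subset[OF D] \<omega>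
    by (intro D.set_mult_coboundaries) auto
qed

end

section \<open>The homomorphism in cohomology induced by a pullback\<close>

lemma pullback_add:
  "pullback n f (\<lambda>s t. \<omega> s t + \<omega>' s t) = (\<lambda>s t. pullback n f \<omega> s t + pullback n f \<omega>' s t)"
  by (simp add: pullback_def fun_eq_iff)

lemma elem_face_push:
  assumes "i \<le> Suc n"
  shows "elem_face n i (simplex_push (Suc n) f s) = simplex_push n f (elem_face n i s)"
  using assms simplical_face_in_standard_simplex[of "Suc n" i] 
  by (auto simp: elem_face_def simplex_push_def restrict_def inv_into_into intro!: ext)

text \<open>An equality of functions on all pairs: \<open>inv_into\<close> sends image points back
  into the domain of the simplex even where \<open>f\<close> is not injective, so faces commute with
  \<open>simplex_push\<close>.\<close>

lemma pullback_coboundary: "pullback (Suc n) f (coboundary n \<omega>) = coboundary n (pullback n f \<omega>)"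
  by (auto simp: pullback_def coboundary_def fun_eq_iff elem_face_push simp del: sum.atMost_Suc)

locale l2_pullback = F: l2_complex F \<Lambda> T \<Gamma> + G: l2_complex G \<Delta> T' \<Gamma>
  for F :: "'a mt_space" and \<Lambda> T \<Gamma> and G :: "'b mt_space" and \<Delta> T' +
  fixes f :: "'a \<Rightarrow> 'b"
  assumes defined: "l2_pullback_defined F \<Lambda> G \<Delta> \<Gamma> f T T'"
begin

lemma pullback_l2_cochain: "l2_cochain G \<Delta> T' \<Gamma> m \<omega> \<Longrightarrow> l2_cochain F \<Lambda> T \<Gamma> m (pullback m f \<omega>)"
  using defined by (simp add: l2_pullback_defined_def)

lemma pullback_equiv:
  "l2_cochain G \<Delta> T' \<Gamma> m \<omega> \<Longrightarrow> l2_cochain G \<Delta> T' \<Gamma> m \<omega>' \<Longrightarrow> cochain_equiv G \<Delta> T' m \<omega> \<omega>' \<Longrightarrow>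
     cochain_equiv F \<Lambda> T m (pullback m f \<omega>) (pullback m f \<omega>')"
  using defined by (simp add: l2_pullback_defined_def)

lemma pullback_zero: "pullback m f (\<lambda>s t. 0) = (\<lambda>s t. 0)"
  by (simp add: pullback_def fun_eq_iff)

lemma pullback_cocycle:
  assumes "\<omega> \<in> carrier (G.cocycles n)" shows "pullback n f \<omega> \<in> carrier (F.cocycles n)"
proof -
  have \<omega>: "l2_cochain G \<Delta> T' \<Gamma> n \<omega>" "cochain_equiv G \<Delta> T' (Suc n) (coboundary n \<omega>) (\<lambda>s t. 0)"
    using assms by (auto simp: G.cocycle_iff)
  from pullback_equiv[OF G.l2_cochain_coboundary[OF \<omega>(1)] G.l2_cochain_zero \<omega>(2)] \<omega>(1)
  show ?thesis by (simp add: F.cocycle_iff pullback_l2_cochain pullback_coboundary pullback_zero)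
qed

lemma pullback_coboundaries:
  assumes "\<omega> \<in> G.coboundaries n" shows "pullback n f \<omega> \<in> F.coboundaries n"
proof -
  have \<omega>: "\<omega> \<in> carrier (G.cocycles n)" "G.exact n \<omega>" "l2_cochain G \<Delta> T' \<Gamma> n \<omega>"
    using assms by (auto simp: G.coboundaries_iff G.cocycle_iff)
  have "F.exact n (pullback n f \<omega>)"
  proof (cases n)
    case 0
    then show ?thesis
      using pullback_equiv[OF \<omega>(3) G.l2_cochain_zero] \<omega>(2)
      by (simp add: F.exact_def G.exact_def pullback_zero)
  next
    case (Suc m)
    then obtain \<eta> where \<eta>: "l2_cochain G \<Delta> T' \<Gamma> m \<eta>" "cochain_equiv G \<Delta> T' (Suc m) \<omega> (coboundary m \<eta>)"
      using \<omega>(2) by (auto simp: G.exact_def)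
    then have "cochain_equiv F \<Lambda> T (Suc m) (pullback (Suc m) f \<omega>) (coboundary m (pullback m f \<eta>))"
      using pullback_equiv[OF _ G.l2_cochain_coboundary[OF \<eta>(1)]] \<omega>(3) Suc by (simp add: pullback_coboundary)
    then show ?thesis using pullback_l2_cochain[OF \<eta>(1)] Suc by (auto simp: F.exact_def)
  qed
  then show ?thesis using pullback_cocycle[OF \<omega>(1)] by (simp add: F.coboundaries_iff)
qed

lemma l2_induced_cohomology_class:
  assumes \<omega>: "\<omega> \<in> carrier (G.cocycles n)"
  shows "l2_induced F \<Lambda> T \<Gamma> n f (G.cohomology_class n \<omega>) = F.cohomology_class n (pullback n f \<omega>)"
  unfolding l2_induced_def
proof (rule F.set_mult_coboundaries[OF pullback_cocycle[OF \<omega>]])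
  show "pullback n f ` G.cohomology_class n \<omega> \<subseteq> F.cohomology_class n (pullback n f \<omega>)"
    using pullback_coboundaries unfolding r_coset_def by (auto simp: pullback_add) blast
  show "pullback n f ` G.cohomology_class n \<omega> \<noteq> {}"
    using G.mem_cohomology_class[OF \<omega>] by auto
qed

lemma l2_induced_hom:
  "l2_induced F \<Lambda> T \<Gamma> n f \<in> hom (l2_cohomology G \<Delta> T' \<Gamma> n) (l2_cohomology F \<Lambda> T \<Gamma> n)"
proof (rule homI)
  show "l2_induced F \<Lambda> T \<Gamma> n f c \<in> carrier (l2_cohomology F \<Lambda> T \<Gamma> n)"
    if "c \<in> carrier (l2_cohomology G \<Delta> T' \<Gamma> n)" for c
    using that pullback_cocycle
    by (auto simp: G.carrier_l2_cohomology F.carrier_l2_cohomology l2_induced_cohomology_class)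
  show "l2_induced F \<Lambda> T \<Gamma> n f (c \<otimes>\<^bsub>l2_cohomology G \<Delta> T' \<Gamma> n\<^esub> c') =
      l2_induced F \<Lambda> T \<Gamma> n f c \<otimes>\<^bsub>l2_cohomology F \<Lambda> T \<Gamma> n\<^esub> l2_induced F \<Lambda> T \<Gamma> n f c'"
    if "c \<in> carrier (l2_cohomology G \<Delta> T' \<Gamma> n)" "c' \<in> carrier (l2_cohomology G \<Delta> T' \<Gamma> n)" for c c'
    using that pullback_cocycle
    by (auto simp: G.carrier_l2_cohomology G.mult_cohomology_class F.mult_cohomology_class
        l2_induced_cohomology_class G.cocycle_add pullback_add)
qed

end

section \<open>Pullbacks at points of the transversal\<close>

definition constant_simplex :: "nat \<Rightarrow> 'a set \<Rightarrow> 'a elem_simplex" where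
  "constant_simplex n S = (S, restrict snd (standard_simplex n \<times> S))"

lemma fst_constant_simplex [simp]: "fst (constant_simplex n S) = S"
  by (simp add: constant_simplex_def)

text \<open>The parameter set carries the discrete topology, so its inclusion into \<open>F\<close>
  is continuous.\<close>

lemma (in l2_complex) elementary_constant_simplex:
  assumes "S \<in> sets (mt_meas F)" and "S \<subseteq> T"
  shows "elementary_simplex F T n (constant_simplex n S)"
proof -
  let ?D = "borel_of (simplex_topology n) \<Otimes>\<^sub>M restrict_space (mt_meas F) S"
  have sp: "space (restrict_space (mt_meas F) S) = S"
    using assms(1) by (auto simp: space_restrict_space dest: sets.sets_into_space)
  have "snd \<in> measurable ?D (mt_meas F)"
    by (rule measurable_compose[OF measurable_snd, unfolded comp_def])
      (auto intro: measurable_restrict_space1)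
  then have m: "restrict snd (standard_simplex n \<times> S) \<in> measurable ?D (mt_meas F)"
    by (subst measurable_cong[where g = snd]) (auto simp: space_pair_measure sp)
  have S: "S \<subseteq> topspace (mt_top F)" using assms T_topspace by auto
  have "continuous_map (prod_topology (simplex_topology n) (discrete_topology S)) (discrete_topology S) snd"
    by (rule continuous_map_snd)
  moreover have "continuous_map (discrete_topology S) (mt_top F) (\<lambda>t. t)"
    using S by (auto simp: continuous_map_def)
  ultimately have "continuous_map (prod_topology (simplex_topology n) (discrete_topology S)) (mt_top F)
      ((\<lambda>t. t) \<circ> snd)"
    by (rule continuous_map_compose)
  then have c: "continuous_map (prod_topology (simplex_topology n) (discrete_topology S)) (mt_top F)
      (restrict snd (standard_simplex n \<times> S))"
    by (rule continuous_map_eq) auto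
  show ?thesis
    using assms m c S by (auto simp: elementary_simplex_iff constant_simplex_def leaf_refl)
qed

text \<open>The \<open>n\<close>-simplex \<open>r \<circ> (id \<times> q)\<close>, for a \<open>0\<close>-simplex \<open>q\<close> regarded as a leafwise map between
  subsets of the transversal. Such a \<open>q\<close> need not be injective.\<close>

definition probe_domain :: "'a elem_simplex \<Rightarrow> 'a elem_simplex \<Rightarrow> 'a set" where
  "probe_domain r q = {v \<in> fst q. snd q (\<lambda>j. if j = 0 then 1 else 0, v) \<in> fst r}"

definition probe :: "nat \<Rightarrow> 'a elem_simplex \<Rightarrow> 'a elem_simplex \<Rightarrow> 'a elem_simplex" where
  "probe n r q = simplex_transform n fst (\<lambda>x. x) (\<lambda>_. 0) (probe_domain r q)
     (\<lambda>v. snd q (\<lambda>j. if j = 0 then 1 else 0, v)) r"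

lemma fst_probe [simp]: "fst (probe n r q) = probe_domain r q"
  by (simp add: probe_def)

context l2_complex
begin

text \<open>The function \<open>\<lambda>j. if j = 0 then 1 else 0\<close> is the only point of the
  standard 0-simplex; evaluation there is a section of a jointly measurable map.\<close>

lemma probe_measurable:
  assumes q: "elementary_simplex F T 0 q" and r: "elementary_simplex F T n r"
  shows "(\<lambda>v. snd q (\<lambda>j. if j = 0 then 1 else 0, v)) \<in> measurable (restrict_space (mt_meas F) (fst q)) (mt_meas F)"
    and "probe_domain r q \<in> sets (mt_meas F)"
proof -
  have V: "fst q \<in> sets (mt_meas F)" and R: "fst r \<in> sets (mt_meas F)"
    by (rule elementary_simplexD(2)[OF q], rule elementary_simplexD(2)[OF r])
  have sp: "space (restrict_space (mt_meas F) (fst q)) = fst q"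
    using V by (auto simp: space_restrict_space dest: sets.sets_into_space)
  have "(\<lambda>v. (\<lambda>j. if j = 0 then 1 else 0, v)) \<in> measurable (restrict_space (mt_meas F) (fst q))
      (borel_of (simplex_topology 0) \<Otimes>\<^sub>M restrict_space (mt_meas F) (fst q))"
    by (rule measurable_Pair1') simp
  then show 1: "(\<lambda>v. snd q (\<lambda>j. if j = 0 then 1 else 0, v)) \<in> measurable (restrict_space (mt_meas F) (fst q)) (mt_meas F)"
    using q by (auto simp: elementary_simplex_iff intro: measurable_compose)
  from measurable_sets[OF 1 R] have "probe_domain r q \<in> sets (restrict_space (mt_meas F) (fst q))"
    by (simp add: probe_domain_def sp vimage_def Int_def conj_commute)
  then show "probe_domain r q \<in> sets (mt_meas F)"
    using V by (subst (asm) sets_restrict_space_iff) auto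
qed

lemma elementary_probe:
  assumes q: "elementary_simplex F T 0 q" and r: "elementary_simplex F T n r"
  shows "elementary_simplex F T n (probe n r q)"
  unfolding probe_def
proof (rule elementary_simplex_transform[OF r mt_map_fst])
  show "probe_domain r q \<in> sets (mt_meas F)" by (rule probe_measurable[OF q r])
  show "probe_domain r q \<subseteq> T" using elementary_simplexD(1)[OF q] by (auto simp: probe_domain_def)
  have "probe_domain r q \<subseteq> fst q" by (auto simp: probe_domain_def)
  from measurable_restrict_mono[OF probe_measurable(1)[OF q r] this]
  show "(\<lambda>v. snd q (\<lambda>j. if j = 0 then 1 else 0, v))
      \<in> measurable (restrict_space (mt_meas F) (probe_domain r q)) (restrict_space (mt_meas F) (fst r))"
    by (auto simp: measurable_restrict_space2_iff space_restrict_space probe_domain_def)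
  fix u y and x :: real
  assume u: "u \<in> probe_domain r q" and y: "y \<in> leaf F (snd q (\<lambda>j. if j = 0 then 1 else 0, u))"
  have "snd q (\<lambda>j. if j = 0 then 1 else 0, u) \<in> leaf F u"
    using u by (intro elementary_simplexD(3)[OF q]) (auto simp: probe_domain_def)
  then show "fst (y, x) \<in> leaf F u" using y by (auto intro: leaf_trans)
qed auto

lemma holonomy_id:
  assumes "A \<in> sets (mt_meas F)" and "A \<subseteq> T"
  shows "holonomy_transformation F A A (\<lambda>t. t)"
  using transversal_subset[OF T assms] assms T_topspace
  by (auto simp: holonomy_transformation_def measurable_isomorphism_id intro!: leaf_refl)

text \<open>The composite of \<open>r\<close> with \<open>q\<close> is elementary even if
  \<open>q\<close> is not injective, so the bound for each \<open>q\<close> is the bound of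
  \<open>\<omega>\<close> on a single \<open>n\<close>-simplex, and the axioms of
  \<open>\<omega>\<close> carry over.\<close>

lemma l2_cochain_probe:
  assumes \<omega>: "l2_cochain F \<Lambda> T \<Gamma> n \<omega>" and r: "elementary_simplex F T n r"
  shows "l2_cochain F \<Lambda> T \<Gamma> 0 (\<lambda>q. \<omega> (probe n r q))"
  unfolding l2_cochain_def
proof (intro conjI allI impI)
  note el = elementary_probe[OF _ r]
  note e = elementary_cochainD[OF l2_cochain_elementary[OF \<omega>] el]
  note loc = cochain_value_local[OF l2_cochain_elementary[OF \<omega>]]
  have e0: "(\<lambda>j. if j = 0 then 1 else 0) \<in> standard_simplex 0" by simp
  show "elementary_cochain F T \<Gamma> 0 (\<lambda>q. \<omega> (probe n r q))"
    unfolding elementary_cochain_def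
  proof (intro allI impI conjI ballI)
    fix q assume q: "elementary_simplex F T 0 q"
    show "\<omega> (probe n r q) \<in> borel_measurable (restrict_space (mt_meas F) T)"
      and "\<And>t. \<omega> (probe n r q) t \<in> \<Gamma>"
      using e[OF q] by auto
    show "\<omega> (probe n r q) t = 0" if "t \<notin> fst q" for t
      using that by (intro e(3)[OF q]) (simp add: probe_domain_def)
    have "fst r \<in> sets (mt_meas F)" using r by (rule elementary_simplexD)
    show "\<omega> (probe n r (simplex_restrict 0 S q)) = (\<lambda>t. \<omega> (probe n r q) t * indicator S t)"
      if S: "S \<in> sets (mt_meas F)" "S \<subseteq> fst q" for S
    proof -
      have dom: "probe_domain r (simplex_restrict 0 S q) = S \<inter> probe_domain r q"
        using S e0 by (auto simp: probe_domain_def simplex_restrict_def)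
      have "probe n r (simplex_restrict 0 S q) = simplex_restrict n (S \<inter> probe_domain r q) (probe n r q)"
        unfolding probe_def simplex_restrict_transform[OF Int_lower2]
        by (rule simplex_transform_cong[OF dom])
          (use e0 in \<open>auto simp: simplex_restrict_def\<close>)
      also have "\<omega> \<dots> = (\<lambda>t. \<omega> (probe n r q) t * indicator (S \<inter> probe_domain r q) t)"
        using S probe_measurable(2)[OF q r] by (intro e(4)[OF q]) auto
      also have "\<dots> = (\<lambda>t. \<omega> (probe n r q) t * indicator S t)"
        using e(3)[OF q] by (auto simp: fun_eq_iff split: split_indicator)
      finally show ?thesis .
    qed
    show "\<omega> (probe n r (simplex_reparam 0 A h q)) = (\<lambda>t. if t \<in> A then \<omega> (probe n r q) (h t) else 0)"
      if "A \<subseteq> T \<and> B \<subseteq> fst q \<and> holonomy_transformation F A B h" for A B h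
    proof
      fix t
      have AB: "A \<subseteq> T" "B \<subseteq> fst q" and h: "holonomy_transformation F A B h" using that by auto
      have q': "elementary_simplex F T 0 (simplex_reparam 0 A h q)"
        by (rule elementary_simplex_reparam[OF q h AB])
      have dom: "probe_domain r (simplex_reparam 0 A h q) = {v \<in> A. h v \<in> probe_domain r q}"
        using e0 reparam_in[OF h AB(2)] by (auto simp: probe_domain_def simplex_reparam_def)
      \<comment> \<open>Points of \<open>A\<close> that \<open>h\<close> followed by
        \<open>q\<close> sends outside \<open>fst r\<close> are dropped; on them both sides are
        0.\<close>
      let ?E = "probe_domain r (simplex_reparam 0 A h q)"
      have E: "?E \<in> sets (mt_meas F)" "?E \<subseteq> A"
        using probe_measurable(2)[OF q' r] dom by auto
      show "\<omega> (probe n r (simplex_reparam 0 A h q)) t = (if t \<in> A then \<omega> (probe n r q) (h t) else 0)"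
      proof (cases "t \<in> ?E")
        case True
        have "\<omega> (probe n r (simplex_reparam 0 A h q)) t = \<omega> (probe n r q) (h t)"
        proof (rule loc[OF el[OF q] el[OF q'] holonomy_restrict(1)[OF h E]])
          show "h ` ?E \<subseteq> fst (probe n r q)" using dom by auto
          show "snd (probe n r (simplex_reparam 0 A h q)) (x, u) = snd (probe n r q) (x, h u)"
            if "x \<in> standard_simplex n" "u \<in> ?E" for x u
            using that dom e0 by (simp add: probe_def snd_simplex_transform simplex_reparam_def)
        qed (use True in auto)
        then show ?thesis using True E by auto
      next
        case False
        then have "\<omega> (probe n r (simplex_reparam 0 A h q)) t = 0"
          by (intro e(3)[OF q']) simp
        moreover have "\<omega> (probe n r q) (h t) = 0" if "t \<in> A"
          using False that dom by (intro e(3)[OF q]) auto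
        ultimately show ?thesis by simp
      qed
    qed
  qed
  fix q assume q: "elementary_simplex F T 0 q"
  have "(\<integral>\<^sup>+t\<in>fst q. ennreal ((norm (\<omega> (probe n r q) t))\<^sup>2) \<partial>\<mu>) =
      (\<integral>\<^sup>+t\<in>fst (probe n r q). ennreal ((norm (\<omega> (probe n r q) t))\<^sup>2) \<partial>\<mu>)"
  proof (intro nn_integral_cong)
    fix t
    show "ennreal ((norm (\<omega> (probe n r q) t))\<^sup>2) * indicator (fst q) t =
        ennreal ((norm (\<omega> (probe n r q) t))\<^sup>2) * indicator (fst (probe n r q)) t"
      using e(3)[OF q, of t] by (auto simp: probe_domain_def split: split_indicator)
  qed
  also have "\<dots> < \<infinity>" by (rule l2_cochain_finite[OF \<omega> el[OF q]])
  finally show "(\<integral>\<^sup>+t\<in>fst q. ennreal ((norm (\<omega> (probe n r q) t))\<^sup>2) \<partial>\<mu>) < \<infinity>" .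
qed

end

section \<open>Injective pullbacks: images of measurable sets and values of cochains at image
  points\<close>

locale l2_injective_pullback = l2_pullback F \<Lambda> T \<Gamma> G \<Delta> T' f
  for F :: "'a mt_space" and \<Lambda> T and \<Gamma> :: "'k::{real_normed_field, second_countable_topology} set"
    and G :: "'b mt_space" and \<Delta> T' f +
  assumes F_singleton: "\<And>t. t \<in> topspace (mt_top F) \<Longrightarrow> {t} \<in> sets (mt_meas F)"
    and G_singleton: "\<And>t. t \<in> topspace (mt_top G) \<Longrightarrow> {t} \<in> sets (mt_meas G)"
    and f: "mt_map F G f" and fT: "f ` T \<subseteq> T'" and inj: "inj_on f T"
begin

text \<open>On the image of a single point the inverse of \<open>f\<close> is constant, hence
  measurable. This settles the one-point case, which the indicator argument below cannot
  exclude.\<close>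

lemma elementary_simplex_push_singleton:
  assumes s: "elementary_simplex F T n s" and S: "fst s = {t}"
  shows "elementary_simplex G T' n (simplex_push n f s)"
  unfolding simplex_push_eq
proof (rule elementary_simplex_transform[OF s])
  have t: "t \<in> T" "t \<in> topspace (mt_top F)"
    using elementary_simplexD(1)[OF s] S F.T_topspace by auto
  have "f t \<in> topspace (mt_top G)" using fT t(1) G.T_topspace by auto
  then show ft: "f ` fst s \<in> sets (mt_meas G)" using G_singleton S by simp
  show "f ` fst s \<subseteq> T'" using fT t(1) S by auto
  show "mt_map (times_line F) G (\<lambda>p. f (fst p))"
    using f mt_map_fst[of F] unfolding mt_map_def
    by (auto intro: measurable_compose continuous_map_compose[unfolded o_def])
  show "inv_into (fst s) f \<in> measurable (restrict_space (mt_meas G) (f ` fst s)) (restrict_space (mt_meas F) (fst s))"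
  proof (subst measurable_cong[where g = "\<lambda>_. t"])
    show "(\<lambda>_. t) \<in> measurable (restrict_space (mt_meas G) (f ` fst s)) (restrict_space (mt_meas F) (fst s))"
      using S t by (intro measurable_const) (auto simp: space_restrict_space mt_space_eq[OF F.mt])
  qed (auto simp: space_restrict_space S inv_into_f_f)
  fix u y and x :: real
  assume "u \<in> f ` fst s" "y \<in> leaf F (inv_into (fst s) f u)"
  then have "u = f t" "y \<in> leaf F t" using S by (auto simp: inv_into_f_f)
  then show "f (fst (y, x)) \<in> leaf G u"
    using f by (auto simp: mt_map_def intro: leaf_image)
qed auto

text \<open>This replaces the Lusin--Souslin theorem on measurability of injective images. A cochain may
  take any values on pairs that are not elementary simplices. If \<open>f\<^sub>\<sharp>s\<close> is such a pair, the pullback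
  of the indicator of this single pair violates the restriction axiom, unless \<open>T\<^sub>\<sigma>\<close> is a single point.\<close>

lemma elementary_simplex_push:
  assumes s: "elementary_simplex F T n s"
  shows "elementary_simplex G T' n (simplex_push n f s)"
proof (rule ccontr)
  assume ne: "\<not> elementary_simplex G T' n (simplex_push n f s)"
  define \<omega> :: "('b, 'k) cochain" where "\<omega> = (\<lambda>r t. if r = simplex_push n f s then 1 else 0)"
  have "l2_cochain G \<Delta> T' \<Gamma> n \<omega>"
    by (rule G.l2_cochain_cong[OF G.l2_cochain_zero]) (use ne in \<open>auto simp: \<omega>_def\<close>)
  from F.l2_cochain_elementary[OF pullback_l2_cochain[OF this]]
  have el: "elementary_cochain F T \<Gamma> n (pullback n f \<omega>)" .
  \<comment> \<open>Over the empty set the push is elementary for trivial reasons, so a parameter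
    \<open>t\<close> can be chosen.\<close>
  have "fst s \<noteq> {}"
  proof
    assume "fst s = {}"
    moreover from this have "snd (simplex_push n f s) \<in> measurable
        (borel_of (simplex_topology n) \<Otimes>\<^sub>M restrict_space (mt_meas G) (f ` fst s)) (mt_meas G)"
      by (intro measurableI) (auto simp: space_pair_measure space_restrict_space)
    ultimately have "elementary_simplex G T' n (simplex_push n f s)"
      by (auto simp: elementary_simplex_iff simplex_push_def continuous_map_def)
    then show False using ne by simp
  qed
  then obtain t where t: "t \<in> fst s" by blast
  then have tT: "t \<in> T" using elementary_simplexD(1)[OF s] by blast
  then have "{t} \<in> sets (mt_meas F)" using F_singleton F.T_topspace by blast
  then have "pullback n f \<omega> (simplex_restrict n {t} s) = (\<lambda>u. pullback n f \<omega> s u * indicator {t} u)"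
    using t by (intro elementary_cochainD(4)[OF el s]) auto
  then have "pullback n f \<omega> (simplex_restrict n {t} s) t = pullback n f \<omega> s t" by simp
  \<comment> \<open>The right-hand value at \<open>t\<close> is 1, so \<open>\<omega>\<close> is 1
    on the push of the restricted simplex as well. This happens only on the pair
    \<open>simplex_push n f s\<close>, and comparing the domains of the two equal pairs leaves a
    single point.\<close>
  then have "simplex_push n f (simplex_restrict n {t} s) = simplex_push n f s"
    using t by (auto simp: pullback_def \<omega>_def split: if_splits)
  then have "fst (simplex_push n f (simplex_restrict n {t} s)) = fst (simplex_push n f s)" by simp
  then have "f ` fst s = {f t}" by simp
  then have "fst s = {t}"
    using t elementary_simplexD(1)[OF s] inj inj_on_image_eq_iff[OF inj, of "fst s" "{t}"] tT by simp
  then show False using ne elementary_simplex_push_singleton[OF s] by blast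
qed

text \<open>The pushed constant simplex over \<open>S\<close> has the image of \<open>S\<close> as
  its domain, and domains of elementary simplices are measurable.\<close>

lemma image_sets: "S \<in> sets (mt_meas F) \<Longrightarrow> S \<subseteq> T \<Longrightarrow> f ` S \<in> sets (mt_meas G)"
  using elementary_simplexD(2)[OF elementary_simplex_push[OF F.elementary_constant_simplex[of S 0]]]
  by simp

text \<open>Preimages under the inverse are images under \<open>f\<close>, so
  \<open>image_sets\<close> makes the inverse measurable.\<close>

lemma measurable_isomorphism_image:
  assumes S: "S \<in> sets (mt_meas F)" "S \<subseteq> T"
  shows "measurable_isomorphism (restrict_space (mt_meas F) S) (restrict_space (mt_meas G) (f ` S)) f"
proof (rule measurable_isomorphismI)
  have sS: "S \<inter> space (mt_meas F) = S" and sf: "f ` S \<inter> space (mt_meas G) = f ` S"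
    using sets.sets_into_space[OF S(1)] sets.sets_into_space[OF image_sets[OF S]] by auto
  have injS: "inj_on f S" using inj S(2) by (rule inj_on_subset)
  show "f \<in> measurable (restrict_space (mt_meas F) S) (restrict_space (mt_meas G) (f ` S))"
    using f by (auto simp: mt_map_def measurable_restrict_space2_iff space_restrict_space
        intro: measurable_restrict_space1)
  show "inv_into S f \<in> measurable (restrict_space (mt_meas G) (f ` S)) (restrict_space (mt_meas F) S)"
  proof (rule measurableI)
    show "inv_into S f u \<in> space (restrict_space (mt_meas F) S)"
      if "u \<in> space (restrict_space (mt_meas G) (f ` S))" for u
      using that by (auto simp: space_restrict_space sS sf inv_into_into)
    fix A assume "A \<in> sets (restrict_space (mt_meas F) S)"
    then have A: "A \<in> sets (mt_meas F)" "A \<subseteq> S"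
      using S by (auto simp: sets_restrict_space_iff sS)
    have "inv_into S f -` A \<inter> space (restrict_space (mt_meas G) (f ` S)) = f ` A"
      using A(2) injS by (auto simp: space_restrict_space sf inv_into_f_f subset_eq)
    then show "inv_into S f -` A \<inter> space (restrict_space (mt_meas G) (f ` S)) \<in> sets (restrict_space (mt_meas G) (f ` S))"
      using A S image_sets[of A] image_sets[OF S] by (auto simp: sets_restrict_space_iff sf)
  qed
  show "inv_into S f (f x) = x" if "x \<in> space (restrict_space (mt_meas F) S)" for x
    using that injS by (simp add: space_restrict_space)
  show "f (inv_into S f y) = y" if "y \<in> space (restrict_space (mt_meas G) (f ` S))" for y
    using that by (simp add: space_restrict_space f_inv_into_f)
qed

text \<open>Pushing the constant simplex over \<open>T\<close> gives the inclusion of the image of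
  \<open>T\<close>, and probing with an inclusion merely restricts \<open>r\<close>. At image points
  outside \<open>fst r\<close> both values are 0.\<close>

lemma pullback_probe:
  assumes \<omega>: "l2_cochain G \<Delta> T' \<Gamma> n \<omega>" and r: "elementary_simplex G T' n r"
    and t: "t \<in> T" 
  shows "pullback 0 f (\<lambda>q. \<omega> (probe n r q)) (constant_simplex 0 T) t = \<omega> r (f t)"
proof -
  define q where "q = simplex_push 0 f (constant_simplex 0 T)"
  have q: "elementary_simplex G T' 0 q"
    unfolding q_def by (rule elementary_simplex_push[OF F.elementary_constant_simplex[OF F.T_sets order_refl]])
  have qv: "snd q (\<lambda>j. if j = 0 then 1 else 0, v) = v" if "v \<in> f ` T" for v
    using that by (auto simp: q_def simplex_push_def constant_simplex_def inv_into_into f_inv_into_f)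
  have dom: "probe_domain r q = f ` T \<inter> fst r"
    using qv by (auto simp: probe_domain_def q_def)
  have "\<omega> (probe n r q) (f t) = \<omega> r (f t)"
  proof (cases "f t \<in> fst r")
    case True
    have A: "f ` T \<inter> fst r \<in> sets (mt_meas G)"
      using image_sets[OF F.T_sets order_refl] elementary_simplexD(2)[OF r] by auto
    have "holonomy_transformation G (f ` T \<inter> fst r) (f ` T \<inter> fst r) (\<lambda>u. u)"
      using fT by (intro G.holonomy_id A) auto
    from cochain_value_local[OF G.l2_cochain_elementary[OF \<omega>] r G.elementary_probe[OF q r] this, of "f t"]
    show ?thesis using True t qv by (auto simp: dom probe_def snd_simplex_transform)
  next
    case False
    then show ?thesis
      using elementary_cochainD(3)[OF G.l2_cochain_elementary[OF \<omega>]] r G.elementary_probe[OF q r]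
      by (metis (no_types, lifting) IntD2 dom fst_probe)
  qed
  then show ?thesis using t by (simp add: pullback_def q_def)
qed

text \<open>\<open>r\<close> is an arbitrary simplex relative to \<open>T'\<close>, as the prism
  will require; the hypothesis on the pullback is used in degree 0 whatever \<open>n\<close>
  is.\<close>

lemma l2_finite_at_image:
  assumes \<omega>: "l2_cochain G \<Delta> T' \<Gamma> n \<omega>" and r: "elementary_simplex G T' n r"
  shows "(\<integral>\<^sup>+t\<in>T. ennreal ((norm (\<omega> r (f t)))\<^sup>2) \<partial>transverse_measure F \<Lambda> T) < \<infinity>"
proof -
  let ?s = "constant_simplex 0 T"
  have s: "elementary_simplex F T 0 ?s"
    by (rule F.elementary_constant_simplex[OF F.T_sets order_refl])
  have "(\<integral>\<^sup>+t\<in>T. ennreal ((norm (\<omega> r (f t)))\<^sup>2) \<partial>transverse_measure F \<Lambda> T) =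
      (\<integral>\<^sup>+t\<in>fst ?s. ennreal ((norm (pullback 0 f (\<lambda>q. \<omega> (probe n r q)) ?s t))\<^sup>2) \<partial>transverse_measure F \<Lambda> T)"
    by (intro nn_integral_cong) (simp add: F.space_transverse_measure pullback_probe[OF \<omega> r])
  also have "\<dots> < \<infinity>"
    by (rule F.l2_cochain_finite[OF pullback_l2_cochain[OF G.l2_cochain_probe[OF \<omega> r]] s])
  finally show ?thesis .
qed

text \<open>Each probe is a single elementary simplex, so probing turns equivalent cochains into
  equivalent 0-cochains, and pulling these back preserves the equivalence.\<close>

lemma equiv_at_image:
  assumes \<omega>: "l2_cochain G \<Delta> T' \<Gamma> n \<omega>" and \<omega>': "l2_cochain G \<Delta> T' \<Gamma> n \<omega>'"
    and eq: "cochain_equiv G \<Delta> T' n \<omega> \<omega>'" and r: "elementary_simplex G T' n r"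
  shows "AE t in transverse_measure F \<Lambda> T. \<omega> r (f t) = \<omega>' r (f t)"
proof -
  let ?s = "constant_simplex 0 T"
  have s: "elementary_simplex F T 0 ?s"
    by (rule F.elementary_constant_simplex[OF F.T_sets order_refl])
  have "cochain_equiv G \<Delta> T' 0 (\<lambda>q. \<omega> (probe n r q)) (\<lambda>q. \<omega>' (probe n r q))"
    by (rule G.cochain_equivI) (rule G.cochain_equivD[OF eq G.elementary_probe[OF _ r]])
  from F.cochain_equivD[OF pullback_equiv[OF G.l2_cochain_probe[OF \<omega> r] G.l2_cochain_probe[OF \<omega>' r] this] s]
  have "AE t in transverse_measure F \<Lambda> T. pullback 0 f (\<lambda>q. \<omega> (probe n r q)) ?s t = pullback 0 f (\<lambda>q. \<omega>' (probe n r q)) ?s t" .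
  then show ?thesis
    by (rule AE_mp) (rule AE_I2, simp add: F.space_transverse_measure pullback_probe[OF \<omega> r] pullback_probe[OF \<omega>' r])
qed

end

section \<open>Cochains transported along a leafwise homotopy\<close>

lemma restrict_space_sets:
  assumes "A \<in> sets M"
  shows "space (restrict_space M A) = A"
  using sets.sets_into_space[OF assms] by (auto simp: space_restrict_space)

locale leafwise_family = F: l2_complex F \<Lambda> T \<Gamma> + G: l2_complex G \<Delta> T' \<Gamma>
  for F :: "'a mt_space" and \<Lambda> T and \<Gamma> :: "'k::{real_normed_field, second_countable_topology} set"
    and G :: "'b mt_space" and \<Delta> T' +
  fixes H :: "'a \<times> real \<Rightarrow> 'b"
  assumes H: "mt_map (times_line F) G H"
begin

text \<open>A simplex \<open>H \<circ> (\<sigma> \<times> b)\<close> is parametrised by a subset of the transversal of \<open>F\<close>. It can be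
  reparametrised by a subset of the transversal of \<open>G\<close> along any injection \<open>\<theta>\<close> that moves points
  along the leaves of \<open>G\<close> containing the image of \<open>H\<close>; the last two conditions compare the
  transverse measures.\<close>

definition transport :: "'a set \<Rightarrow> ('a \<Rightarrow> 'b) \<Rightarrow> bool" where
  "transport D \<theta> \<longleftrightarrow>
     D \<in> sets (mt_meas F) \<and> D \<subseteq> T \<and> \<theta> ` D \<in> sets (mt_meas G) \<and> \<theta> ` D \<subseteq> T' \<and>
     measurable_isomorphism (restrict_space (mt_meas F) D) (restrict_space (mt_meas G) (\<theta> ` D)) \<theta> \<and>
     (\<forall>t\<in>D. \<theta> t \<in> leaf G (H (t, 0))) \<and>
     (\<forall>m \<omega> r. l2_cochain G \<Delta> T' \<Gamma> m \<omega> \<longrightarrow> elementary_simplex G (\<theta> ` D) m r \<longrightarrow>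
        (\<integral>\<^sup>+t\<in>D. ennreal ((norm (\<omega> r (\<theta> t)))\<^sup>2) \<partial>transverse_measure F \<Lambda> T) < \<infinity>) \<and>
     (\<forall>m \<omega> \<omega>' r. l2_cochain G \<Delta> T' \<Gamma> m \<omega> \<longrightarrow> l2_cochain G \<Delta> T' \<Gamma> m \<omega>' \<longrightarrow>
        cochain_equiv G \<Delta> T' m \<omega> \<omega>' \<longrightarrow> elementary_simplex G (\<theta> ` D) m r \<longrightarrow>
        (AE t in transverse_measure F \<Lambda> T. t \<in> D \<longrightarrow> \<omega> r (\<theta> t) = \<omega>' r (\<theta> t)))"

lemma transportD:
  assumes "transport D \<theta>"
  shows "D \<in> sets (mt_meas F)" "D \<subseteq> T" "\<theta> ` D \<in> sets (mt_meas G)" "\<theta> ` D \<subseteq> T'"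
    "measurable_isomorphism (restrict_space (mt_meas F) D) (restrict_space (mt_meas G) (\<theta> ` D)) \<theta>"
    "\<And>t. t \<in> D \<Longrightarrow> \<theta> t \<in> leaf G (H (t, 0))"
    "\<And>m \<omega> r. l2_cochain G \<Delta> T' \<Gamma> m \<omega> \<Longrightarrow> elementary_simplex G (\<theta> ` D) m r \<Longrightarrow>
        (\<integral>\<^sup>+t\<in>D. ennreal ((norm (\<omega> r (\<theta> t)))\<^sup>2) \<partial>transverse_measure F \<Lambda> T) < \<infinity>"
    "\<And>m \<omega> \<omega>' r. l2_cochain G \<Delta> T' \<Gamma> m \<omega> \<Longrightarrow> l2_cochain G \<Delta> T' \<Gamma> m \<omega>' \<Longrightarrow>
        cochain_equiv G \<Delta> T' m \<omega> \<omega>' \<Longrightarrow> elementary_simplex G (\<theta> ` D) m r \<Longrightarrow>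
        AE t in transverse_measure F \<Lambda> T. t \<in> D \<longrightarrow> \<omega> r (\<theta> t) = \<omega>' r (\<theta> t)"
  using assms unfolding transport_def by blast+

lemma transport_inj:
  assumes "transport D \<theta>" shows "inj_on \<theta> D"
  using transportD(5)[OF assms] restrict_space_sets[OF transportD(1)[OF assms]]
  by (simp add: measurable_isomorphism_def bij_betw_def)

lemma transport_restrict:
  assumes "transport D \<theta>" and "E \<in> sets (mt_meas F)" and "E \<subseteq> D"
  shows "\<theta> ` E \<in> sets (mt_meas G)"
    and "measurable_isomorphism (restrict_space (mt_meas F) E) (restrict_space (mt_meas G) (\<theta> ` E)) \<theta>"
  using measurable_isomorphism_restrict[OF transportD(5,1,3)[OF assms(1)] assms(2,3)] by auto

text \<open>The heights \<open>r\<close> and \<open>r'\<close> are unrelated because the leaf of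
  \<open>(t, r')\<close> is all of \<open>leaf F t \<times> UNIV\<close>.\<close>

lemma H_leaf:
  assumes "y \<in> leaf F t" shows "H (y, r) \<in> leaf G (H (t, r'))"
proof (rule leaf_image[where F = "times_line F"])
  show "continuous_map (mt_top (times_line F)) (mt_top G) H" using H by (simp add: mt_map_def)
  show "(y, r) \<in> leaf (times_line F) (t, r')"
    using assms by (simp add: leaf_times_line)
qed

lemma transport_leaf:
  assumes "transport D \<theta>" and "t \<in> D" and "y \<in> leaf F t"
  shows "H (y, r) \<in> leaf G (\<theta> t)"
  using leaf_trans[OF leaf_sym[OF transportD(6)[OF assms(1,2)]] H_leaf[OF assms(3)]] .

text \<open>The pair \<open>(a, b)\<close> maps the \<open>m\<close>-simplex into the cylinder over
  the \<open>n\<close>-simplex: the identity with a constant height gives a time slice, a degeneracy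
  with \<open>prism_height\<close> a prism piece. \<open>\<theta>\<close> renames the parameters as
  points of \<open>G\<close>.\<close>

definition transported_simplex ::
    "nat \<Rightarrow> ((nat \<Rightarrow> real) \<Rightarrow> nat \<Rightarrow> real) \<Rightarrow> ((nat \<Rightarrow> real) \<Rightarrow> real) \<Rightarrow> 'a set \<Rightarrow> ('a \<Rightarrow> 'b) \<Rightarrow>
     'a elem_simplex \<Rightarrow> 'b elem_simplex" where
  "transported_simplex m a b D \<theta> s =
     simplex_transform m H a b (\<theta> ` (fst s \<inter> D)) (inv_into D \<theta>) s"

lemma fst_transported_simplex [simp]: "fst (transported_simplex m a b D \<theta> s) = \<theta> ` (fst s \<inter> D)"
  by (simp add: transported_simplex_def)

text \<open>Stated relative to the image of \<open>D\<close> rather than \<open>T'\<close>, because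
  \<open>transport\<close> gives its integral and almost-everywhere conditions for simplices of that
  kind.\<close>

lemma elementary_transported_simplex:
  assumes D: "transport D \<theta>" and s: "elementary_simplex F T n s"
    and a: "continuous_map (simplex_topology m) (simplex_topology n) a"
    and b: "continuous_map (simplex_topology m) euclideanreal b"
  shows "elementary_simplex G (\<theta> ` D) m (transported_simplex m a b D \<theta> s)"
  unfolding transported_simplex_def
proof (rule elementary_simplex_transform[OF s H a b])
  have SD: "fst s \<inter> D \<in> sets (mt_meas F)"
    using elementary_simplexD(2)[OF s] transportD(1)[OF D] by auto
  then show "\<theta> ` (fst s \<inter> D) \<in> sets (mt_meas G)" by (rule transport_restrict(1)[OF D]) auto
  show "\<theta> ` (fst s \<inter> D) \<subseteq> \<theta> ` D" by auto
  have "inv_into D \<theta> \<in> measurable (restrict_space (mt_meas G) (\<theta> ` D)) (restrict_space (mt_meas F) D)"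
    using transportD(5)[OF D] restrict_space_sets[OF transportD(1)[OF D]]
    by (simp add: measurable_isomorphism_def)
  then have "inv_into D \<theta> \<in> measurable (restrict_space (mt_meas G) (\<theta> ` D)) (mt_meas F)"
    by (simp add: measurable_restrict_space2_iff)
  then have "inv_into D \<theta> \<in> measurable (restrict_space (mt_meas G) (\<theta> ` (fst s \<inter> D))) (mt_meas F)"
    by (rule measurable_restrict_mono) auto
  then show "inv_into D \<theta> \<in> measurable (restrict_space (mt_meas G) (\<theta> ` (fst s \<inter> D))) (restrict_space (mt_meas F) (fst s))"
    using transport_inj[OF D] by (auto simp: measurable_restrict_space2_iff space_restrict_space)
  show "H (y, r) \<in> leaf G u" if "u \<in> \<theta> ` (fst s \<inter> D)" "y \<in> leaf F (inv_into D \<theta> u)" for u y r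
    using that transport_leaf[OF D] transport_inj[OF D] by auto
qed

lemma elementary_transported_simplex':
  assumes "transport D \<theta>" and "elementary_simplex F T n s"
    and "continuous_map (simplex_topology m) (simplex_topology n) a"
    and "continuous_map (simplex_topology m) euclideanreal b"
  shows "elementary_simplex G T' m (transported_simplex m a b D \<theta> s)"
  using elementary_simplex_mono[OF elementary_transported_simplex[OF assms]] transportD(4)[OF assms(1)] by auto

text \<open>The map \<open>?k\<close>, which undoes \<open>\<theta>\<close> and then applies
  \<open>h\<close> and \<open>\<theta>'\<close>, is a holonomy transformation of \<open>G\<close>:
  \<open>\<theta> u\<close>, \<open>H (u, 0)\<close>, \<open>H (h u, 0)\<close> and
  \<open>\<theta>' (h u)\<close> lie on one leaf. Invariance of \<open>\<omega>\<close> under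
  \<open>?k\<close> gives the equality. As \<open>D\<close> and \<open>D'\<close> may differ, this
  is also what matches values labelled by \<open>f\<close> with values labelled by
  \<open>g\<close>.\<close>

lemma transported_value_local:
  assumes \<omega>: "l2_cochain G \<Delta> T' \<Gamma> m \<omega>"
    and D: "transport D \<theta>" and D': "transport D' \<theta>'"
    and s: "elementary_simplex F T n s" and s': "elementary_simplex F T n s'"
    and a: "continuous_map (simplex_topology m) (simplex_topology n) a"
    and b: "continuous_map (simplex_topology m) euclideanreal b"
    and h: "holonomy_transformation F E E' h" and E: "E \<subseteq> fst s \<inter> D" and E': "E' \<subseteq> fst s' \<inter> D'"
    and eq: "\<And>x t. x \<in> standard_simplex n \<Longrightarrow> t \<in> E \<Longrightarrow> snd s (x, t) = snd s' (x, h t)"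
    and t: "t \<in> E"
  shows "\<omega> (transported_simplex m a b D \<theta> s) (\<theta> t) =
    \<omega> (transported_simplex m a b D' \<theta>' s') (\<theta>' (h t))"
proof -
  have Es: "E \<in> sets (mt_meas F)" "E' \<in> sets (mt_meas F)"
    using h by (auto simp: holonomy_transformation_def transversal_def)
  note R = transport_restrict[OF D Es(1)] and R' = transport_restrict[OF D' Es(2)]
  have injE: "inj_on \<theta> E" using transport_inj[OF D] E by (auto intro: inj_on_subset)
  have hE: "h u \<in> E'" if "u \<in> E" for u
    by (rule F.reparam_in[OF h order_refl that])
  let ?k = "\<lambda>u. \<theta>' (h (inv_into E \<theta> u))"
  have k: "?k (\<theta> u) = \<theta>' (h u)" if "u \<in> E" for u
    using injE that by simp
  have "holonomy_transformation G (\<theta> ` E) (\<theta>' ` E') ?k"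
    unfolding holonomy_transformation_def
  proof (intro conjI ballI)
    show "transversal G (\<theta> ` E)"
      using R(1) E transportD(4)[OF D] by (intro transversal_subset[OF G.T]) auto
    show "transversal G (\<theta>' ` E')"
      using R'(1) E' transportD(4)[OF D'] by (intro transversal_subset[OF G.T]) auto
    have "measurable_isomorphism (restrict_space (mt_meas G) (\<theta> ` E)) (restrict_space (mt_meas F) E) (inv_into E \<theta>)"
      using measurable_isomorphism_inv[OF R(2)] E restrict_space_sets[OF Es(1)] by auto
    moreover have "measurable_isomorphism (restrict_space (mt_meas F) E) (restrict_space (mt_meas G) (\<theta>' ` E')) (\<lambda>u. \<theta>' (h u))"
    proof (rule measurable_isomorphism_compose[where h = h and k = \<theta>'])
      show "measurable_isomorphism (restrict_space (mt_meas F) E) (restrict_space (mt_meas F) E') h"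
        using h by (simp add: holonomy_transformation_def)
      show "measurable_isomorphism (restrict_space (mt_meas F) E') (restrict_space (mt_meas G) (\<theta>' ` E')) \<theta>'"
        using R'(2) E' by simp
    qed
    ultimately show "measurable_isomorphism (restrict_space (mt_meas G) (\<theta> ` E)) (restrict_space (mt_meas G) (\<theta>' ` E')) ?k"
      by (rule measurable_isomorphism_compose)
    fix v assume "v \<in> \<theta> ` E"
    then obtain u where u: "u \<in> E" "v = \<theta> u" by blast
    have "h u \<in> leaf F u" using h u by (simp add: holonomy_transformation_def)
    then have "H (h u, 0) \<in> leaf G (\<theta> u)" using transport_leaf[OF D] u E by auto
    moreover have "\<theta>' (h u) \<in> leaf G (H (h u, 0))"
      using hE[OF u(1)] E' by (auto intro: transportD(6)[OF D'])
    ultimately show "?k v \<in> leaf G v"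
      using leaf_trans k[OF u(1)] u(2) by metis
  qed
  note hol = this
  have "\<omega> (transported_simplex m a b D \<theta> s) (\<theta> t) = \<omega> (transported_simplex m a b D' \<theta>' s') (?k (\<theta> t))"
  proof (rule cochain_value_local[OF G.l2_cochain_elementary[OF \<omega>] _ _ hol])
    show "elementary_simplex G T' m (transported_simplex m a b D' \<theta>' s')"
      and "elementary_simplex G T' m (transported_simplex m a b D \<theta> s)"
      using elementary_transported_simplex' D D' s s' a b by auto
    show "\<theta> ` E \<subseteq> fst (transported_simplex m a b D \<theta> s)"
      and "\<theta>' ` E' \<subseteq> fst (transported_simplex m a b D' \<theta>' s')"
      using E E' by auto
    fix x v assume x: "x \<in> standard_simplex m" and "v \<in> \<theta> ` E"
    then obtain u where u: "u \<in> E" "v = \<theta> u" by blast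
    have ax: "a x \<in> standard_simplex n" using a x by (auto simp: continuous_map_def)
    have 1: "inv_into D \<theta> (\<theta> u) = u" "\<theta> u \<in> \<theta> ` (fst s \<inter> D)"
      using transport_inj[OF D] u E by auto
    have 2: "inv_into D' \<theta>' (\<theta>' (h u)) = h u" "\<theta>' (h u) \<in> \<theta>' ` (fst s' \<inter> D')"
      using transport_inj[OF D'] hE[OF u(1)] E' by auto
    show "snd (transported_simplex m a b D \<theta> s) (x, v) = snd (transported_simplex m a b D' \<theta>' s') (x, ?k v)"
      using 1 2 u(1) x eq[OF ax u(1)] by (simp add: u(2) k transported_simplex_def snd_simplex_transform)
  qed (use t in auto)
  then show ?thesis using k[OF t] by simp
qed

definition piece ::
    "nat \<Rightarrow> ((nat \<Rightarrow> real) \<Rightarrow> nat \<Rightarrow> real) \<Rightarrow> ((nat \<Rightarrow> real) \<Rightarrow> real) \<Rightarrow> 'a set \<Rightarrow> ('a \<Rightarrow> 'b) \<Rightarrow>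
     ('b, 'k) cochain \<Rightarrow> ('a, 'k) cochain" where
  "piece m a b D \<theta> \<omega> s t =
     (if t \<in> fst s \<inter> D then \<omega> (transported_simplex m a b D \<theta> s) (\<theta> t) else 0)"

lemma piece_measurable:
  assumes \<omega>: "l2_cochain G \<Delta> T' \<Gamma> m \<omega>"
    and D: "transport D \<theta>" and s: "elementary_simplex F T n s"
    and a: "continuous_map (simplex_topology m) (simplex_topology n) a"
    and b: "continuous_map (simplex_topology m) euclideanreal b"
  shows "piece m a b D \<theta> \<omega> s \<in> borel_measurable (restrict_space (mt_meas F) T)"
proof -
  let ?r = "transported_simplex m a b D \<theta> s"
  have SD: "fst s \<inter> D \<in> sets (mt_meas F)" "fst s \<inter> D \<subseteq> T"
    using elementary_simplexD(1,2)[OF s] transportD(1)[OF D] by auto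
  have "\<omega> ?r \<in> borel_measurable (restrict_space (mt_meas G) T')"
    using elementary_cochainD(1)[OF G.l2_cochain_elementary[OF \<omega>] elementary_transported_simplex'[OF D s a b]] .
  moreover have "\<theta> \<in> measurable (restrict_space (mt_meas F) D) (restrict_space (mt_meas G) T')"
    using transportD(4,5)[OF D] unfolding measurable_isomorphism_def measurable_restrict_space2_iff by blast
  then have "\<theta> \<in> measurable (restrict_space (mt_meas F) (fst s \<inter> D)) (restrict_space (mt_meas G) T')"
    by (rule measurable_restrict_mono) auto
  ultimately have "(\<lambda>t. \<omega> ?r (\<theta> t)) \<in> borel_measurable (restrict_space (mt_meas F) (fst s \<inter> D))"
    by (rule measurable_compose[rotated])
  then have "(\<lambda>t. \<omega> ?r (\<theta> t)) \<in> borel_measurable (restrict_space (restrict_space (mt_meas F) T) (fst s \<inter> D))"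
    using SD F.T_sets by (simp add: restrict_restrict_space Int_absorb1 Int_absorb2)
  then have "(\<lambda>t. if t \<in> fst s \<inter> D then \<omega> ?r (\<theta> t) else 0) \<in> borel_measurable (restrict_space (mt_meas F) T)"
    using SD F.sets_restrict_T by (subst (asm) measurable_restrict_space_iff[where c = 0]) (auto simp: F.space_restrict_T Int_absorb2)
  then show ?thesis by (simp add: piece_def[abs_def])
qed

lemma piece_finite:
  assumes \<omega>: "l2_cochain G \<Delta> T' \<Gamma> m \<omega>"
    and D: "transport D \<theta>" and s: "elementary_simplex F T n s"
    and a: "continuous_map (simplex_topology m) (simplex_topology n) a"
    and b: "continuous_map (simplex_topology m) euclideanreal b"
  shows "(\<integral>\<^sup>+t\<in>S. ennreal ((norm (piece m a b D \<theta> \<omega> s t))\<^sup>2) \<partial>transverse_measure F \<Lambda> T) < \<infinity>"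
proof -
  let ?r = "transported_simplex m a b D \<theta> s"
  have "(\<integral>\<^sup>+t\<in>S. ennreal ((norm (piece m a b D \<theta> \<omega> s t))\<^sup>2) \<partial>transverse_measure F \<Lambda> T)
      \<le> (\<integral>\<^sup>+t\<in>D. ennreal ((norm (\<omega> ?r (\<theta> t)))\<^sup>2) \<partial>transverse_measure F \<Lambda> T)"
    by (intro nn_integral_mono) (auto simp: piece_def split: split_indicator)
  also have "\<dots> < \<infinity>"
    by (rule transportD(7)[OF D \<omega> elementary_transported_simplex[OF D s a b]])
  finally show ?thesis .
qed

lemma piece_equiv:
  assumes \<omega>: "l2_cochain G \<Delta> T' \<Gamma> m \<omega>" "l2_cochain G \<Delta> T' \<Gamma> m \<omega>'" "cochain_equiv G \<Delta> T' m \<omega> \<omega>'"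
    and D: "transport D \<theta>" and s: "elementary_simplex F T n s"
    and a: "continuous_map (simplex_topology m) (simplex_topology n) a"
    and b: "continuous_map (simplex_topology m) euclideanreal b"
  shows "AE t in transverse_measure F \<Lambda> T. piece m a b D \<theta> \<omega> s t = piece m a b D \<theta> \<omega>' s t"
  using transportD(8)[OF D \<omega> elementary_transported_simplex[OF D s a b]]
  by eventually_elim (simp add: piece_def)

end

section \<open>Gluing two transports with disjoint domains\<close>

locale transported_family = leafwise_family F \<Lambda> T \<Gamma> G \<Delta> T' H
  for F :: "'a mt_space" and \<Lambda> T and \<Gamma> :: "'k::{real_normed_field, second_countable_topology} set"
    and G :: "'b mt_space" and \<Delta> T' H +
  fixes D1 D2 :: "'a set" and \<theta>1 \<theta>2 :: "'a \<Rightarrow> 'b"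
  assumes D1: "transport D1 \<theta>1" and D2: "transport D2 \<theta>2"
    and disj: "D1 \<inter> D2 = {}" and cover: "T \<subseteq> D1 \<union> D2"
begin

text \<open>The supports of the summands are disjoint, so this is a case distinction; written as a
  sum it inherits measurability and equivalence from the pieces.\<close>

definition transported ::
    "nat \<Rightarrow> ((nat \<Rightarrow> real) \<Rightarrow> nat \<Rightarrow> real) \<Rightarrow> ((nat \<Rightarrow> real) \<Rightarrow> real) \<Rightarrow>
     ('b, 'k) cochain \<Rightarrow> ('a, 'k) cochain" where
  "transported m a b \<omega> s t = piece m a b D1 \<theta>1 \<omega> s t + piece m a b D2 \<theta>2 \<omega> s t"

text \<open>\<open>D\<close> and \<open>\<theta>\<close> depend on \<open>t\<close> alone. All faces
  and prism pieces can therefore be evaluated at \<open>t\<close> with one and the same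
  labelling.\<close>

lemma piece_cases:
  assumes "t \<in> T"
  shows "\<exists>D \<theta>. transport D \<theta> \<and> t \<in> D \<and>
    (\<forall>m a b \<omega> s. t \<in> fst s \<longrightarrow> transported m a b \<omega> s t = \<omega> (transported_simplex m a b D \<theta> s) (\<theta> t))"
proof (cases "t \<in> D1")
  case True
  then have "t \<notin> D2" using disj by blast
  then show ?thesis using True D1 by (intro exI[of _ D1] exI[of _ \<theta>1]) (simp add: transported_def piece_def)
next
  case False
  then have "t \<in> D2" using cover assms by blast
  then show ?thesis using False D2 by (intro exI[of _ D2] exI[of _ \<theta>2]) (simp add: transported_def piece_def)
qed

lemma transported_outside: "t \<notin> fst s \<Longrightarrow> transported m a b \<omega> s t = 0"
  by (simp add: transported_def piece_def)

lemma transported_zero: "transported m a b (\<lambda>s t. 0) = (\<lambda>s t. 0)"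
  by (simp add: transported_def piece_def fun_eq_iff)

text \<open>A holonomy transformation may carry points of one piece into the other. For the given
  \<open>t\<close> it is restricted to the points that start in the piece of \<open>t\<close> and
  end in the piece of \<open>h t\<close>; there \<open>transported_value_local\<close>
  applies.\<close>

lemma transported_holonomy:
  assumes \<omega>: "l2_cochain G \<Delta> T' \<Gamma> m \<omega>"
    and s: "elementary_simplex F T n s" and s': "elementary_simplex F T n s'"
    and a: "continuous_map (simplex_topology m) (simplex_topology n) a"
    and b: "continuous_map (simplex_topology m) euclideanreal b"
    and h: "holonomy_transformation F A B h" and A: "A \<subseteq> fst s" and B: "B \<subseteq> fst s'"
    and eq: "\<And>x t. x \<in> standard_simplex n \<Longrightarrow> t \<in> A \<Longrightarrow> snd s (x, t) = snd s' (x, h t)"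
    and t: "t \<in> A"
  shows "transported m a b \<omega> s t = transported m a b \<omega> s' (h t)"
proof -
  have As: "A \<in> sets (mt_meas F)" using h by (simp add: holonomy_transformation_def transversal_def)
  have tT: "t \<in> T" using t A elementary_simplexD(1)[OF s] by auto
  have ht: "h t \<in> B" by (rule F.reparam_in[OF h order_refl t])
  then have htT: "h t \<in> T" using B elementary_simplexD(1)[OF s'] by auto
  obtain D \<theta> where D: "transport D \<theta>" "t \<in> D"
    and v: "\<And>m a b \<omega> s. t \<in> fst s \<Longrightarrow> transported m a b \<omega> s t = \<omega> (transported_simplex m a b D \<theta> s) (\<theta> t)"
    using piece_cases[OF tT] by blast
  obtain D' \<theta>' where D': "transport D' \<theta>'" "h t \<in> D'"
    and v': "\<And>m a b \<omega> s. h t \<in> fst s \<Longrightarrow>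
      transported m a b \<omega> s (h t) = \<omega> (transported_simplex m a b D' \<theta>' s) (\<theta>' (h t))"
    using piece_cases[OF htT] by blast
  define E where "E = {u \<in> A. u \<in> D \<and> h u \<in> D'}"
  have "h \<in> measurable (restrict_space (mt_meas F) A) (mt_meas F)"
    using holonomy_transformation_measurable[OF h order_refl] by (simp add: measurable_restrict_space2_iff)
  from measurable_sets[OF this transportD(1)[OF D'(1)]]
  have "h -` D' \<inter> A \<in> sets (mt_meas F)"
    using As by (simp add: restrict_space_sets sets_restrict_space_iff)
  moreover have "E = (h -` D' \<inter> A) \<inter> D" by (auto simp: E_def)
  ultimately have E: "E \<in> sets (mt_meas F)" "E \<subseteq> A"
    using transportD(1)[OF D(1)] by (auto simp: E_def)
  have hE: "h ` E \<subseteq> fst s' \<inter> D'"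
    using F.reparam_in[OF h B] by (auto simp: E_def)
  have "\<omega> (transported_simplex m a b D \<theta> s) (\<theta> t) = \<omega> (transported_simplex m a b D' \<theta>' s') (\<theta>' (h t))"
    using A t D(2) D'(2) eq E(2)
    by (intro transported_value_local[OF \<omega> D(1) D'(1) s s' a b holonomy_restrict(1)[OF h E] _ hE])
      (auto simp: E_def)
  moreover have "t \<in> fst s" "h t \<in> fst s'" using t ht A B by auto
  ultimately show ?thesis by (simp only: v v')
qed

text \<open>Values do not depend on the transport: \<open>transported_value_local\<close> is applied
  to the identity on the common domain. In the final argument this allows labels by \<open>g\<close>
  on all of \<open>Tg\<close>, although the gluing uses \<open>f\<close> on
  \<open>Tf \<inter> Tg\<close>.\<close>

lemma transported_eq:
  assumes \<omega>: "l2_cochain G \<Delta> T' \<Gamma> m \<omega>"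
    and s: "elementary_simplex F T n s"
    and a: "continuous_map (simplex_topology m) (simplex_topology n) a"
    and b: "continuous_map (simplex_topology m) euclideanreal b"
    and D': "transport D' \<theta>'" and t: "t \<in> fst s" "t \<in> D'"
  shows "transported m a b \<omega> s t = \<omega> (transported_simplex m a b D' \<theta>' s) (\<theta>' t)"
proof -
  have tT: "t \<in> T" using t elementary_simplexD(1)[OF s] by auto
  obtain D \<theta> where D: "transport D \<theta>" "t \<in> D"
    and v: "\<And>m a b \<omega> s. t \<in> fst s \<Longrightarrow> transported m a b \<omega> s t = \<omega> (transported_simplex m a b D \<theta> s) (\<theta> t)"
    using piece_cases[OF tT] by blast
  have "fst s \<inter> D \<inter> D' \<in> sets (mt_meas F)"
    using elementary_simplexD(2)[OF s] transportD(1)[OF D(1)] transportD(1)[OF D'] by auto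
  moreover have "fst s \<inter> D \<inter> D' \<subseteq> T" using elementary_simplexD(1)[OF s] by auto
  ultimately have "holonomy_transformation F (fst s \<inter> D \<inter> D') (fst s \<inter> D \<inter> D') (\<lambda>u. u)"
    by (rule F.holonomy_id)
  from transported_value_local[OF \<omega> D(1) D' s s a b this, of t]
  have "\<omega> (transported_simplex m a b D \<theta> s) (\<theta> t) = \<omega> (transported_simplex m a b D' \<theta>' s) (\<theta>' t)"
    using t D(2) by auto
  then show ?thesis using v t by simp
qed

lemma l2_cochain_transported:
  assumes \<omega>: "l2_cochain G \<Delta> T' \<Gamma> m \<omega>"
    and a: "continuous_map (simplex_topology m) (simplex_topology n) a"
    and b: "continuous_map (simplex_topology m) euclideanreal b"
  shows "l2_cochain F \<Lambda> T \<Gamma> n (transported m a b \<omega>)"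
  unfolding l2_cochain_def
proof (intro conjI allI impI)
  have meas: "piece m a b D \<theta> \<omega> s \<in> borel_measurable (restrict_space (mt_meas F) T)"
    if "transport D \<theta>" "elementary_simplex F T n s" for D \<theta> s
    by (rule piece_measurable[OF \<omega> that a b])
  note G = elementary_cochainD[OF G.l2_cochain_elementary[OF \<omega>] elementary_transported_simplex'[OF _ _ a b]]
  show "elementary_cochain F T \<Gamma> n (transported m a b \<omega>)"
    unfolding elementary_cochain_def
  proof (intro allI impI conjI ballI)
    fix s assume s: "elementary_simplex F T n s"
    show "transported m a b \<omega> s \<in> borel_measurable (restrict_space (mt_meas F) T)"
      unfolding transported_def[abs_def] using meas[OF D1 s] meas[OF D2 s] by simp
    show "transported m a b \<omega> s t \<in> \<Gamma>" for t
    proof (cases "t \<in> fst s")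
      case True
      then have "t \<in> T" using elementary_simplexD(1)[OF s] by auto
      then obtain D \<theta> where "transport D \<theta>"
        and "\<And>m a b \<omega> s. t \<in> fst s \<Longrightarrow> transported m a b \<omega> s t = \<omega> (transported_simplex m a b D \<theta> s) (\<theta> t)"
        using piece_cases by blast
      then show ?thesis using G(2) s True by auto
    qed (simp add: transported_outside F.zero_in)
    show "transported m a b \<omega> s t = 0" if "t \<notin> fst s" for t
      by (rule transported_outside[OF that])
    show "transported m a b \<omega> (simplex_restrict n S s) = (\<lambda>t. transported m a b \<omega> s t * indicator S t)"
      if S: "S \<in> sets (mt_meas F)" "S \<subseteq> fst s" for S
    proof
      fix t
      show "transported m a b \<omega> (simplex_restrict n S s) t = transported m a b \<omega> s t * indicator S t"
      proof (cases "t \<in> S")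
        case True
        have "holonomy_transformation F S S (\<lambda>u. u)"
          using S elementary_simplexD(1)[OF s] by (intro F.holonomy_id) auto
        from transported_holonomy[OF \<omega> elementary_simplex_restrict[OF s S] s a b this _ S(2) _ True]
        show ?thesis using True by (simp add: simplex_restrict_def)
      qed (simp add: transported_outside)
    qed
    show "transported m a b \<omega> (simplex_reparam n A h s) = (\<lambda>t. if t \<in> A then transported m a b \<omega> s (h t) else 0)"
      if "A \<subseteq> T \<and> B \<subseteq> fst s \<and> holonomy_transformation F A B h" for A B h
    proof
      fix t
      have AB: "A \<subseteq> T" "B \<subseteq> fst s" and h: "holonomy_transformation F A B h" using that by auto
      show "transported m a b \<omega> (simplex_reparam n A h s) t = (if t \<in> A then transported m a b \<omega> s (h t) else 0)"
        using transported_holonomy[OF \<omega> elementary_simplex_reparam[OF s h AB] s a b h _ AB(2), of t]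
        by (auto simp: simplex_reparam_def transported_outside)
    qed
  qed
  fix s assume s: "elementary_simplex F T n s"
  let ?p1 = "piece m a b D1 \<theta>1 \<omega> s" and ?p2 = "piece m a b D2 \<theta>2 \<omega> s"
  have [measurable]: "?p1 \<in> borel_measurable F.\<mu>" "?p2 \<in> borel_measurable F.\<mu>" "fst s \<in> sets F.\<mu>"
    using meas[OF D1 s] meas[OF D2 s] F.measurable_transverse_measure F.elementary_simplex_space[OF s] by auto
  have "(\<integral>\<^sup>+t\<in>fst s. ennreal ((norm (transported m a b \<omega> s t))\<^sup>2) \<partial>F.\<mu>) =
      (\<integral>\<^sup>+t. ennreal ((norm (?p1 t))\<^sup>2) * indicator (fst s) t + ennreal ((norm (?p2 t))\<^sup>2) * indicator (fst s) t \<partial>F.\<mu>)"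
    \<comment> \<open>At most one piece is nonzero at each point, so the squared norms add without a
      cross term.\<close>
    using disj by (intro nn_integral_cong) (auto simp: transported_def piece_def split: split_indicator)
  also have "\<dots> = (\<integral>\<^sup>+t\<in>fst s. ennreal ((norm (?p1 t))\<^sup>2) \<partial>F.\<mu>) + (\<integral>\<^sup>+t\<in>fst s. ennreal ((norm (?p2 t))\<^sup>2) \<partial>F.\<mu>)"
    by (rule nn_integral_add) auto
  also have "\<dots> < \<infinity>"
    using piece_finite[OF \<omega> D1 s a b] piece_finite[OF \<omega> D2 s a b] by simp
  finally show "(\<integral>\<^sup>+t\<in>fst s. ennreal ((norm (transported m a b \<omega> s t))\<^sup>2) \<partial>F.\<mu>) < \<infinity>" .
qed

lemma transported_equiv:
  assumes \<omega>: "l2_cochain G \<Delta> T' \<Gamma> m \<omega>" "l2_cochain G \<Delta> T' \<Gamma> m \<omega>'" "cochain_equiv G \<Delta> T' m \<omega> \<omega>'"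
    and a: "continuous_map (simplex_topology m) (simplex_topology n) a"
    and b: "continuous_map (simplex_topology m) euclideanreal b"
  shows "cochain_equiv F \<Lambda> T n (transported m a b \<omega>) (transported m a b \<omega>')"
proof (rule F.cochain_equivI)
  fix s assume s: "elementary_simplex F T n s"
  from piece_equiv[OF \<omega> D1 s a b] piece_equiv[OF \<omega> D2 s a b]
  show "AE t in F.\<mu>. transported m a b \<omega> s t = transported m a b \<omega>' s t"
    by eventually_elim (simp add: transported_def)
qed

end

section \<open>The prism operator\<close>

text \<open>The prism \<open>\<Delta>\<^sup>n \<times> [0,1]\<close> is the union of the images of the affine maps \<open>\<Delta>\<^sup>n\<^sup>+\<^sup>1 \<rightarrow> \<Delta>\<^sup>n \<times> [0,1]\<close> sending
  the vertices to \<open>(e\<^sub>0,0), \<dots>, (e\<^sub>i,0), (e\<^sub>i,1), \<dots>, (e\<^sub>n,1)\<close>. Their components are the \<open>i\<close>-th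
  degeneracy and the sum of the barycentric coordinates after the \<open>i\<close>-th.\<close>

definition degeneracy :: "nat \<Rightarrow> (nat \<Rightarrow> real) \<Rightarrow> nat \<Rightarrow> real" where
  "degeneracy i x = (\<lambda>k. if k < i then x k else if k = i then x i + x (Suc i) else x (Suc k))"

definition prism_height :: "nat \<Rightarrow> nat \<Rightarrow> (nat \<Rightarrow> real) \<Rightarrow> real" where
  "prism_height n i x = sum x {i..n}"

text \<open>Two neighbouring coordinates are merged into one, so nonnegativity and the total are
  preserved.\<close>

lemma degeneracy_in_standard_simplex:
  assumes i: "i \<le> n" and x: "x \<in> standard_simplex (Suc n)"
  shows "degeneracy i x \<in> standard_simplex n"
proof -
  have x0: "\<And>k. 0 \<le> x k" and xs: "\<And>k. k > Suc n \<Longrightarrow> x k = 0" and sx: "(\<Sum>k\<le>Suc n. x k) = 1"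
    using x by (auto simp: standard_simplex_def)
  have nonneg: "0 \<le> degeneracy i x k" for k using x0 by (simp add: degeneracy_def)
  have "(\<Sum>k\<le>n. degeneracy i x k) = (\<Sum>k\<in>{..<i}. x k) + (x i + x (Suc i)) + (\<Sum>k\<in>{Suc i..n}. x (Suc k))"
  proof -
    have "{..n} = {..<i} \<union> {i} \<union> {Suc i..n}" using i by auto
    then have "(\<Sum>k\<le>n. degeneracy i x k) = sum (degeneracy i x) ({..<i} \<union> {i} \<union> {Suc i..n})" by simp
    also have "\<dots> = sum (degeneracy i x) {..<i} + sum (degeneracy i x) {i} + sum (degeneracy i x) {Suc i..n}"
      by (subst sum.union_disjoint; (subst sum.union_disjoint)?) auto
    finally show ?thesis by (simp add: degeneracy_def)
  qed
  also have "(\<Sum>k\<in>{Suc i..n}. x (Suc k)) = (\<Sum>k\<in>{Suc (Suc i)..Suc n}. x k)"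
    by (rule sum.shift_bounds_cl_Suc_ivl[symmetric])
  also have "(\<Sum>k\<in>{..<i}. x k) + (x i + x (Suc i)) + (\<Sum>k\<in>{Suc (Suc i)..Suc n}. x k) = (\<Sum>k\<le>Suc n. x k)"
  proof -
    have "{..Suc n} = {..<i} \<union> {i, Suc i} \<union> {Suc (Suc i)..Suc n}" using i by auto
    then have "(\<Sum>k\<le>Suc n. x k) = sum x ({..<i} \<union> {i, Suc i} \<union> {Suc (Suc i)..Suc n})" by simp
    also have "\<dots> = sum x {..<i} + sum x {i, Suc i} + sum x {Suc (Suc i)..Suc n}"
      by (subst sum.union_disjoint; (subst sum.union_disjoint)?) auto
    finally show ?thesis by simp
  qed
  finally have s1: "(\<Sum>k\<le>n. degeneracy i x k) = 1" using sx by simp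
  have z: "degeneracy i x k = 0" if "k > n" for k
    using that i xs by (simp add: degeneracy_def)
  \<comment> \<open>\<open>standard_simplex\<close> also bounds each coordinate by 1; a term of a
    nonnegative sum is at most the total.\<close>
  have "degeneracy i x k \<le> 1" for k
  proof (cases "k \<le> n")
    case True
    then have "degeneracy i x k \<le> (\<Sum>k\<le>n. degeneracy i x k)"
      by (intro member_le_sum) (use nonneg in auto)
    then show ?thesis using s1 by simp
  qed (use z in auto)
  then show ?thesis using nonneg z s1 by (simp add: standard_simplex_def)
qed

lemma continuous_map_coordinate: "continuous_map (simplex_topology n) euclideanreal (\<lambda>x. x k)"
  unfolding simplex_topology_def
  by (intro continuous_map_from_subtopology continuous_map_product_projection) simp

lemma continuous_degeneracy:
  assumes "i \<le> n"
  shows "continuous_map (simplex_topology (Suc n)) (simplex_topology n) (degeneracy i)"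
proof -
  have "continuous_map (simplex_topology (Suc n)) euclideanreal (\<lambda>x. degeneracy i x k)" for k
    by (auto simp: degeneracy_def intro!: continuous_map_coordinate continuous_map_add)
  then have "continuous_map (simplex_topology (Suc n)) (powertop_real UNIV) (degeneracy i)"
    by (simp add: continuous_map_componentwise_UNIV)
  then show ?thesis
    using degeneracy_in_standard_simplex[OF assms]
    by (auto simp: simplex_topology_def[of n] continuous_map_in_subtopology)
qed

lemma continuous_prism_height: "continuous_map (simplex_topology m) euclideanreal (prism_height n i)"
  unfolding prism_height_def[abs_def] by (intro continuous_map_sum continuous_map_coordinate) auto

text \<open>With \<open>simplical_face\<close> as coface and \<open>degeneracy\<close> as
  codegeneracy, this and the next two lemmas are the mixed cosimplicial identities.\<close>

lemma degeneracy_face_less: "j < i \<Longrightarrow> degeneracy i (simplical_face j x) = simplical_face j (degeneracy (i - 1) x)"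
  by (auto simp: degeneracy_def simplical_face_def fun_eq_iff Suc_diff_Suc)

lemma degeneracy_face_greater: "Suc i < j \<Longrightarrow> degeneracy i (simplical_face j x) = simplical_face (j - 1) (degeneracy i x)"
  by (auto simp: degeneracy_def simplical_face_def fun_eq_iff)

lemma degeneracy_face_same: "degeneracy i (simplical_face i x) = x" "degeneracy i (simplical_face (Suc i) x) = x"
  by (auto simp: degeneracy_def simplical_face_def fun_eq_iff)

text \<open>The face inserts a zero coordinate before the range of summation and moves that range up
  by one.\<close>

lemma prism_height_face_le:
  assumes "j \<le> i" shows "prism_height (Suc n) (Suc i) (simplical_face j x) = prism_height n i x"
  using assms unfolding prism_height_def sum.shift_bounds_cl_Suc_ivl
  by (intro sum.cong) (auto simp: simplical_face_def)

text \<open>The zero is inserted inside the range of summation, which gains an index without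
  changing the sum.\<close>

lemma prism_height_face_greater:
  assumes "i < j" and "j \<le> Suc n"
  shows "prism_height (Suc n) i (simplical_face j x) = prism_height n i x"
proof -
  have 1: "{i..Suc n} = {i..<j} \<union> ({j} \<union> {Suc j..Suc n})" using assms by auto
  have 2: "{i..n} = {i..<j} \<union> {j..n}" using assms by auto
  have "(\<Sum>k\<in>{Suc j..Suc n}. simplical_face j x k) = (\<Sum>k\<in>{j..n}. x k)"
    unfolding sum.shift_bounds_cl_Suc_ivl by (intro sum.cong) (auto simp: simplical_face_def)
  moreover have "(\<Sum>k\<in>{i..<j}. simplical_face j x k) = (\<Sum>k\<in>{i..<j}. x k)"
    by (intro sum.cong) (auto simp: simplical_face_def)
  moreover have "simplical_face j x j = 0" by (simp add: simplical_face_def)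
  moreover have "sum (simplical_face j x) ({i..<j} \<union> ({j} \<union> {Suc j..Suc n})) =
      sum (simplical_face j x) {i..<j} + (simplical_face j x j + sum (simplical_face j x) {Suc j..Suc n})"
    by (subst sum.union_disjoint) auto
  moreover have "sum x ({i..<j} \<union> {j..n}) = sum x {i..<j} + sum x {j..n}"
    by (subst sum.union_disjoint) auto
  ultimately show ?thesis
    unfolding prism_height_def 1 2 by simp
qed

text \<open>\<open>A i j\<close> stands for the value on the \<open>j\<close>-th face of the
  \<open>i\<close>-th prism piece, \<open>B i j\<close> for the value on the \<open>i\<close>-th
  piece over the \<open>j\<close>-th face of the simplex. Faces with \<open>j < i\<close> or
  \<open>j > Suc i\<close> cancel against \<open>B\<close>, neighbouring pieces share the face in
  \<open>diag\<close>, and only the two ends of the prism survive.\<close>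

lemma alternating_prism_sum:
  fixes A B :: "nat \<Rightarrow> nat \<Rightarrow> 'k::comm_ring_1"
  assumes low: "\<And>i j. i \<le> n \<Longrightarrow> j < i \<Longrightarrow> A i j = B (i - 1) j"
    and high: "\<And>i j. Suc i < j \<Longrightarrow> j \<le> Suc n \<Longrightarrow> A i j = B i (j - 1)"
    and diag: "\<And>i. i < n \<Longrightarrow> A i (Suc i) = A (Suc i) (Suc i)"
  shows "(\<Sum>i\<le>n. (-1) ^ i * (\<Sum>j\<le>Suc n. (-1) ^ j * A i j)) + (\<Sum>j\<le>n. (-1) ^ j * (\<Sum>i<n. (-1) ^ i * B i j))
    = A 0 0 - A n (Suc n)"
proof -
  have row: "(\<Sum>j\<le>Suc n. (-1) ^ j * A i j) =
      (\<Sum>j<i. (-1) ^ j * B (i - 1) j) + ((-1) ^ i * A i i - (-1) ^ i * A i (Suc i))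
      - (\<Sum>j\<in>{Suc i..n}. (-1) ^ j * B i j)" if "i \<le> n" for i
  proof -
    have "{..Suc n} = {..<i} \<union> {i, Suc i} \<union> {Suc (Suc i)..Suc n}" using that by auto
    then have "(\<Sum>j\<le>Suc n. (-1) ^ j * A i j) =
        (\<Sum>j\<in>{..<i} \<union> {i, Suc i} \<union> {Suc (Suc i)..Suc n}. (-1) ^ j * A i j)" by simp
    also have "\<dots> = (\<Sum>j<i. (-1) ^ j * A i j) + (\<Sum>j\<in>{i, Suc i}. (-1) ^ j * A i j) +
        (\<Sum>j\<in>{Suc (Suc i)..Suc n}. (-1) ^ j * A i j)"
      by (subst sum.union_disjoint; (subst sum.union_disjoint)?) auto
    also have "(\<Sum>j\<in>{Suc (Suc i)..Suc n}. (-1) ^ j * A i j) = - (\<Sum>j\<in>{Suc i..n}. (-1) ^ j * B i j)"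
      unfolding sum.shift_bounds_cl_Suc_ivl sum_negf[symmetric]
      by (intro sum.cong) (auto simp: high)
    also have "(\<Sum>j<i. (-1) ^ j * A i j) = (\<Sum>j<i. (-1) ^ j * B (i - 1) j)"
      by (intro sum.cong) (auto simp: low that)
    finally show ?thesis by simp
  qed
  have "(\<Sum>i\<le>n. (-1) ^ i * (\<Sum>j\<le>Suc n. (-1) ^ j * A i j)) =
      (\<Sum>i\<le>n. (-1) ^ i * (\<Sum>j<i. (-1) ^ j * B (i - 1) j)) + (\<Sum>i\<le>n. A i i - A i (Suc i))
      - (\<Sum>i\<le>n. (-1) ^ i * (\<Sum>j\<in>{Suc i..n}. (-1) ^ j * B i j))"
  proof -
    have "(-1) ^ i * (\<Sum>j\<le>Suc n. (-1) ^ j * A i j) =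
      (-1) ^ i * (\<Sum>j<i. (-1) ^ j * B (i - 1) j) + (A i i - A i (Suc i))
      - (-1) ^ i * (\<Sum>j\<in>{Suc i..n}. (-1) ^ j * B i j)" if "i \<le> n" for i
    proof -
      have sq: "(-1) ^ i * ((-1) ^ i * z) = z" for z :: 'k
        by (simp add: mult.assoc[symmetric] flip: power_mult_distrib)
      show ?thesis unfolding row[OF that] by (simp add: algebra_simps sq)
    qed
    then show ?thesis by (simp add: sum.distrib sum_subtractf del: sum.atMost_Suc)
  qed
  \<comment> \<open>The inner sum for \<open>i = 0\<close> is empty; shifting the index by one
    produces the minus sign.\<close>
  also have "(\<Sum>i\<le>n. (-1) ^ i * (\<Sum>j<i. (-1) ^ j * B (i - 1) j)) =
      - (\<Sum>i<n. (-1) ^ i * (\<Sum>j\<le>i. (-1) ^ j * B i j))"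
  proof -
    have "(\<Sum>i\<le>n. (-1) ^ i * (\<Sum>j<i. (-1) ^ j * B (i - 1) j)) =
        (\<Sum>i<n. (-1) ^ Suc i * (\<Sum>j<Suc i. (-1) ^ j * B i j))"
      by (simp add: lessThan_Suc_atMost[symmetric] sum.lessThan_Suc_shift del: sum.lessThan_Suc)
    then show ?thesis by (simp add: lessThan_Suc_atMost sum_negf del: sum.lessThan_Suc sum.atMost_Suc)
  qed
  \<comment> \<open>For \<open>i = n\<close> the inner range \<open>{Suc n..n}\<close> is
    empty.\<close>
  also have "(\<Sum>i\<le>n. (-1) ^ i * (\<Sum>j\<in>{Suc i..n}. (-1) ^ j * B i j)) =
      (\<Sum>i<n. (-1) ^ i * (\<Sum>j\<in>{Suc i..n}. (-1) ^ j * B i j))"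
    by (simp add: lessThan_Suc_atMost[symmetric])
  \<comment> \<open>By \<open>diag\<close> the sum telescopes.\<close>
  also have "(\<Sum>i\<le>n. A i i - A i (Suc i)) = A 0 0 - A n (Suc n)"
    using diag by (induction n) auto
  finally have *: "(\<Sum>i\<le>n. (-1) ^ i * (\<Sum>j\<le>Suc n. (-1) ^ j * A i j)) = A 0 0 - A n (Suc n)
      - ((\<Sum>i<n. (-1) ^ i * (\<Sum>j\<le>i. (-1) ^ j * B i j)) + (\<Sum>i<n. (-1) ^ i * (\<Sum>j\<in>{Suc i..n}. (-1) ^ j * B i j)))"
    by simp
  have "(\<Sum>j\<le>i. (-1) ^ j * B i j) + (\<Sum>j\<in>{Suc i..n}. (-1) ^ j * B i j) = (\<Sum>j\<le>n. (-1) ^ j * B i j)"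
    if "i < n" for i
  proof -
    have "{..n} = {..i} \<union> {Suc i..n}" using that by auto
    then show ?thesis by (simp add: sum.union_disjoint)
  qed
  then have "(\<Sum>i<n. (-1) ^ i * (\<Sum>j\<le>i. (-1) ^ j * B i j)) + (\<Sum>i<n. (-1) ^ i * (\<Sum>j\<in>{Suc i..n}. (-1) ^ j * B i j))
      = (\<Sum>i<n. (-1) ^ i * (\<Sum>j\<le>n. (-1) ^ j * B i j))"
    by (simp add: sum.distrib[symmetric] distrib_left[symmetric])
  also have "\<dots> = (\<Sum>j\<le>n. (-1) ^ j * (\<Sum>i<n. (-1) ^ i * B i j))"
    unfolding sum_distrib_left by (subst sum.swap) (simp add: ac_simps)
  finally show ?thesis using * by simp
qed

context transported_family
begin

lemma id_cont: "continuous_map (simplex_topology n) (simplex_topology n) (\<lambda>x. x)"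
  by simp

text \<open>A time slice leaves the simplex variable alone, and all faces at \<open>t\<close> share
  the label \<open>\<theta> t\<close>, so the slice commutes with taking faces.\<close>

lemma coboundary_transported:
  assumes s: "elementary_simplex F T (Suc n) s"
  shows "coboundary n (transported n (\<lambda>x. x) (\<lambda>_. c) \<omega>) s t =
    transported (Suc n) (\<lambda>x. x) (\<lambda>_. c) (coboundary n \<omega>) s t"
proof (cases "t \<in> fst s")
  case True
  then have "t \<in> T" using elementary_simplexD(1)[OF s] by auto
  then obtain D \<theta> where D: "transport D \<theta>" "t \<in> D"
    and v: "\<And>m a b \<omega> s. t \<in> fst s \<Longrightarrow> transported m a b \<omega> s t = \<omega> (transported_simplex m a b D \<theta> s) (\<theta> t)"
    using piece_cases by blast
  have "transported_simplex n (\<lambda>x. x) (\<lambda>_. c) D \<theta> (elem_face n i s) =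
      elem_face n i (transported_simplex (Suc n) (\<lambda>x. x) (\<lambda>_. c) D \<theta> s)" if "i \<le> Suc n" for i
    unfolding transported_simplex_def using transport_inj[OF D(1)]
    by (subst transform_elem_face[where n = n]) (auto simp: elem_face_transform[OF that])
  then show ?thesis
    using True by (simp add: coboundary_def v del: sum.atMost_Suc)
next
  case False
  then show ?thesis by (simp add: coboundary_def transported_outside)
qed

text \<open>Lowers the degree from \<open>Suc n\<close> to \<open>n\<close>. The bounds
  \<open>Suc i\<close> and \<open>Suc n\<close> of the height refer to the vertices of the
  \<open>(n + 1)\<close>-simplex after the \<open>i\<close>-th, which are the ones at time
  1.\<close>

definition prism :: "nat \<Rightarrow> ('b, 'k) cochain \<Rightarrow> ('a, 'k) cochain" where
  "prism n \<omega> s t = (\<Sum>i\<in>{..n}. (-1) ^ i * transported (Suc n) (degeneracy i) (prism_height (Suc n) (Suc i)) \<omega> s t)"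

lemma l2_cochain_prism:
  assumes "l2_cochain G \<Delta> T' \<Gamma> (Suc n) \<omega>"
  shows "l2_cochain F \<Lambda> T \<Gamma> n (prism n \<omega>)"
  unfolding prism_def[abs_def]
  by (rule F.l2_cochain_alternating_sum)
    (auto intro!: l2_cochain_transported[OF assms] continuous_degeneracy continuous_prism_height)

text \<open>The coboundary of a cocycle vanishes only almost everywhere, so the prism operator has
  to respect null cochains.\<close>

lemma prism_equiv_zero:
  assumes "l2_cochain G \<Delta> T' \<Gamma> (Suc n) \<omega>" and "cochain_equiv G \<Delta> T' (Suc n) \<omega> (\<lambda>s t. 0)"
  shows "cochain_equiv F \<Lambda> T n (prism n \<omega>) (\<lambda>s t. 0)"
proof -
  have "cochain_equiv F \<Lambda> T n (prism n \<omega>)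
    (\<lambda>s t. \<Sum>i\<in>{..n}. (-1) ^ i * transported (Suc n) (degeneracy i) (prism_height (Suc n) (Suc i)) (\<lambda>s t. 0) s t)"
    unfolding prism_def[abs_def]
    by (rule F.cochain_equiv_alternating_sum, simp,
      rule transported_equiv[OF assms(1) G.l2_cochain_zero assms(2)])
     (auto intro: continuous_degeneracy continuous_prism_height)
  then show ?thesis by (simp add: transported_zero)
qed

text \<open>At a fixed \<open>t\<close> every simplex involved is evaluated at the same point
  \<open>\<theta> t\<close>, so the classical prism computation applies value by value. A 0-simplex
  has no faces, whence the 0 in degree 0.\<close>

lemma prism_homotopy:
  assumes s: "elementary_simplex F T n s"
  shows "prism n (coboundary n \<omega>) s t + (case n of 0 \<Rightarrow> 0 | Suc m \<Rightarrow> coboundary m (prism m \<omega>) s t) =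
    transported n (\<lambda>x. x) (\<lambda>_. 1) \<omega> s t - transported n (\<lambda>x. x) (\<lambda>_. 0) \<omega> s t"
proof (cases "t \<in> fst s")
  case True
  then have "t \<in> T" using elementary_simplexD(1)[OF s] by auto
  then obtain D \<theta> where D: "transport D \<theta>" "t \<in> D"
    and v: "\<And>m a b \<omega> s. t \<in> fst s \<Longrightarrow> transported m a b \<omega> s t = \<omega> (transported_simplex m a b D \<theta> s) (\<theta> t)"
    using piece_cases by blast
  have inS: "inv_into D \<theta> u \<in> fst s" if "u \<in> \<theta> ` (fst s \<inter> D)" for u
    using that transport_inj[OF D(1)] by auto
  \<comment> \<open>The value at \<open>t\<close> of the simplex cut out of the prism by
    \<open>(a, b)\<close>. By \<open>V_cong\<close> it depends only on \<open>a\<close> and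
    \<open>b\<close> on the standard simplex, so the terms can be compared through the identities
    for degeneracies and heights.\<close>
  define V where "V a b = \<omega> (transported_simplex n a b D \<theta> s) (\<theta> t)" for a b
  have V_cong: "V a b = V a' b'"
    if "\<And>x. x \<in> standard_simplex n \<Longrightarrow> a x = a' x \<and> b x = b' x" for a b a' b'
  proof -
    have "transported_simplex n a b D \<theta> s = transported_simplex n a' b' D \<theta> s"
      unfolding transported_simplex_def using that by (intro simplex_transform_cong) auto
    then show ?thesis by (simp add: V_def)
  qed
  define A where "A i j = V (\<lambda>x. degeneracy i (simplical_face j x))
    (\<lambda>x. prism_height (Suc n) (Suc i) (simplical_face j x))" for i j
  define B where "B i j = V (\<lambda>x. simplical_face j (degeneracy i x)) (prism_height n (Suc i))" for i j
  have "prism n (coboundary n \<omega>) s t = (\<Sum>i\<le>n. (-1) ^ i * (\<Sum>j\<le>Suc n. (-1) ^ j * A i j))"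
    unfolding prism_def using True
    by (intro sum.cong refl arg_cong2[where f = "(*)"])
      (auto simp: v coboundary_def A_def V_def transported_simplex_def elem_face_transform
        simp del: sum.atMost_Suc intro!: sum.cong)
  moreover have "(case n of 0 \<Rightarrow> 0 | Suc m \<Rightarrow> coboundary m (prism m \<omega>) s t) =
      (\<Sum>j\<le>n. (-1) ^ j * (\<Sum>i<n. (-1) ^ i * B i j))"
  proof (cases n)
    case (Suc m)
    have "transported (Suc m) (degeneracy i) (prism_height (Suc m) (Suc i)) \<omega> (elem_face m j s) t = B i j"
      if "i \<le> m" for i j
    proof -
      have "simplex_transform (Suc m) H (degeneracy i) (prism_height (Suc m) (Suc i)) (\<theta> ` (fst s \<inter> D)) (inv_into D \<theta>) (elem_face m j s) =
        simplex_transform (Suc m) H (\<lambda>x. simplical_face j (degeneracy i x)) (prism_height (Suc m) (Suc i)) (\<theta> ` (fst s \<inter> D)) (inv_into D \<theta>) s"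
        by (rule transform_elem_face[OF inS degeneracy_in_standard_simplex[OF that]])
      then show ?thesis using True Suc by (simp add: v B_def V_def transported_simplex_def)
    qed
    then show ?thesis
      by (simp add: Suc coboundary_def prism_def lessThan_Suc_atMost del: sum.atMost_Suc sum.lessThan_Suc)
  qed simp
  moreover have "(\<Sum>i\<le>n. (-1) ^ i * (\<Sum>j\<le>Suc n. (-1) ^ j * A i j)) + (\<Sum>j\<le>n. (-1) ^ j * (\<Sum>i<n. (-1) ^ i * B i j))
    = A 0 0 - A n (Suc n)"
  proof (rule alternating_prism_sum)
    show "A i j = B (i - 1) j" if "i \<le> n" "j < i" for i j
      using that prism_height_face_le[of j i n] 
      by (auto simp: A_def B_def degeneracy_face_less intro!: V_cong)
    show "A i j = B i (j - 1)" if "Suc i < j" "j \<le> Suc n" for i j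
      using that by (auto simp: A_def B_def degeneracy_face_greater prism_height_face_greater intro!: V_cong)
    \<comment> \<open>The two heights differ by the coordinate \<open>Suc i\<close>, which this face
      sets to 0.\<close>
    show "A i (Suc i) = A (Suc i) (Suc i)" if "i < n" for i
      using that by (auto simp: A_def degeneracy_face_same intro!: V_cong)
        (simp add: prism_height_def simplical_face_def sum.atLeast_Suc_atMost)
  qed
  moreover have "A 0 0 = transported n (\<lambda>x. x) (\<lambda>_. 1) \<omega> s t"
  proof -
    \<comment> \<open>The height is the sum of all barycentric coordinates of
      \<open>x\<close>.\<close>
    have "prism_height (Suc n) (Suc 0) (simplical_face 0 x) = 1" if "x \<in> standard_simplex n" for x
      using that prism_height_face_le[of 0 0 n x]
      by (simp add: prism_height_def[of n] standard_simplex_def atMost_atLeast0)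
    then show ?thesis
      unfolding A_def v[OF True] V_def[symmetric] by (intro V_cong) (auto simp: degeneracy_face_same)
  qed
  \<comment> \<open>The height is the single coordinate \<open>Suc n\<close>, which this face sets
    to 0.\<close>
  moreover have "A n (Suc n) = transported n (\<lambda>x. x) (\<lambda>_. 0) \<omega> s t"
    using True unfolding A_def v[OF True] V_def[symmetric]
    by (intro V_cong) (auto simp: degeneracy_face_same, simp add: prism_height_def simplical_face_def)
  ultimately show ?thesis by simp
next
  case False
  then have "t \<notin> fst (elem_face m i s)" for m i by simp
  then show ?thesis
    using False by (auto simp: prism_def coboundary_def transported_outside split: nat.split)
qed

lemma transported_cocycle:
  assumes "\<omega> \<in> carrier (G.cocycles n)"
  shows "transported n (\<lambda>x. x) (\<lambda>_. c) \<omega> \<in> carrier (F.cocycles n)"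
proof -
  have \<omega>: "l2_cochain G \<Delta> T' \<Gamma> n \<omega>" "cochain_equiv G \<Delta> T' (Suc n) (coboundary n \<omega>) (\<lambda>s t. 0)"
    using assms by (auto simp: G.cocycle_iff)
  have "cochain_equiv F \<Lambda> T (Suc n) (transported (Suc n) (\<lambda>x. x) (\<lambda>_. c) (coboundary n \<omega>)) (\<lambda>s t. 0)"
    using transported_equiv[OF G.l2_cochain_coboundary[OF \<omega>(1)] G.l2_cochain_zero \<omega>(2) id_cont, of "\<lambda>_. c"]
    by (simp add: transported_zero)
  moreover have "cochain_equiv F \<Lambda> T (Suc n) (coboundary n (transported n (\<lambda>x. x) (\<lambda>_. c) \<omega>))
      (transported (Suc n) (\<lambda>x. x) (\<lambda>_. c) (coboundary n \<omega>))"
    by (rule F.cochain_equiv_eqI) (rule coboundary_transported)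
  ultimately show ?thesis
    using l2_cochain_transported[OF \<omega>(1) id_cont, of "\<lambda>_. c"] F.cochain_equiv_trans by (auto simp: F.cocycle_iff)
qed

text \<open>For a cocycle the first term of \<open>prism_homotopy\<close> is null; the second is a
  coboundary in positive degree and 0 in degree 0.\<close>

lemma transported_exact:
  assumes "\<omega> \<in> carrier (G.cocycles n)"
  shows "F.exact n (\<lambda>s t. transported n (\<lambda>x. x) (\<lambda>_. 1) \<omega> s t - transported n (\<lambda>x. x) (\<lambda>_. 0) \<omega> s t)"
    (is "F.exact n ?d")
proof -
  have \<omega>: "l2_cochain G \<Delta> T' \<Gamma> n \<omega>" "cochain_equiv G \<Delta> T' (Suc n) (coboundary n \<omega>) (\<lambda>s t. 0)"
    using assms by (auto simp: G.cocycle_iff)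
  let ?c = "\<lambda>s t. case n of 0 \<Rightarrow> 0 | Suc m \<Rightarrow> coboundary m (prism m \<omega>) s t"
  have "cochain_equiv F \<Lambda> T n ?d (\<lambda>s t. prism n (coboundary n \<omega>) s t + ?c s t)"
    by (rule F.cochain_equiv_eqI) (simp only: prism_homotopy)
  moreover have "cochain_equiv F \<Lambda> T n (\<lambda>s t. prism n (coboundary n \<omega>) s t + ?c s t) (\<lambda>s t. 0 + ?c s t)"
    by (rule F.cochain_equiv_add[OF prism_equiv_zero[OF G.l2_cochain_coboundary[OF \<omega>(1)] \<omega>(2)] F.cochain_equiv_refl])
  ultimately have d: "cochain_equiv F \<Lambda> T n ?d (\<lambda>s t. 0 + ?c s t)"
    by (rule F.cochain_equiv_trans)
  show ?thesis
  proof (cases n)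
    case 0
    then show ?thesis using d by (simp add: F.exact_def)
  next
    case (Suc m)
    then show ?thesis using d l2_cochain_prism[of m \<omega>] \<omega>(1) by (auto simp: F.exact_def)
  qed
qed

end

section \<open>Homotopy invariance\<close>

text \<open>Supplies both pieces of the gluing. The comparison of measures is known relative to
  \<open>T0\<close> and \<open>T0'\<close>: cochains relative to \<open>T'\<close> are restricted to
  \<open>T0'\<close>, and integrals over \<open>D\<close> agree for the measures on \<open>T\<close>
  and on \<open>T0\<close>.\<close>

lemma (in leafwise_family) transportI:
  assumes P: "l2_injective_pullback F \<Lambda> T0 \<Gamma> G \<Delta> T0' \<phi>" and T0: "T0 \<subseteq> T" "T0' \<subseteq> T'"
    and D: "D \<in> sets (mt_meas F)" "D \<subseteq> T0"
    and leaf: "\<And>t. t \<in> D \<Longrightarrow> \<phi> t \<in> leaf G (H (t, 0))"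
  shows "transport D \<phi>"
proof -
  interpret P: l2_injective_pullback F \<Lambda> T0 \<Gamma> G \<Delta> T0' \<phi> by (rule P)
  have \<phi>D: "\<phi> ` D \<subseteq> T0'" using P.fT D(2) by auto
  have mono: "l2_cochain G \<Delta> T0' \<Gamma> m \<omega>" if "l2_cochain G \<Delta> T' \<Gamma> m \<omega>" for m \<omega>
    by (rule G.l2_cochain_mono[OF that P.G.T_sets T0(2)])
  have el: "elementary_simplex G T0' m r" if "elementary_simplex G (\<phi> ` D) m r" for m r
    using elementary_simplexD(1)[OF that] \<phi>D by (intro elementary_simplex_mono[OF that]) auto
  show ?thesis
    unfolding transport_def
  proof (intro conjI allI impI ballI)
    show "D \<in> sets (mt_meas F)" "D \<subseteq> T" "\<phi> ` D \<in> sets (mt_meas G)" "\<phi> ` D \<subseteq> T'"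
      using D T0 \<phi>D P.image_sets by auto
    show "measurable_isomorphism (restrict_space (mt_meas F) D) (restrict_space (mt_meas G) (\<phi> ` D)) \<phi>"
      by (rule P.measurable_isomorphism_image[OF D])
    show "\<phi> t \<in> leaf G (H (t, 0))" if "t \<in> D" for t by (rule leaf[OF that])
    fix m \<omega> r assume \<omega>: "l2_cochain G \<Delta> T' \<Gamma> m \<omega>" and r: "elementary_simplex G (\<phi> ` D) m r"
    have "(\<integral>\<^sup>+t\<in>D. ennreal ((norm (\<omega> r (\<phi> t)))\<^sup>2) \<partial>F.\<mu>) \<le> (\<integral>\<^sup>+t\<in>T0. ennreal ((norm (\<omega> r (\<phi> t)))\<^sup>2) \<partial>F.\<mu>)"
      using D(2) by (intro nn_integral_mono) (auto split: split_indicator)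
    also have "\<dots> = (\<integral>\<^sup>+t\<in>T0. ennreal ((norm (\<omega> r (\<phi> t)))\<^sup>2) \<partial>transverse_measure F \<Lambda> T0)"
      by (rule F.nn_integral_subset[OF P.F.T_sets T0(1) order_refl, symmetric])
    also have "\<dots> < \<infinity>" by (rule P.l2_finite_at_image[OF mono[OF \<omega>] el[OF r]])
    finally show "(\<integral>\<^sup>+t\<in>D. ennreal ((norm (\<omega> r (\<phi> t)))\<^sup>2) \<partial>F.\<mu>) < \<infinity>" .
    fix \<omega>' assume \<omega>': "l2_cochain G \<Delta> T' \<Gamma> m \<omega>'" and eq: "cochain_equiv G \<Delta> T' m \<omega> \<omega>'"
    have "AE t in transverse_measure F \<Lambda> T0. \<omega> r (\<phi> t) = \<omega>' r (\<phi> t)"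
      by (rule P.equiv_at_image[OF mono[OF \<omega>] mono[OF \<omega>'] G.cochain_equiv_mono[OF eq P.G.T_sets T0(2)] el[OF r]])
    then have "AE t in F.\<mu>. t \<in> T0 \<longrightarrow> \<omega> r (\<phi> t) = \<omega>' r (\<phi> t)"
      by (simp only: F.AE_subset[OF P.F.T_sets T0(1)])
    then show "AE t in F.\<mu>. t \<in> D \<longrightarrow> \<omega> r (\<phi> t) = \<omega>' r (\<phi> t)"
      by eventually_elim (use D(2) in auto)
  qed
qed

text \<open>If the label \<open>\<phi>\<close> is itself the slice of \<open>H\<close> at time
  \<open>c\<close>, the transported simplex is the pushed simplex. This serves for \<open>f\<close>
  at time 0 and for \<open>g\<close> at time 1; \<open>transported_eq\<close> permits a transport
  other than the two that were glued.\<close>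

lemma (in transported_family) transported_eq_pullback:
  assumes \<omega>: "l2_cochain G \<Delta> T' \<Gamma> n \<omega>" and D: "transport D \<phi>" and s: "elementary_simplex F D n s"
    and H\<phi>: "\<And>y. y \<in> topspace (mt_top F) \<Longrightarrow> H (y, c) = \<phi> y"
  shows "transported n (\<lambda>x. x) (\<lambda>_. c) \<omega> s t = pullback n \<phi> \<omega> s t"
proof (cases "t \<in> fst s")
  case True
  have sD: "fst s \<subseteq> D" by (rule elementary_simplexD(1)[OF s])
  have sT: "elementary_simplex F T n s"
    using sD transportD(2)[OF D] by (intro elementary_simplex_mono[OF s]) simp
  have inj: "inj_on \<phi> D" by (rule transport_inj[OF D])
  have "transported_simplex n (\<lambda>x. x) (\<lambda>_. c) D \<phi> s = simplex_push n \<phi> s"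
    unfolding transported_simplex_def simplex_push_eq
  proof (rule simplex_transform_cong)
    show "\<phi> ` (fst s \<inter> D) = \<phi> ` fst s" using sD by (simp add: Int_absorb2)
    fix x u assume x: "x \<in> standard_simplex n" and "u \<in> \<phi> ` fst s"
    then obtain v where v: "v \<in> fst s" "u = \<phi> v" by blast
    have "inv_into D \<phi> u = v" "inv_into (fst s) \<phi> u = v"
      using v sD inj inj_on_subset[OF inj sD] by auto
    moreover have "snd s (x, v) \<in> topspace (mt_top F)"
      by (rule leaf_in_topspace[OF elementary_simplexD(3)[OF s x v(1)]])
    ultimately show "H (snd s (x, inv_into D \<phi> u), c) = \<phi> (fst (snd s (x, inv_into (fst s) \<phi> u), 0 :: real))"
      by (simp add: H\<phi>)
  qed
  then show ?thesis
    using True sD transported_eq[OF \<omega> sT id_cont _ D True, of "\<lambda>_. c"] by (auto simp: pullback_def)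
qed (simp add: pullback_def transported_outside)

text \<open>The witness is \<open>T \<times> {0}\<close>: on it \<open>H\<close> agrees with
  \<open>f\<close>, it meets every leaf \<open>L \<times> \<real>\<close>, and its projection is
  injective, so \<open>\<Lambda>'\<close> gives it the finite measure of \<open>T\<close>.\<close>

lemma comparable_homotopy:
  assumes F: "is_mt_space F" and H: "mt_homotopy F G f g H" and f: "comparable F \<Lambda> G \<Delta> f"
    and \<Lambda>': "line_induced_measure F \<Lambda> \<Lambda>'"
  shows "comparable (times_line F) \<Lambda>' G \<Delta> H"
proof -
  obtain T T' where c: "comparison_transversals F \<Lambda> G \<Delta> f T T'"
    using f by (auto simp: comparable_def)
  have T: "transversal F T" and complete: "\<And>L. L \<in> leaves F \<Longrightarrow> T \<inter> L \<noteq> {}"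
    using c by (auto simp: comparison_transversals_def complete_transversal_def)
  have fT: "\<Lambda> T < \<infinity>" "f ` T \<subseteq> T'" "inj_on f T" "complete_transversal G T'" "\<Delta> T' < \<infinity>"
    using c by (auto simp: comparison_transversals_def)
  let ?T = "T \<times> {0 :: real}"
  have leaves: "\<exists>L\<in>leaves F. K = L \<times> UNIV" if K: "K \<in> leaves (times_line F)" for K
  proof -
    obtain x r where xr: "x \<in> topspace (mt_top F)" "K = leaf (times_line F) (x, r)"
      using K by (auto simp: leaves_def leaf_def connected_components_of_def times_line_def)
    then have "K = leaf F x \<times> UNIV" by (simp add: leaf_times_line)
    moreover have "leaf F x \<in> leaves F" using xr by (auto simp: leaves_def leaf_def connected_components_of_def)
    ultimately show ?thesis by blast
  qed
  have tr: "transversal (times_line F) ?T"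
    unfolding transversal_def
  proof (intro conjI ballI)
    show "?T \<in> sets (mt_meas (times_line F))"
      using T by (auto simp: times_line_def transversal_def intro!: pair_measureI)
    fix K assume "K \<in> leaves (times_line F)"
    then obtain L where L: "L \<in> leaves F" "K = L \<times> UNIV" using leaves by blast
    then have "?T \<inter> K = (T \<inter> L) \<times> {0}" by auto
    moreover have "countable (T \<inter> L)" using T L by (auto simp: transversal_def)
    ultimately show "countable (?T \<inter> K)" by simp
  qed
  have "?T \<inter> K \<noteq> {}" if "K \<in> leaves (times_line F)" for K
    using leaves[OF that] complete by fastforce
  moreover have "\<Lambda>' ?T < \<infinity>"
  proof -
    have "inj_on fst ?T" by (auto simp: inj_on_def)
    then have "\<Lambda>' ?T = \<Lambda> (fst ` ?T)" using \<Lambda>' tr by (auto simp: line_induced_measure_def)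
    then show ?thesis using fT by simp
  qed
  moreover have H0: "H (t, 0) = f t" if "t \<in> T" for t
  proof -
    have "t \<in> space (mt_meas F)"
      using T that by (auto simp: transversal_def dest: sets.sets_into_space)
    then show ?thesis using H by (simp add: mt_homotopy_def mt_space_eq[OF F])
  qed
  moreover have "inj_on H ?T" using fT(3) H0 by (auto simp: inj_on_def)
  moreover have "H ` ?T \<subseteq> T'" using fT(2) H0 by auto
  ultimately have "comparison_transversals (times_line F) \<Lambda>' G \<Delta> H ?T T'"
    using tr fT by (auto simp: comparison_transversals_def complete_transversal_def)
  then show ?thesis using H by (auto simp: comparable_def mt_homotopy_def)
qed

theorem proposition4p4:
  fixes F :: "'a mt_space" and G :: "'b mt_space"
    and \<Lambda> :: "'a set \<Rightarrow> ennreal" and \<Delta> :: "'b set \<Rightarrow> ennreal"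
    and f g :: "'a \<Rightarrow> 'b" and H :: "'a \<times> real \<Rightarrow> 'b"
    and \<Gamma> :: "'k::{real_normed_field, second_countable_topology} set"
  assumes "standing_assumptions F \<Lambda>" and "standing_assumptions G \<Delta>"
    and "measurable_subgroup \<Gamma>"
    and "comparable F \<Lambda> G \<Delta> f" and "comparable F \<Lambda> G \<Delta> g"
    and "mt_homotopy F G f g H"
  shows "(\<forall>\<Lambda>'. line_induced_measure F \<Lambda> \<Lambda>' \<longrightarrow> comparable (times_line F) \<Lambda>' G \<Delta> H) \<and>
    (\<forall>Tf Tf' Tg Tg'.
       comparison_transversals F \<Lambda> G \<Delta> f Tf Tf' \<and> l2_pullback_defined F \<Lambda> G \<Delta> \<Gamma> f Tf Tf' \<and>
       comparison_transversals F \<Lambda> G \<Delta> g Tg Tg' \<and> l2_pullback_defined F \<Lambda> G \<Delta> \<Gamma> g Tg Tg' \<longrightarrow>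
       (\<forall>n.
          l2_induced F \<Lambda> Tf \<Gamma> n f \<in> hom (l2_cohomology G \<Delta> Tf' \<Gamma> n) (l2_cohomology F \<Lambda> Tf \<Gamma> n) \<and>
          l2_induced F \<Lambda> Tg \<Gamma> n g \<in> hom (l2_cohomology G \<Delta> Tg' \<Gamma> n) (l2_cohomology F \<Lambda> Tg \<Gamma> n) \<and>
          (\<forall>c\<in>carrier (l2_cohomology G \<Delta> Tf' \<Gamma> n). \<forall>c'\<in>carrier (l2_cohomology G \<Delta> Tg' \<Gamma> n).
             l2_identified G \<Delta> \<Gamma> n Tf' Tg' c c' \<longrightarrow>
             l2_identified F \<Lambda> \<Gamma> n Tf Tg (l2_induced F \<Lambda> Tf \<Gamma> n f c)
                                       (l2_induced F \<Lambda> Tg \<Gamma> n g c'))))"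
proof (intro conjI allI impI)
  have lam: "measurable_lamination F" "measurable_lamination G"
    and tim: "transverse_invariant_measure F \<Lambda>" "transverse_invariant_measure G \<Delta>"
    using assms(1,2) by (auto simp: standing_assumptions_def)
  have mt: "is_mt_space F" "is_mt_space G"
    using lam by (auto simp: measurable_lamination_def)
  show "comparable (times_line F) \<Lambda>' G \<Delta> H" if "line_induced_measure F \<Lambda> \<Lambda>'" for \<Lambda>'
    by (rule comparable_homotopy[OF mt(1) assms(6,4) that])
  fix Tf Tf' Tg Tg'
  assume *: "comparison_transversals F \<Lambda> G \<Delta> f Tf Tf' \<and> l2_pullback_defined F \<Lambda> G \<Delta> \<Gamma> f Tf Tf' \<and>
       comparison_transversals F \<Lambda> G \<Delta> g Tg Tg' \<and> l2_pullback_defined F \<Lambda> G \<Delta> \<Gamma> g Tg Tg'"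
  have inj_pullback: "l2_injective_pullback F \<Lambda> T \<Gamma> G \<Delta> T' \<phi>"
    if "comparison_transversals F \<Lambda> G \<Delta> \<phi> T T'" "l2_pullback_defined F \<Lambda> G \<Delta> \<Gamma> \<phi> T T'" "comparable F \<Lambda> G \<Delta> \<phi>"
    for \<phi> T T'
  proof -
    have "l2_complex F \<Lambda> T \<Gamma>" "l2_complex G \<Delta> T' \<Gamma>"
      using that(1) mt tim assms(3)
      by (auto simp: l2_complex_def comparison_transversals_def complete_transversal_def)
    moreover have "mt_map F G \<phi>" using that(3) by (simp add: comparable_def countable_to_one_def)
    ultimately show ?thesis
      using that(1,2) measurable_lamination_singleton[OF lam(1)] measurable_lamination_singleton[OF lam(2)]
      by (simp add: l2_injective_pullback_def l2_injective_pullback_axioms_def l2_pullback_def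
          l2_pullback_axioms_def comparison_transversals_def)
  qed
  interpret f: l2_injective_pullback F \<Lambda> Tf \<Gamma> G \<Delta> Tf' f using * assms(4) by (intro inj_pullback) auto
  interpret g: l2_injective_pullback F \<Lambda> Tg \<Gamma> G \<Delta> Tg' g using * assms(5) by (intro inj_pullback) auto
  fix n
  show "l2_induced F \<Lambda> Tf \<Gamma> n f \<in> hom (l2_cohomology G \<Delta> Tf' \<Gamma> n) (l2_cohomology F \<Lambda> Tf \<Gamma> n)"
    by (rule f.l2_induced_hom)
  show "l2_induced F \<Lambda> Tg \<Gamma> n g \<in> hom (l2_cohomology G \<Delta> Tg' \<Gamma> n) (l2_cohomology F \<Lambda> Tg \<Gamma> n)"
    by (rule g.l2_induced_hom)
  let ?T = "Tf \<union> Tg" and ?T' = "Tf' \<union> Tg'"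
  interpret FT: l2_complex F \<Lambda> ?T \<Gamma>
    using mt tim assms(3) transversal_Un[OF f.F.T g.F.T] by (simp add: l2_complex_def)
  interpret GT: l2_complex G \<Delta> ?T' \<Gamma>
    using mt tim assms(3) transversal_Un[OF f.G.T g.G.T] by (simp add: l2_complex_def)
  have Hmap: "mt_map (times_line F) G H"
    using assms(6) by (simp add: mt_homotopy_def countable_to_one_def)
  interpret leafwise_family F \<Lambda> ?T \<Gamma> G \<Delta> ?T' H
    by unfold_locales (rule Hmap)
  have H01: "H (y, 0) = f y" "H (y, 1) = g y" if "y \<in> topspace (mt_top F)" for y
    using assms(6) that by (auto simp: mt_homotopy_def)
  have tf: "transport D f" if "D \<in> sets (mt_meas F)" "D \<subseteq> Tf" for D
  proof (rule transportI[OF f.l2_injective_pullback_axioms _ _ that])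
    fix t assume t: "t \<in> D"
    then have t': "t \<in> topspace (mt_top F)" using that(2) f.F.T_topspace by auto
    then show "f t \<in> leaf G (H (t, 0))"
      using H_leaf[OF leaf_refl[OF t'], of 0 0] by (simp add: H01)
  qed auto
  \<comment> \<open>\<open>g t\<close> is the value of \<open>H\<close> at time 1, but
    \<open>H_leaf\<close> places it on the leaf of the value at time 0, as \<open>transport\<close>
    demands.\<close>
  have tg: "transport D g" if "D \<in> sets (mt_meas F)" "D \<subseteq> Tg" for D
  proof (rule transportI[OF g.l2_injective_pullback_axioms _ _ that])
    fix t assume t: "t \<in> D"
    then have t': "t \<in> topspace (mt_top F)" using that(2) g.F.T_topspace by auto
    then show "g t \<in> leaf G (H (t, 0))"
      using H_leaf[OF leaf_refl[OF t'], of 1 0] by (simp add: H01)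
  qed auto
  \<comment> \<open>The domains are made disjoint in \<open>F\<close>; the images under
    \<open>f\<close> and \<open>g\<close> may still overlap in \<open>G\<close>.\<close>
  interpret transported_family F \<Lambda> ?T \<Gamma> G \<Delta> ?T' H Tf "Tg - Tf" f g
    by unfold_locales (use tf tg f.F.T_sets g.F.T_sets in auto)
  show "\<forall>c\<in>carrier (l2_cohomology G \<Delta> Tf' \<Gamma> n). \<forall>c'\<in>carrier (l2_cohomology G \<Delta> Tg' \<Gamma> n).
     l2_identified G \<Delta> \<Gamma> n Tf' Tg' c c' \<longrightarrow>
     l2_identified F \<Lambda> \<Gamma> n Tf Tg (l2_induced F \<Lambda> Tf \<Gamma> n f c) (l2_induced F \<Lambda> Tg \<Gamma> n g c')"
  proof (intro ballI impI)
    fix c c' assume "l2_identified G \<Delta> \<Gamma> n Tf' Tg' c c'"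
    \<comment> \<open>Both \<open>c\<close> and \<open>c'\<close> are restrictions of one class on
      the union, so the two pullbacks can be computed from the same representative.\<close>
    then obtain \<omega> where \<omega>: "\<omega> \<in> carrier (GT.cocycles n)"
      and c: "c = l2_restrict G \<Delta> \<Gamma> n Tf' (GT.cohomology_class n \<omega>)"
      and c': "c' = l2_restrict G \<Delta> \<Gamma> n Tg' (GT.cohomology_class n \<omega>)"
      by (auto simp: l2_identified_def GT.carrier_l2_cohomology)
    have \<omega>l: "l2_cochain G \<Delta> ?T' \<Gamma> n \<omega>" using \<omega> by (simp add: GT.cocycle_iff)
    have \<omega>f: "\<omega> \<in> carrier (f.G.cocycles n)" and \<omega>g: "\<omega> \<in> carrier (g.G.cocycles n)"
      using GT.cocycles_subset[OF f.G.T_sets, of n] GT.cocycles_subset[OF g.G.T_sets, of n] \<omega> by auto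
    define \<eta> where "\<eta> = transported n (\<lambda>x. x) (\<lambda>_. 0) \<omega>"
    have \<eta>: "\<eta> \<in> carrier (FT.cocycles n)"
      unfolding \<eta>_def by (rule transported_cocycle[OF \<omega>])
    have \<eta>f: "\<eta> \<in> carrier (f.F.cocycles n)" and \<eta>g: "\<eta> \<in> carrier (g.F.cocycles n)"
      using FT.cocycles_subset[OF f.F.T_sets, of n] FT.cocycles_subset[OF g.F.T_sets, of n] \<eta> by auto
    have "l2_induced F \<Lambda> Tf \<Gamma> n f c = f.F.cohomology_class n (pullback n f \<omega>)"
      unfolding c GT.l2_restrict_cohomology_class[OF f.G.T_sets Un_upper1 \<omega>]
      by (rule f.l2_induced_cohomology_class[OF \<omega>f])
    also have "\<dots> = f.F.cohomology_class n \<eta>"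
    proof (rule f.F.cohomology_class_eqI[OF f.pullback_cocycle[OF \<omega>f] \<eta>f], rule f.F.exact_if_equiv_zero,
        rule f.F.cochain_equiv_eqI)
      fix s t assume s: "elementary_simplex F Tf n s"
      show "pullback n f \<omega> s t - \<eta> s t = 0"
        using transported_eq_pullback[OF \<omega>l tf[OF f.F.T_sets order_refl] s H01(1)] by (simp add: \<eta>_def)
    qed
    also have "\<dots> = l2_restrict F \<Lambda> \<Gamma> n Tf (FT.cohomology_class n \<eta>)"
      by (rule FT.l2_restrict_cohomology_class[OF f.F.T_sets Un_upper1 \<eta>, symmetric])
    finally have 1: "l2_restrict F \<Lambda> \<Gamma> n Tf (FT.cohomology_class n \<eta>) = l2_induced F \<Lambda> Tf \<Gamma> n f c" ..
    have "l2_induced F \<Lambda> Tg \<Gamma> n g c' = g.F.cohomology_class n (pullback n g \<omega>)"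
      unfolding c' GT.l2_restrict_cohomology_class[OF g.G.T_sets Un_upper2 \<omega>]
      by (rule g.l2_induced_cohomology_class[OF \<omega>g])
    also have "\<dots> = g.F.cohomology_class n \<eta>"
    proof (rule g.F.cohomology_class_eqI[OF g.pullback_cocycle[OF \<omega>g] \<eta>g])
      let ?\<eta>1 = "transported n (\<lambda>x. x) (\<lambda>_. 1) \<omega>"
      have "?\<eta>1 \<in> carrier (FT.cocycles n)" by (rule transported_cocycle[OF \<omega>])
      then have "(\<lambda>s t. ?\<eta>1 s t - \<eta> s t) \<in> FT.coboundaries n"
        using transported_exact[OF \<omega>] FT.cocycle_diff \<eta> by (simp add: FT.coboundaries_iff \<eta>_def)
      then have "(\<lambda>s t. ?\<eta>1 s t - \<eta> s t) \<in> g.F.coboundaries n"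
        using FT.coboundaries_subset[OF g.F.T_sets, of n] by auto
      then have 1: "g.F.exact n (\<lambda>s t. ?\<eta>1 s t - \<eta> s t)" by (simp add: g.F.coboundaries_iff)
      have "cochain_equiv F \<Lambda> Tg n (\<lambda>s t. ?\<eta>1 s t - pullback n g \<omega> s t) (\<lambda>s t. 0)"
      proof (rule g.F.cochain_equiv_eqI)
        fix s t assume s: "elementary_simplex F Tg n s"
        show "?\<eta>1 s t - pullback n g \<omega> s t = 0"
          using transported_eq_pullback[OF \<omega>l tg[OF g.F.T_sets order_refl] s H01(2)] by simp
      qed
      \<comment> \<open>Subtracting the null difference of \<open>?\<eta>1\<close> and the pullback
        from the exact difference of \<open>?\<eta>1\<close> and \<open>\<eta>\<close> leaves the
        pullback minus \<open>\<eta>\<close>.\<close>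
      from g.F.exact_diff[OF 1 g.F.exact_if_equiv_zero[OF this]]
      show "g.F.exact n (\<lambda>s t. pullback n g \<omega> s t - \<eta> s t)" by simp
    qed
    also have "\<dots> = l2_restrict F \<Lambda> \<Gamma> n Tg (FT.cohomology_class n \<eta>)"
      by (rule FT.l2_restrict_cohomology_class[OF g.F.T_sets Un_upper2 \<eta>, symmetric])
    finally have 2: "l2_restrict F \<Lambda> \<Gamma> n Tg (FT.cohomology_class n \<eta>) = l2_induced F \<Lambda> Tg \<Gamma> n g c'" ..
    have "FT.cohomology_class n \<eta> \<in> carrier (l2_cohomology F \<Lambda> ?T \<Gamma> n)"
      using \<eta> by (auto simp: FT.carrier_l2_cohomology)
    then show "l2_identified F \<Lambda> \<Gamma> n Tf Tg (l2_induced F \<Lambda> Tf \<Gamma> n f c) (l2_induced F \<Lambda> Tg \<Gamma> n g c')"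
      using 1 2 unfolding l2_identified_def by blast
  qed
qed

end
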